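(* Let $(X,d)$ be a path-connected, locally path-connected metric space, $x_0\in X$, let $F_S$ be the free group on a finite set $S$, acting on $X$ by homeomorphisms, and let $\theta\ge1$. Assume that $(X,d)$ has homotopy rectifiable paths and that the warped space $(X,\delta_S)$ is jumping-geodesic. Then the discretisation homomorphism $\mathcal{D}\colon J_S\Pi_1(X,x_0)\to\pi_{1,\theta}((X,\delta_S),x_0)$ is surjective and its kernel is the subgroup generated by $\mathrm{FT}_\theta$. Therefore $$\pi_{1,\theta}\bigl((X,\delta_S),x_0\bigr)\cong J_S\Pi_1(X,x_0)/\langle \mathrm{FT}_\theta\rangle.$$
   Context: Warped metric. $\delta_S$ is the largest metric on $X$ with $\delta_S\le d$ and $\delta_S(x,s\cdot x)\le1$ for all $x\in X$, $s\in S$. Discrete fundamental group. For a metric space $(Z,\rho)$ and $\theta>0$, a $\theta$-path is a sequence $(z_0,\dots,z_n)$ with $\rho(z_i,z_{i+1})\le\theta$, viewed as a $\theta$-Lipschitz map $[n]=\{0,\dots,n\}\to Z$. A lazification is a precomposition with a surjective monotone map $[m]\to[n]$. Two $\theta$-paths of the same length $n$ are $\theta$-grid homotopic if there is a $\theta$-Lipschitz map $H\colon[n]\times[m]\to Z$ ($\ell^1$ metric on the source) restricting to them on $[n]\times\{0\}$ and $[n]\times\{m\}$, with $H(0,\cdot)$ and $H(n,\cdot)$ constant. $\pi_{1,\theta}(Z,z_0)$ is the group of closed $\theta$-paths based at $z_0$ modulo the equivalence relation generated by lazifications and $\theta$-grid homotopies, with concatenation. Jumping-paths. A jumping-path $\gamma_0\stackrel{\vec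 s_1}{\rightsquigarrow}\gamma_1\cdots\stackrel{\vec s_n}{\rightsquigarrow}\gamma_n$ is a finite sequence of continuous paths $\gamma_i\colon[0,1]\to X$ and elements $\vec s_i\in S\cup S^{-1}$ with $\gamma_i(0)=\vec s_i\cdot\gamma_{i-1}(1)$. Its length is $n+\sum_i\|\gamma_i\|$, with $\|\gamma_i\|$ the length in $(X,d)$. $(X,\delta_S)$ is jumping-geodesic if $(X,d)$ is a geodesic metric space and any two points $x,y\in X$ are joined by a jumping-path of length exactly $\delta_S(x,y)$. $(X,d)$ has homotopy rectifiable paths if every continuous path is homotopic (rel endpoints) to one of finite length. Homotopy. Two jumping-paths with the same jumps $\vec s_1,\dots,\vec s_n$ and pieces $\gamma_i$, $\gamma'_i$ are spatially-homotopic if there are free homotopies $H_i$ from $\gamma_i=H_i(\cdot,0)$ to $\gamma_i'=H_i(\cdot,1)$ with $H_0(0,t)=\gamma_0(0)=\gamma'_0(0)$, $H_n(1,t)=\gamma_n(1)=\gamma_n'(1)$ and $H_i(0,t)=\vec s_i\cdot H_{i-1}(1,t)$ for all $t$ and $i\ge1$. Removing two consecutive jumps $\stackrel{\vec s}{\rightsquigarrow}\stackrel{\vec s^{\,-1}}{\rightsquigarrow}$ separated by a constant path is a contraction, the inverse is an extension. Homotopy is the equivalence relation generated by spatial homotopies, contractions and extensions. $J_S\Pi_1(X,x_0)$ is the group of homotopy classes of closed jumping-paths based at $x_0$, with concatenation. A free homotopy of closed jumping-paths is defined similarly, but the spatial homotopies need not fix the endpoints as long as $H_0(0,t)=H_n(1,t)$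 for all $t$, and cyclic contractions and extensions are also allowed (i.e. $x_0\stackrel{\vec s}{\rightsquigarrow}\vec\gamma\stackrel{\vec s^{\,-1}}{\rightsquigarrow}x_0$ is freely homotopic to $\vec\gamma$). Discretisation. A $\theta$-discretisation of a continuous path $\gamma$ is a sequence $(\gamma(t_0),\dots,\gamma(t_m))$ with $0=t_0<\dots<t_m=1$ and $\gamma([t_{i-1},t_i])$ contained in the closed $d$-ball of radius $\theta$ about $\gamma(t_{i-1})$. The discretisation of a jumping-path is the $\theta$-path in $(X,\delta_S)$ obtained by concatenating discretisations of its continuous pieces and its jumps (each jump being a step of a $\theta$-path, as $\theta\ge1$). This is well defined on homotopy classes and gives the homomorphism $\mathcal{D}$. $\mathcal{T}_\theta$ is the set of closed jumping-paths (with any base point) that are concatenations $\vec\gamma_0\vec\gamma_1\vec\gamma_2\vec\gamma_3$ of four (not necessarily closed) jumping-paths of length at most $\theta$, and $\mathrm{FT}_\theta\subseteq J_S\Pi_1(X,x_0)$ is the set of classes $[\vec\gamma]$ of closed jumping-paths $\vec\gamma$ based at $x_0$ that are freely homotopic to an element of $\mathcal{T}_\theta$. *)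

theory Defs
  imports "HOL-Analysis.Analysis" "HOL-Algebra.Group_Action" "HOL-Algebra.Generated_Groups"
begin

section \<open>The free group on a set\<close>

datatype 's letter = Gen 's | GenInv 's

fun generator_of :: "'s letter \<Rightarrow> 's" where
  "generator_of (Gen s) = s"
| "generator_of (GenInv s) = s"

fun letter_inv :: "'s letter \<Rightarrow> 's letter" where
  "letter_inv (Gen s) = GenInv s"
| "letter_inv (GenInv s) = Gen s"

definition letters :: "'s set \<Rightarrow> 's letter set" where
  "letters S = {l. generator_of l \<in> S}"

fun reduced :: "'s letter list \<Rightarrow> bool" where
  "reduced (a # b # w) \<longleftrightarrow> b \<noteq> letter_inv a \<and> reduced (b # w)"
| "reduced _ \<longleftrightarrow> True"

fun letter_mult :: "'s letter \<Rightarrow> 's letter list \<Rightarrow> 's letter list" where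
  "letter_mult a [] = [a]"
| "letter_mult a (b # w) = (if b = letter_inv a then w else a # b # w)"

definition free_group :: "'s set \<Rightarrow> 's letter list monoid" where
  "free_group S =
     \<lparr>carrier = {w. reduced w \<and> set w \<subseteq> letters S},
      mult = (\<lambda>u v. foldr letter_mult u v),
      one = []\<rparr>"

lemma letter_inv_inv [simp]: "letter_inv (letter_inv a) = a"
  by (cases a) auto

lemma letter_inv_in_letters [simp]: "letter_inv a \<in> letters S \<longleftrightarrow> a \<in> letters S"
  by (cases a) (auto simp: letters_def)

lemma reduced_ConsD: "reduced (a # w) \<Longrightarrow> reduced w"
  by (cases w) auto

lemma reduced_letter_mult: "reduced w \<Longrightarrow> reduced (letter_mult a w)"
  by (cases w) (auto dest: reduced_ConsD)

lemma letter_mult_cancel: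
  assumes "reduced w"
  shows "letter_mult (letter_inv a) (letter_mult a w) = w"
  using assms
proof (cases w)
  case (Cons b v)
  with assms show ?thesis by (cases v) auto
qed simp

lemma letter_mult_reduced_Cons: "reduced (a # w) \<Longrightarrow> letter_mult a w = a # w"
  by (cases w) auto

lemma set_letter_mult: "set (letter_mult a w) \<subseteq> insert a (set w)"
  by (cases w) auto

lemma reduced_foldr_letter_mult: "reduced v \<Longrightarrow> reduced (foldr letter_mult u v)"
  by (induction u) (auto intro: reduced_letter_mult)

lemma set_foldr_letter_mult: "set (foldr letter_mult u v) \<subseteq> set u \<union> set v"
proof (induction u)
  case (Cons a u)
  then show ?case using set_letter_mult[of a "foldr letter_mult u v"] by auto
qed simp

lemma foldr_letter_mult_letter_mult:
  assumes "reduced v"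
  shows "foldr letter_mult (letter_mult a w) v = letter_mult a (foldr letter_mult w v)"
proof (cases w)
  case (Cons b w')
  show ?thesis
  proof (cases "b = letter_inv a")
    case True
    have "letter_mult (letter_inv b) (letter_mult b (foldr letter_mult w' v)) = foldr letter_mult w' v"
      by (intro letter_mult_cancel reduced_foldr_letter_mult assms)
    then show ?thesis using True Cons by simp
  qed (use Cons in auto)
qed simp

lemma foldr_letter_mult_assoc:
  assumes "reduced v" "reduced w"
  shows "foldr letter_mult (foldr letter_mult u v) w = foldr letter_mult u (foldr letter_mult v w)"
  using assms by (induction u) (auto simp: foldr_letter_mult_letter_mult)

lemma foldr_letter_mult_Nil: "reduced u \<Longrightarrow> foldr letter_mult u [] = u"
proof (induction u)
  case (Cons a u)
  then show ?case using reduced_ConsD[of a u] letter_mult_reduced_Cons[of a u] by simp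
qed simp

lemma foldr_letter_mult_inverse:
  "\<exists>v. reduced v \<and> set v \<subseteq> letters S \<and> foldr letter_mult v u = []"
  if "reduced u" "set u \<subseteq> letters S"
  using that
proof (induction u)
  case Nil
  then show ?case by (intro exI[of _ "[]"]) auto
next
  case (Cons a u)
  then obtain v where v: "reduced v" "set v \<subseteq> letters S" "foldr letter_mult v u = []"
    by (auto dest: reduced_ConsD)
  let ?v = "foldr letter_mult v [letter_inv a]"
  have u: "reduced u" using Cons.prems reduced_ConsD by blast
  have "foldr letter_mult ?v (a # u)
      = foldr letter_mult v (foldr letter_mult [letter_inv a] (a # u))"
    using Cons.prems by (intro foldr_letter_mult_assoc) auto
  also have "\<dots> = []"
    using v by simp
  finally have "foldr letter_mult ?v (a # u) = []" .
  moreover have "reduced ?v"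
    by (rule reduced_foldr_letter_mult) simp
  moreover have "set ?v \<subseteq> letters S"
    using set_foldr_letter_mult[of v "[letter_inv a]"] v Cons.prems by auto
  ultimately show ?case by blast
qed

theorem group_free_group: "group (free_group S)"
proof (rule groupI)
  fix u v assume uv: "u \<in> carrier (free_group S)" "v \<in> carrier (free_group S)"
  show "u \<otimes>\<^bsub>free_group S\<^esub> v \<in> carrier (free_group S)"
    using uv set_foldr_letter_mult[of u v]
    by (auto simp: free_group_def intro: reduced_foldr_letter_mult)
next
  fix u assume "u \<in> carrier (free_group S)"
  then show "\<exists>v\<in>carrier (free_group S). v \<otimes>\<^bsub>free_group S\<^esub> u = \<one>\<^bsub>free_group S\<^esub>"
    using foldr_letter_mult_inverse[of u S] by (auto simp: free_group_def)
qed (auto simp: free_group_def foldr_letter_mult_assoc)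

definition acts_by_homeomorphisms ::
    "'s set \<Rightarrow> ('s letter list \<Rightarrow> 'a::topological_space \<Rightarrow> 'a) \<Rightarrow> bool" where
  "acts_by_homeomorphisms S \<phi> \<longleftrightarrow>
     group_action (free_group S) UNIV \<phi> \<and>
     (\<forall>w\<in>carrier (free_group S). homeomorphic_map euclidean euclidean (\<phi> w))"


section \<open>Metric notions\<close>

definition is_warping_metric ::
    "'s set \<Rightarrow> ('s letter list \<Rightarrow> 'a::metric_space \<Rightarrow> 'a) \<Rightarrow> ('a \<Rightarrow> 'a \<Rightarrow> real) \<Rightarrow> bool" where
  "is_warping_metric S \<phi> \<rho> \<longleftrightarrow>
     Metric_space UNIV \<rho> \<and> (\<forall>x y. \<rho> x y \<le> dist x y) \<and> (\<forall>x. \<forall>s\<in>S. \<rho> x (\<phi> [Gen s] x) \<le> 1)"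

text \<open>The order on functions is pointwise; the greatest element exists by
  \<open>warped_dist_greatest\<close> below.\<close>

definition warped_dist ::
    "'s set \<Rightarrow> ('s letter list \<Rightarrow> 'a::metric_space \<Rightarrow> 'a) \<Rightarrow> 'a \<Rightarrow> 'a \<Rightarrow> real" where
  "warped_dist S \<phi> = (GREATEST \<rho>. is_warping_metric S \<phi> \<rho>)"

lemma is_warping_metric_bounded:
  fixes \<phi> :: "'s letter list \<Rightarrow> 'a::metric_space \<Rightarrow> 'a"
  shows "is_warping_metric S \<phi> (\<lambda>x y. min (dist x y) 1)"
proof -
  have "Metric_space UNIV (\<lambda>x y :: 'a. min (dist x y) 1)"
  proof
    fix x y z :: 'a
    show "min (dist x z) 1 \<le> min (dist x y) 1 + min (dist y z) 1"
      using dist_triangle[of x z y] zero_le_dist[of x y] zero_le_dist[of y z]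
      by linarith
  qed (auto simp: dist_commute min_def)
  then show ?thesis
    by (auto simp: is_warping_metric_def)
qed

lemma warped_dist_greatest:
  fixes \<phi> :: "'s letter list \<Rightarrow> 'a::metric_space \<Rightarrow> 'a"
  shows "is_warping_metric S \<phi> (warped_dist S \<phi>)"
    and "is_warping_metric S \<phi> \<rho> \<Longrightarrow> \<rho> x y \<le> warped_dist S \<phi> x y"
proof -
  define M where "M = {\<rho>. is_warping_metric S \<phi> \<rho>}"
  define \<delta> where "\<delta> = (\<lambda>x y. SUP \<rho>\<in>M. \<rho> x y)"
  have ne: "M \<noteq> {}" using is_warping_metric_bounded unfolding M_def by blast
  have bdd: "bdd_above ((\<lambda>\<rho>. \<rho> x y) ` M)" for x y
    by (rule bdd_aboveI[where M = "dist x y"]) (auto simp: M_def is_warping_metric_def)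
  have upper: "\<rho> x y \<le> \<delta> x y" if "\<rho> \<in> M" for \<rho> x y
    unfolding \<delta>_def using that bdd by (intro cSUP_upper) auto
  have least: "\<delta> x y \<le> c" if "\<And>\<rho>. \<rho> \<in> M \<Longrightarrow> \<rho> x y \<le> c" for x y c
    unfolding \<delta>_def using that ne by (intro cSUP_least) auto
  have mem: "Metric_space UNIV \<rho>" if "\<rho> \<in> M" for \<rho>
    using that by (auto simp: M_def is_warping_metric_def)
  have zero: "\<delta> x x = 0" for x
  proof (rule antisym)
    show "\<delta> x x \<le> 0"
    proof (rule least)
      fix \<rho> assume "\<rho> \<in> M"
      then show "\<rho> x x \<le> 0" using Metric_space.zero[OF mem, of \<rho> x x] by simp
    qed
    obtain \<rho> where "\<rho> \<in> M" using ne by blast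
    then show "0 \<le> \<delta> x x"
      using upper[of \<rho> x x] Metric_space.nonneg[OF mem, of \<rho> x x] by linarith
  qed
  have lower: "min (dist x y) 1 \<le> \<delta> x y" for x y
    using upper[of "\<lambda>x y. min (dist x y) 1"] is_warping_metric_bounded by (auto simp: M_def)
  have sym: "\<delta> x y = \<delta> y x" for x y
    unfolding \<delta>_def by (rule SUP_cong) (auto intro: Metric_space.commute mem)
  have "Metric_space UNIV \<delta>"
  proof
    fix x y z :: 'a
    show "0 \<le> \<delta> x y"
      using lower[of x y] zero_le_dist[of x y] by linarith
    show "\<delta> x y = \<delta> y x" by (rule sym)
    show "\<delta> x y = 0 \<longleftrightarrow> x = y"
      using lower[of x y] zero zero_less_dist_iff[of x y] by (auto simp: min_def split: if_splits)
    show "\<delta> x z \<le> \<delta> x y + \<delta> y z"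
    proof (rule least)
      fix \<rho> assume \<rho>: "\<rho> \<in> M"
      have "\<rho> x z \<le> \<rho> x y + \<rho> y z"
        by (rule Metric_space.triangle[OF mem[OF \<rho>]]) auto
      then show "\<rho> x z \<le> \<delta> x y + \<delta> y z"
        using upper[OF \<rho>, of x y] upper[OF \<rho>, of y z] by linarith
    qed
  qed
  moreover have "\<delta> x y \<le> dist x y" for x y
    by (rule least) (auto simp: M_def is_warping_metric_def)
  moreover have "\<delta> x (\<phi> [Gen s] x) \<le> 1" if "s \<in> S" for x s
    using that by (intro least) (auto simp: M_def is_warping_metric_def)
  ultimately have \<delta>: "is_warping_metric S \<phi> \<delta>"
    by (auto simp: is_warping_metric_def)
  have eq: "warped_dist S \<phi> = \<delta>"
    unfolding warped_dist_def
    by (rule Greatest_equality) (auto simp: \<delta> le_fun_def M_def intro!: upper)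
  show "is_warping_metric S \<phi> (warped_dist S \<phi>)" using \<delta> eq by simp
  show "is_warping_metric S \<phi> \<rho> \<Longrightarrow> \<rho> x y \<le> warped_dist S \<phi> x y"
    using upper[of \<rho> x y] eq by (simp add: M_def)
qed

definition path_length :: "(real \<Rightarrow> 'a::metric_space) \<Rightarrow> ennreal" where
  "path_length g =
     (SUP ts\<in>{ts. sorted ts \<and> set ts \<subseteq> {0..1}}.
        \<Sum>i<length ts - 1. ennreal (dist (g (ts ! i)) (g (ts ! Suc i))))"

definition geodesic :: "'a::metric_space set \<Rightarrow> bool" where
  "geodesic X \<longleftrightarrow>
     (\<forall>x\<in>X. \<forall>y\<in>X. \<exists>g. g ` {0..dist x y} \<subseteq> X \<and> g 0 = x \<and> g (dist x y) = y \<and>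
        (\<forall>s\<in>{0..dist x y}. \<forall>t\<in>{0..dist x y}. dist (g s) (g t) = \<bar>s - t\<bar>))"

definition homotopy_rectifiable_paths :: "'a::metric_space set \<Rightarrow> bool" where
  "homotopy_rectifiable_paths X \<longleftrightarrow>
     (\<forall>g. path g \<and> path_image g \<subseteq> X \<longrightarrow> (\<exists>h. homotopic_paths X g h \<and> path_length h < \<infinity>))"


section \<open>The discrete fundamental group\<close>

text \<open>The \<open>\<theta>\<close>-path \<open>(z\<^sub>0, \<dots>, z\<^sub>n)\<close> is the list of its \<open>n + 1\<close> entries.\<close>

definition theta_path :: "('z \<Rightarrow> 'z \<Rightarrow> real) \<Rightarrow> real \<Rightarrow> 'z list \<Rightarrow> bool" where
  "theta_path \<rho> \<theta> zs \<longleftrightarrow> zs \<noteq> [] \<and> (\<forall>i. Suc i < length zs \<longrightarrow> \<rho> (zs ! i) (zs ! Suc i) \<le> \<theta>)"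

definition lazification :: "'z list \<Rightarrow> 'z list \<Rightarrow> bool" where
  "lazification zs ws \<longleftrightarrow>
     (\<exists>n m p. length zs = Suc n \<and> mono_on {0..m::nat} p \<and> p ` {0..m} = {0..n} \<and>
        ws = map (\<lambda>j. zs ! p j) [0..<Suc m])"

definition grid_homotopic :: "('z \<Rightarrow> 'z \<Rightarrow> real) \<Rightarrow> real \<Rightarrow> 'z list \<Rightarrow> 'z list \<Rightarrow> bool" where
  "grid_homotopic \<rho> \<theta> zs ws \<longleftrightarrow>
     (\<exists>n m H.
        (\<forall>i\<in>{0..n}. \<forall>i'\<in>{0..n}. \<forall>j\<in>{0..m}. \<forall>j'\<in>{0..m}.
           \<rho> (H i j) (H i' j') \<le> \<theta> * (\<bar>real i - real i'\<bar> + \<bar>real j - real j'\<bar>)) \<and>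
        zs = map (\<lambda>i. H i 0) [0..<Suc n] \<and>
        ws = map (\<lambda>i. H i m) [0..<Suc n] \<and>
        (\<forall>j\<in>{0..m}. H 0 j = H 0 0 \<and> H n j = H n 0))"

definition theta_homotopic :: "('z \<Rightarrow> 'z \<Rightarrow> real) \<Rightarrow> real \<Rightarrow> 'z list \<Rightarrow> 'z list \<Rightarrow> bool" where
  "theta_homotopic \<rho> \<theta> =
     equivclp (\<lambda>zs ws. theta_path \<rho> \<theta> zs \<and> theta_path \<rho> \<theta> ws \<and>
                        (lazification zs ws \<or> grid_homotopic \<rho> \<theta> zs ws))"

definition theta_class :: "('z \<Rightarrow> 'z \<Rightarrow> real) \<Rightarrow> real \<Rightarrow> 'z list \<Rightarrow> 'z list set" where
  "theta_class \<rho> \<theta> zs = {ws. theta_homotopic \<rho> \<theta> zs ws}"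

text \<open>Both generating moves fix the end points, so the class of a closed \<open>\<theta>\<close>-path consists of closed
  \<open>\<theta>\<close>-paths with the same base point. The product of two classes is a union over
  representatives; since concatenation respects the equivalence, it is a single class. The same
  convention is used for jumping-paths below.\<close>

definition discrete_pi1 :: "('z \<Rightarrow> 'z \<Rightarrow> real) \<Rightarrow> real \<Rightarrow> 'z \<Rightarrow> 'z list set monoid" where
  "discrete_pi1 \<rho> \<theta> z0 =
     \<lparr>carrier = theta_class \<rho> \<theta> ` {zs. theta_path \<rho> \<theta> zs \<and> hd zs = z0 \<and> last zs = z0},
      mult = (\<lambda>A B. \<Union>zs\<in>A. \<Union>ws\<in>B. theta_class \<rho> \<theta> (zs @ tl ws)),
      one = theta_class \<rho> \<theta> [z0]\<rparr>"


section \<open>Jumping-paths\<close>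

text \<open>The jumping-path with pieces \<open>\<gamma>\<^sub>0, \<dots>, \<gamma>\<^sub>n\<close> and jumps \<open>s\<^sub>1, \<dots>, s\<^sub>n\<close> is the pair of these
  lists, so that \<open>jumps p ! i\<close> leads from \<open>pieces p ! i\<close> to \<open>pieces p ! Suc i\<close>. A letter \<open>l\<close> acts
  through the one-letter word \<open>[l]\<close>. As usual for paths in the library, only the values on
  \<open>[0,1]\<close> are relevant; two pieces that agree there are spatially homotopic.\<close>

type_synonym ('s, 'a) jpath = "(real \<Rightarrow> 'a) list \<times> 's letter list"

abbreviation pieces :: "('s, 'a) jpath \<Rightarrow> (real \<Rightarrow> 'a) list" where "pieces \<equiv> fst"
abbreviation jumps :: "('s, 'a) jpath \<Rightarrow> 's letter list" where "jumps \<equiv> snd"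

definition jstart :: "('s, 'a) jpath \<Rightarrow> 'a" where
  "jstart p = hd (pieces p) 0"

definition jfinish :: "('s, 'a) jpath \<Rightarrow> 'a" where
  "jfinish p = last (pieces p) 1"

definition jumping_path ::
    "'s set \<Rightarrow> ('s letter list \<Rightarrow> 'a::metric_space \<Rightarrow> 'a) \<Rightarrow> ('s, 'a) jpath \<Rightarrow> bool" where
  "jumping_path S \<phi> p \<longleftrightarrow>
     length (pieces p) = Suc (length (jumps p)) \<and>
     (\<forall>g\<in>set (pieces p). path g) \<and> set (jumps p) \<subseteq> letters S \<and>
     (\<forall>i<length (jumps p). (pieces p ! Suc i) 0 = \<phi> [jumps p ! i] ((pieces p ! i) 1))"

definition jlength :: "('s, 'a::metric_space) jpath \<Rightarrow> ennreal" where
  "jlength p = of_nat (length (jumps p)) + (\<Sum>g\<leftarrow>pieces p. path_length g)"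

text \<open>Concatenation merges the last piece of the first path with the first piece of the second.\<close>

definition jconcat :: "('s, 'a::metric_space) jpath \<Rightarrow> ('s, 'a) jpath \<Rightarrow> ('s, 'a) jpath" where
  "jconcat p q =
     (butlast (pieces p) @ [last (pieces p) +++ hd (pieces q)] @ tl (pieces q), jumps p @ jumps q)"

definition jumping_geodesic :: "'s set \<Rightarrow> ('s letter list \<Rightarrow> 'a::metric_space \<Rightarrow> 'a) \<Rightarrow> bool" where
  "jumping_geodesic S \<phi> \<longleftrightarrow>
     geodesic (UNIV :: 'a set) \<and>
     (\<forall>x y. \<exists>p. jumping_path S \<phi> p \<and> jstart p = x \<and> jfinish p = y \<and>
                 jlength p = ennreal (warped_dist S \<phi> x y))"

text \<open>\<open>H i (u, t)\<close> is the homotopy of the \<open>i\<close>-th piece, with path parameter \<open>u\<close> and time \<open>t\<close>. No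
  condition is imposed here on the two ends of the jumping-path.\<close>

definition spatial_homotopy ::
    "('s letter list \<Rightarrow> 'a::metric_space \<Rightarrow> 'a) \<Rightarrow> (nat \<Rightarrow> real \<times> real \<Rightarrow> 'a) \<Rightarrow>
     ('s, 'a) jpath \<Rightarrow> ('s, 'a) jpath \<Rightarrow> bool" where
  "spatial_homotopy \<phi> H p q \<longleftrightarrow>
     jumps p = jumps q \<and> length (pieces p) = length (pieces q) \<and>
     (\<forall>i<length (pieces p). continuous_on ({0..1} \<times> {0..1}) (H i) \<and>
        (\<forall>u\<in>{0..1}. H i (u, 0) = (pieces p ! i) u \<and> H i (u, 1) = (pieces q ! i) u)) \<and>
     (\<forall>i<length (jumps p). \<forall>t\<in>{0..1}. H (Suc i) (0, t) = \<phi> [jumps p ! i] (H i (1, t)))"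

definition spatially_homotopic ::
    "('s letter list \<Rightarrow> 'a::metric_space \<Rightarrow> 'a) \<Rightarrow> ('s, 'a) jpath \<Rightarrow> ('s, 'a) jpath \<Rightarrow> bool" where
  "spatially_homotopic \<phi> p q \<longleftrightarrow>
     (\<exists>H. spatial_homotopy \<phi> H p q \<and>
        (\<forall>t\<in>{0..1}. H 0 (0, t) = jstart p \<and> H 0 (0, t) = jstart q \<and>
           H (length (jumps p)) (1, t) = jfinish p \<and> H (length (jumps p)) (1, t) = jfinish q))"

definition freely_spatially_homotopic ::
    "('s letter list \<Rightarrow> 'a::metric_space \<Rightarrow> 'a) \<Rightarrow> ('s, 'a) jpath \<Rightarrow> ('s, 'a) jpath \<Rightarrow> bool" where
  "freely_spatially_homotopic \<phi> p q \<longleftrightarrow>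
     (\<exists>H. spatial_homotopy \<phi> H p q \<and>
        (\<forall>t\<in>{0..1}. H 0 (0, t) = H (length (jumps p)) (1, t)))"

definition const_path :: "(real \<Rightarrow> 'a) \<Rightarrow> bool" where
  "const_path c \<longleftrightarrow> (\<forall>u\<in>{0..1}. c u = c 0)"

text \<open>Once the two jumps around the constant piece \<open>c\<close> are removed, the pieces \<open>g\<close> and \<open>h\<close> before
  and after them match up and are joined to a single piece.\<close>

definition contraction :: "('s, 'a::metric_space) jpath \<Rightarrow> ('s, 'a) jpath \<Rightarrow> bool" where
  "contraction p q \<longleftrightarrow>
     (\<exists>gs g c h hs ss l ts. length gs = length ss \<and> const_path c \<and>
        p = (gs @ [g, c, h] @ hs, ss @ [l, letter_inv l] @ ts) \<and>
        q = (gs @ [g +++ h] @ hs, ss @ ts))"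

definition cyclic_contraction :: "('s, 'a::metric_space) jpath \<Rightarrow> ('s, 'a) jpath \<Rightarrow> bool" where
  "cyclic_contraction p q \<longleftrightarrow>
     (\<exists>c c' l. const_path c \<and> const_path c' \<and>
        p = ([c] @ pieces q @ [c'], [l] @ jumps q @ [letter_inv l]))"

definition jhomotopic ::
    "'s set \<Rightarrow> ('s letter list \<Rightarrow> 'a::metric_space \<Rightarrow> 'a) \<Rightarrow> ('s, 'a) jpath \<Rightarrow> ('s, 'a) jpath \<Rightarrow> bool"
  where
  "jhomotopic S \<phi> =
     equivclp (\<lambda>p q. jumping_path S \<phi> p \<and> jumping_path S \<phi> q \<and>
                      (spatially_homotopic \<phi> p q \<or> contraction p q))"

definition closed_jumping_path ::
    "'s set \<Rightarrow> ('s letter list \<Rightarrow> 'a::metric_space \<Rightarrow> 'a) \<Rightarrow> ('s, 'a) jpath \<Rightarrow> bool" where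
  "closed_jumping_path S \<phi> p \<longleftrightarrow> jumping_path S \<phi> p \<and> jstart p = jfinish p"

definition freely_jhomotopic ::
    "'s set \<Rightarrow> ('s letter list \<Rightarrow> 'a::metric_space \<Rightarrow> 'a) \<Rightarrow> ('s, 'a) jpath \<Rightarrow> ('s, 'a) jpath \<Rightarrow> bool"
  where
  "freely_jhomotopic S \<phi> =
     equivclp (\<lambda>p q. closed_jumping_path S \<phi> p \<and> closed_jumping_path S \<phi> q \<and>
                      (freely_spatially_homotopic \<phi> p q \<or> contraction p q \<or> cyclic_contraction p q))"

definition jclass ::
    "'s set \<Rightarrow> ('s letter list \<Rightarrow> 'a::metric_space \<Rightarrow> 'a) \<Rightarrow> ('s, 'a) jpath \<Rightarrow> ('s, 'a) jpath set"
  where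
  "jclass S \<phi> p = {q. jhomotopic S \<phi> p q}"

definition jumping_pi1 ::
    "'s set \<Rightarrow> ('s letter list \<Rightarrow> 'a::metric_space \<Rightarrow> 'a) \<Rightarrow> 'a \<Rightarrow> ('s, 'a) jpath set monoid" where
  "jumping_pi1 S \<phi> x0 =
     \<lparr>carrier = jclass S \<phi> ` {p. closed_jumping_path S \<phi> p \<and> jstart p = x0},
      mult = (\<lambda>A B. \<Union>p\<in>A. \<Union>q\<in>B. jclass S \<phi> (jconcat p q)),
      one = jclass S \<phi> ([\<lambda>_. x0], [])\<rparr>"


section \<open>Discretisation\<close>

definition path_discretisation :: "real \<Rightarrow> (real \<Rightarrow> 'a::metric_space) \<Rightarrow> 'a list \<Rightarrow> bool" where
  "path_discretisation \<theta> g zs \<longleftrightarrow>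
     (\<exists>m t. t 0 = 0 \<and> t m = (1::real) \<and> (\<forall>i<m. t i < t (Suc i)) \<and>
        (\<forall>i<m. g ` {t i..t (Suc i)} \<subseteq> cball (g (t i)) \<theta>) \<and>
        zs = map (\<lambda>i. g (t i)) [0..<Suc m])"

text \<open>Between the discretisations of consecutive pieces, the step from the last entry of one to the
  first entry of the next is the jump.\<close>

definition jpath_discretisation :: "real \<Rightarrow> ('s, 'a::metric_space) jpath \<Rightarrow> 'a list \<Rightarrow> bool" where
  "jpath_discretisation \<theta> p zs \<longleftrightarrow>
     (\<exists>zss. list_all2 (path_discretisation \<theta>) (pieces p) zss \<and> zs = concat zss)"

text \<open>The union of the classes of all discretisations of all representatives. That it is a single
  class, i.e. that the discretisation is well defined, is part of the assertion that it maps into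
  the carrier of the discrete fundamental group (see \<open>discretisation_eq_theta_class\<close>).\<close>

definition discretisation ::
    "'s set \<Rightarrow> ('s letter list \<Rightarrow> 'a::metric_space \<Rightarrow> 'a) \<Rightarrow> real \<Rightarrow> ('s, 'a) jpath set \<Rightarrow> 'a list set"
  where
  "discretisation S \<phi> \<theta> C =
     (\<Union>p\<in>C. \<Union>zs\<in>{zs. jpath_discretisation \<theta> p zs}. theta_class (warped_dist S \<phi>) \<theta> zs)"

lemma discretisation_eq_theta_class:
  assumes "discretisation S \<phi> \<theta> C \<in> carrier (discrete_pi1 (warped_dist S \<phi>) \<theta> x0)"
    and "p \<in> C" "jpath_discretisation \<theta> p zs"
  shows "discretisation S \<phi> \<theta> C = theta_class (warped_dist S \<phi>) \<theta> zs"
proof -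
  let ?R = "theta_homotopic (warped_dist S \<phi>) \<theta>"
  obtain ws where ws: "discretisation S \<phi> \<theta> C = theta_class (warped_dist S \<phi>) \<theta> ws"
    using assms(1) by (auto simp: discrete_pi1_def)
  have "zs \<in> theta_class (warped_dist S \<phi>) \<theta> zs"
    by (simp add: theta_class_def theta_homotopic_def)
  then have "zs \<in> discretisation S \<phi> \<theta> C"
    unfolding discretisation_def using assms(2,3) by blast
  then have "?R ws zs"
    unfolding ws by (simp add: theta_class_def)
  then have "?R ws vs \<longleftrightarrow> ?R zs vs" for vs
    unfolding theta_homotopic_def by (meson equivclp_sym equivclp_trans)
  then show ?thesis
    unfolding ws by (simp add: theta_class_def)
qed


section \<open>The kernel of the discretisation\<close>

definition short_quadrilaterals ::
    "'s set \<Rightarrow> ('s letter list \<Rightarrow> 'a::metric_space \<Rightarrow> 'a) \<Rightarrow> real \<Rightarrow> ('s, 'a) jpath set" where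
  "short_quadrilaterals S \<phi> \<theta> =
     {p. closed_jumping_path S \<phi> p \<and>
        (\<exists>p0 p1 p2 p3. p = jconcat (jconcat (jconcat p0 p1) p2) p3 \<and>
           (\<forall>q\<in>{p0, p1, p2, p3}. jumping_path S \<phi> q \<and> jlength q \<le> ennreal \<theta>) \<and>
           jfinish p0 = jstart p1 \<and> jfinish p1 = jstart p2 \<and> jfinish p2 = jstart p3)}"

definition FT ::
    "'s set \<Rightarrow> ('s letter list \<Rightarrow> 'a::metric_space \<Rightarrow> 'a) \<Rightarrow> real \<Rightarrow> 'a \<Rightarrow> ('s, 'a) jpath set set" where
  "FT S \<phi> \<theta> x0 =
     jclass S \<phi> ` {p. closed_jumping_path S \<phi> p \<and> jstart p = x0 \<and>
                      (\<exists>q\<in>short_quadrilaterals S \<phi> \<theta>. freely_jhomotopic S \<phi> p q)}"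

end

theory Submission
  imports Defs
begin

text \<open>
  On the discrete side, theta-homotopy is generated by repeating a vertex and by exchanging two
  consecutive edges of a quadrilateral for the other two, so invariants of theta-paths have to be
  checked on these moves only. A discretisation depends only on the homotopy class because all
  sufficiently fine samples agree, and a spatial homotopy sampled on a fine grid is a grid homotopy;
  sampling a free homotopy shows that being null-homotopic survives it, hence every element of
  \<open>FT\<close> lies in the kernel. Replacing the steps of a theta-path by jumping geodesics
  gives surjectivity, since a jumping-path of length at most \<open>\<theta>\<close> stays within
  distance \<open>\<theta>\<close> of its start.

  For the converse inclusion, \<open>FT\<close> is invariant under conjugation, so it generates a
  normal subgroup. Modulo it, all jumping-paths of length at most \<open>\<theta>\<close> between two given points agree, and the
  square move becomes a relation; multiplying these values along a theta-path therefore defines an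
  invariant of its homotopy class. Cutting the (rectifiable) pieces of a jumping-path into short ones
  shows that its class modulo \<open>FT\<close> is the value of its discretisation.
\<close>

section \<open>Theta-paths up to homotopy\<close>

text \<open>The number four in \<open>FT\<close> is that of the elementary square: exchanging
  \<open>a, b, c\<close> for \<open>a, d, c\<close> sweeps out the closed path
  \<open>a, b, c, d, a\<close>, and filling in its sides by short jumping-paths gives a
  quadrilateral. Bigons are included by taking two sides constant. Two difficulties shape the
  argument. A free homotopy moves the base point, so classes of closed theta-paths cannot be
  compared along it; only the property of being null-homotopic can, and for elements of
  \<open>FT\<close> this suffices. Conversely, the quadrilaterals swept out by a homotopy of
  theta-paths lie anywhere in the space. Joining one to the base point by an arbitrary jumping-path
  is a conjugation, which a free homotopy absorbs; this is why the subgroup generated by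
  \<open>FT\<close> needs no further closure. The working object is therefore the groupoid of
  jumping-paths with arbitrary ends, transported to the base point only when values in a group are
  required. The condition \<open>\<theta> \<ge> 1\<close> makes a single jump both a step of a
  theta-path and a jumping-path of admissible length.\<close>

locale theta_space = Metric_space UNIV \<rho> for \<rho> :: "'z \<Rightarrow> 'z \<Rightarrow> real" +
  fixes \<theta> :: real
  assumes theta_nonneg [simp]: "0 \<le> \<theta>"
begin

abbreviation near :: "'z \<Rightarrow> 'z \<Rightarrow> bool" where
  "near a b \<equiv> \<rho> a b \<le> \<theta>"

abbreviation tpath :: "'z list \<Rightarrow> bool" where
  "tpath \<equiv> theta_path \<rho> \<theta>"

lemma near_refl [simp]: "near a a"
  by simp

lemma near_sym: "near a b \<longleftrightarrow> near b a"
  by (simp add: commute)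

lemma tpath_iff: "tpath zs \<longleftrightarrow> zs \<noteq> [] \<and> successively near zs"
  by (simp add: theta_path_def successively_conv_nth)

lemma tpath_append: "tpath (as @ bs) \<longleftrightarrow>
    as @ bs \<noteq> [] \<and> successively near as \<and> successively near bs \<and>
      (as = [] \<or> bs = [] \<or> near (last as) (hd bs))"
  by (auto simp: tpath_iff successively_append_iff)

text \<open>This will turn out to be the homotopy relation; it is easier to induct on.\<close>

inductive theq :: "'z list \<Rightarrow> 'z list \<Rightarrow> bool" (infix "\<simeq>" 50) where
  refl: "tpath zs \<Longrightarrow> zs \<simeq> zs"
| stutter: "tpath (xs @ [a] @ ys) \<Longrightarrow> xs @ [a] @ ys \<simeq> xs @ [a, a] @ ys"
| square: "tpath (xs @ [a, b, c] @ ys) \<Longrightarrow> tpath (xs @ [a, d, c] @ ys) \<Longrightarrow>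
    xs @ [a, b, c] @ ys \<simeq> xs @ [a, d, c] @ ys"
| sym: "zs \<simeq> ws \<Longrightarrow> ws \<simeq> zs"
| trans [trans]: "zs \<simeq> ws \<Longrightarrow> ws \<simeq> vs \<Longrightarrow> zs \<simeq> vs"

lemma theqD:
  assumes "zs \<simeq> ws"
  shows "tpath zs" "tpath ws" "hd ws = hd zs" "last ws = last zs"
proof -
  have "tpath zs \<and> tpath ws \<and> hd ws = hd zs \<and> last ws = last zs"
    using assms
  proof induction
    case (stutter xs a ys)
    then show ?case by (cases ys) (auto simp: tpath_iff successively_append_iff hd_append last_append)
  qed (auto simp: hd_append last_append)
  then show "tpath zs" "tpath ws" "hd ws = hd zs" "last ws = last zs" by auto
qed

text \<open>The surroundings of a block see only its first and last entries, so any block with the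
  same ends fits into the same context.\<close>

lemma tpath_context:
  assumes "tpath zs" "tpath ws" "hd ws = hd zs" "last ws = last zs" "tpath (as @ zs @ bs)"
  shows "tpath (as @ ws @ bs)"
  using assms by (auto simp: tpath_iff successively_append_iff hd_append)

lemma theq_context:
  assumes "zs \<simeq> ws" "tpath (as @ zs @ bs)"
  shows "as @ zs @ bs \<simeq> as @ ws @ bs"
  using assms
proof (induction arbitrary: as bs)
  case (refl zs)
  then show ?case by (simp add: theq.refl)
next
  case (stutter xs a ys)
  then show ?case using theq.stutter[of "as @ xs" a "ys @ bs"] by simp
next
  case (square xs a b c ys d)
  have "tpath (as @ (xs @ [a, d, c] @ ys) @ bs)"
    by (rule tpath_context[OF square.hyps _ _ square.prems]) (auto simp: hd_append last_append)
  then show ?case using theq.square[of "as @ xs" a b c "ys @ bs" d] square.prems by simp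
next
  case (sym zs ws)
  then show ?case by (meson theq.sym theqD tpath_context)
next
  case (trans zs ws vs)
  then show ?case by (meson theq.trans theqD tpath_context)
qed

lemma theq_append:
  assumes "zs \<simeq> zs'" "ws \<simeq> ws'" "near (last zs) (hd ws)"
  shows "zs @ ws \<simeq> zs' @ ws'"
proof -
  have t: "tpath (zs @ ws)"
    using assms(3) theqD(1)[OF assms(1)] theqD(1)[OF assms(2)] by (auto simp: tpath_iff successively_append_iff)
  have "zs @ ws \<simeq> zs' @ ws"
    using theq_context[of zs zs' "[]" ws] assms(1) t by simp
  moreover have "zs' @ ws \<simeq> zs' @ ws'"
    using theq_context[of ws ws' zs' "[]"] assms(2) theqD(2)[OF calculation] by simp
  ultimately show ?thesis by (rule theq.trans)
qed

lemma theq_Cons: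
  assumes "ws \<simeq> ws'" "near a (hd ws)"
  shows "a # ws \<simeq> a # ws'"
  using theq_append[of "[a]" "[a]" ws ws'] assms by (simp add: theq.refl tpath_iff)

lemma theq_stutter1: "tpath (a # ys) \<Longrightarrow> a # ys \<simeq> a # a # ys"
  using stutter[of "[]" a ys] by simp

lemma theq_square1:
  assumes "tpath (a # b # c # ys)" "near a d" "near d c"
  shows "a # b # c # ys \<simeq> a # d # c # ys"
  using square[of "[]" a b c ys d] assms by (simp add: tpath_iff)

text \<open>A square move turns the middle vertex into a second copy of \<open>a\<close>, which is
  then removed as a repetition.\<close>

lemma theq_drop_near:
  assumes "tpath (a # b # c # ys)" "near a c"
  shows "a # b # c # ys \<simeq> a # c # ys"
proof -
  have "a # b # c # ys \<simeq> a # a # c # ys"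
    by (rule theq_square1) (use assms in auto)
  also have "\<dots> \<simeq> a # c # ys"
    by (rule sym, rule theq_stutter1) (use assms in \<open>auto simp: tpath_iff\<close>)
  finally show ?thesis .
qed

lemma theq_backtrack: "near a b \<Longrightarrow> tpath (a # ys) \<Longrightarrow> a # b # a # ys \<simeq> a # ys"
  using theq_drop_near[of a b a ys] sym[OF theq_stutter1[of a ys]] near_sym[of a b] trans
  by (auto simp: tpath_iff)

text \<open>The product in \<open>discrete_pi1\<close> lists the common vertex once; listing it
  twice is a single repetition and makes the product a plain append.\<close>

lemma theq_join: "tpath zs \<Longrightarrow> tpath ws \<Longrightarrow> last zs = hd ws \<Longrightarrow> zs @ tl ws \<simeq> zs @ ws"
proof -
  assume a: "tpath zs" "tpath ws" "last zs = hd ws"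
  then obtain a ws' where ws: "ws = a # ws'" by (cases ws) (auto simp: tpath_iff)
  obtain us where zs: "zs = us @ [a]"
    using a ws by (metis append_butlast_last_id list.sel(1) tpath_iff)
  have "tpath (us @ [a] @ ws')"
    using a ws zs by (cases ws') (auto simp: tpath_iff successively_append_iff)
  from stutter[OF this] show ?thesis using ws zs by simp
qed

lemma theq_singleton: "set zs \<subseteq> {a} \<Longrightarrow> zs \<noteq> [] \<Longrightarrow> zs \<simeq> [a]"
proof (induction zs)
  case (Cons b zs)
  show ?case
  proof (cases zs)
    case Nil
    then show ?thesis using Cons by (auto intro!: theq.refl simp: tpath_iff)
  next
    case (Cons c ws)
    then have "zs \<simeq> [a]" "b = a" "c = a" using Cons.IH Cons.prems by auto
    then have "b # zs \<simeq> [a, a]" using theq_Cons[of zs "[a]" a] \<open>zs = c # ws\<close> by simp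
    also have "\<dots> \<simeq> [a]" by (rule sym, rule theq_stutter1) (simp add: tpath_iff)
    finally show ?thesis .
  qed
qed simp

text \<open>Vertices are skipped from the left: as long as another one follows, the step from
  \<open>x\<close> may lead directly to that one, since it is near \<open>x\<close> as well.\<close>

lemma theq_star:
  assumes "tpath (x # zs)" "\<forall>z\<in>set zs. near x z" "zs \<noteq> []"
  shows "x # zs \<simeq> [x, last zs]"
  using assms
proof (induction zs)
  case (Cons z zs)
  show ?case
  proof (cases zs)
    case Nil
    then show ?thesis using Cons by (auto intro: theq.refl)
  next
    case (Cons w ws)
    have "x # z # zs \<simeq> x # zs"
      using theq_drop_near[of x z w ws] Cons Cons.prems by simp
    also have "\<dots> \<simeq> [x, last zs]"
      using Cons.IH Cons.prems Cons by (auto simp: tpath_iff)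
    finally show ?thesis using Cons by simp
  qed
qed simp

text \<open>The row \<open>zs\<close> is pushed across the strip one square at a time, beginning at
  the right end. The vertical edges at both ends survive; along a free homotopy they become a
  conjugating edge.\<close>

lemma theq_row:
  assumes "list_all2 near zs ws" "tpath zs" "tpath ws"
  shows "zs \<simeq> hd zs # ws @ [last zs]"
  using assms
proof (induction zs ws rule: list_all2_induct)
  case (Cons z zs w ws)
  show ?case
  proof (cases zs)
    case Nil
    then show ?thesis
      using Cons theq_backtrack[of z w "[]"] by (auto intro: sym simp: tpath_iff)
  next
    case (Cons z' zs')
    then obtain w' ws' where ws: "ws = w' # ws'" using Cons.hyps by (cases ws) auto
    have IH: "zs \<simeq> hd zs # ws @ [last zs]"
      using Cons.IH Cons.prems Cons ws by (auto simp: tpath_iff)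
    have nr: "near z z'" "near w w'" "near z w" "near z' w'"
      using Cons.hyps Cons.prems Cons ws by (auto simp: tpath_iff)
    have 1: "z # zs \<simeq> z # z' # w' # ws' @ [last zs]"
      using theq_Cons[OF IH, of z] nr Cons ws by simp
    \<comment> \<open>Square move on \<open>z, z', w'\<close>: the corner \<open>z'\<close> is
      exchanged for \<open>w\<close>.\<close>
    also have "\<dots> \<simeq> z # w # w' # ws' @ [last zs]"
      by (rule theq_square1[OF theqD(2)[OF 1]]) (use nr in auto)
    finally show ?thesis using Cons ws by simp
  qed
qed (simp add: tpath_iff)

text \<open>With fixed ends the two vertical edges left over by \<open>theq_row\<close> are
  degenerate and disappear as repetitions.\<close>

lemma theq_row_fixed:
  assumes "list_all2 near zs ws" "tpath zs" "tpath ws" "hd zs = hd ws" "last zs = last ws"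
  shows "zs \<simeq> ws"
proof -
  obtain w ws' where ws: "ws = w # ws'" using assms(3) by (cases ws) (auto simp: tpath_iff)
  have "zs \<simeq> w # ws @ [last ws]" using theq_row[OF assms(1-3)] assms(4,5) ws by simp
  also have "\<dots> \<simeq> ws @ [last ws]"
    using sym[OF theq_stutter1[of w "ws' @ [last ws]"]] theqD(2)[OF calculation] ws
    by (simp add: tpath_iff)
  also have "\<dots> \<simeq> ws"
  proof -
    have e: "ws = butlast ws @ [last ws]" using ws by simp
    have "ws \<simeq> butlast ws @ [last ws, last ws]"
      using stutter[of "butlast ws" "last ws" "[]"] assms(3) e by simp
    moreover have "butlast ws @ [last ws, last ws] = ws @ [last ws]" by (simp add: ws)
    ultimately show ?thesis by (metis sym)
  qed
  finally show ?thesis .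
qed

section \<open>Agreement with the homotopy relation generated by lazifications and grid
  homotopies\<close>

lemma dist_nth_le:
  assumes "tpath zs" "i < length zs" "j < length zs"
  shows "\<rho> (zs ! i) (zs ! j) \<le> \<theta> * \<bar>real i - real j\<bar>"
proof -
  have *: "\<rho> (zs ! i) (zs ! (i + k)) \<le> \<theta> * k" if "i + k < length zs" for i k
    using that
  proof (induction k)
    case (Suc k)
    have "\<rho> (zs ! i) (zs ! (i + Suc k)) \<le> \<rho> (zs ! i) (zs ! (i + k)) + \<rho> (zs ! (i + k)) (zs ! Suc (i + k))"
      using triangle[of "zs ! i" "zs ! (i + k)" "zs ! Suc (i + k)"] by simp
    moreover have "near (zs ! (i + k)) (zs ! Suc (i + k))"
      using assms(1) Suc.prems by (simp add: theta_path_def)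
    ultimately show ?case using Suc by (simp add: algebra_simps)
  qed (simp add: theta_nonneg)
  show ?thesis
  proof (cases "i \<le> j")
    case True
    then show ?thesis using *[of i "j - i"] assms by simp
  next
    case False
    then show ?thesis using *[of j "i - j"] assms by (simp add: commute)
  qed
qed

text \<open>Two rows form a grid with \<open>m = 1\<close>. Between points in different rows and
  columns, the Lipschitz bound follows by moving along the first row and then vertically.\<close>

lemma grid_homotopic_row:
  assumes "list_all2 near zs ws" "tpath zs" "tpath ws" "hd zs = hd ws" "last zs = last ws"
  shows "grid_homotopic \<rho> \<theta> zs ws"
proof -
  define H where "H i j = (if j = 0 then zs ! i else ws ! i)" for i and j :: nat
  define n where "n = length zs - 1"
  have len: "length zs = Suc n" "length ws = Suc n"
    using assms by (auto simp: n_def tpath_iff dest: list_all2_lengthD)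
  have nr: "near (zs ! i) (ws ! i)" if "i \<le> n" for i
    using assms(1) that len by (simp add: list_all2_conv_all_nth)
  have 1: "\<rho> (zs ! i) (ws ! i') \<le> \<theta> * (\<bar>real i - real i'\<bar> + 1)" if "i \<le> n" "i' \<le> n" for i i'
    using triangle[of "zs ! i" "zs ! i'" "ws ! i'"] dist_nth_le[OF assms(2), of i i'] nr[of i'] that len
    by (simp add: algebra_simps)
  have 2: "\<rho> (ws ! i) (zs ! i') \<le> \<theta> * (\<bar>real i - real i'\<bar> + 1)" if "i \<le> n" "i' \<le> n" for i i'
    using 1[of i' i] that commute[of "ws ! i"] by (simp add: abs_minus_commute)
  have "\<rho> (H i j) (H i' j') \<le> \<theta> * (\<bar>real i - real i'\<bar> + \<bar>real j - real j'\<bar>)"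
    if "i \<in> {0..n}" "i' \<in> {0..n}" "j \<in> {0..1}" "j' \<in> {0..1}" for i i' j j'
    using that dist_nth_le[OF assms(2), of i i'] dist_nth_le[OF assms(3), of i i'] 1[of i i'] 2[of i i'] len
    by (cases "j = 0"; cases "j' = 0") (auto simp: H_def le_Suc_eq)
  moreover have "zs = map (\<lambda>i. H i 0) [0..<Suc n]" "ws = map (\<lambda>i. H i 1) [0..<Suc n]"
    unfolding H_def using len by (auto intro!: nth_equalityI simp del: upt_Suc)
  moreover have "\<forall>j\<in>{0..1}. H 0 j = H 0 0 \<and> H n j = H n 0"
  proof -
    have "zs ! 0 = ws ! 0" "zs ! n = ws ! n"
      using assms(4,5) len hd_conv_nth[of zs] hd_conv_nth[of ws] last_conv_nth[of zs] last_conv_nth[of ws]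
      by (cases "zs = []"; cases "ws = []"; simp)+
    then show ?thesis by (auto simp: H_def)
  qed
  ultimately show ?thesis unfolding grid_homotopic_def by blast
qed

lemma lazification_stutter: "lazification (xs @ [a] @ ys) (xs @ [a, a] @ ys)"
proof -
  \<comment> \<open>The index map takes the value \<open>length xs\<close> twice in succession;
    \<open>?n\<close> is the last index of the shorter list.\<close>
  define p where "p j = (if j \<le> length xs then j else j - 1)" for j
  let ?n = "length xs + length ys"
  have "p ` {0..Suc ?n} = {0..?n}"
  proof
    show "{0..?n} \<subseteq> p ` {0..Suc ?n}"
    proof
      fix k assume k: "k \<in> {0..?n}"
      show "k \<in> p ` {0..Suc ?n}"
        using k by (cases "k \<le> length xs") (auto simp: p_def image_iff intro: bexI[of _ k] bexI[of _ "Suc k"])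
    qed
  qed (auto simp: p_def)
  moreover have "mono_on {0..Suc ?n} p"
    by (auto simp: mono_on_def p_def)
  moreover have "xs @ [a, a] @ ys = map (\<lambda>j. (xs @ [a] @ ys) ! p j) [0..<Suc (Suc ?n)]"
  proof (rule nth_equalityI)
    fix i assume "i < length (xs @ [a, a] @ ys)"
    then have "map (\<lambda>j. (xs @ [a] @ ys) ! p j) [0..<Suc (Suc ?n)] ! i = (xs @ [a] @ ys) ! p i"
      by (subst nth_map) (simp_all del: upt_Suc)
    also have "\<dots> = (xs @ [a, a] @ ys) ! i"
    proof (cases "i \<le> length xs")
      case False
      then obtain k where "i = Suc (length xs + k)" by (metis add_Suc less_imp_Suc_add not_le)
      then show ?thesis by (simp add: p_def nth_append)
    qed (auto simp: p_def nth_append)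
    finally show "(xs @ [a, a] @ ys) ! i = map (\<lambda>j. (xs @ [a] @ ys) ! p j) [0..<Suc (Suc ?n)] ! i" ..
  qed simp
  ultimately show ?thesis unfolding lazification_def
    by (intro exI[of _ ?n] exI[of _ "Suc ?n"] exI[of _ p]) auto
qed

text \<open>Induction on the length of the lazy path. Either the top index is attained at the last
  two times, and the final entry is a repetition, or only at the last one, and the final entries of
  both lists are split off.\<close>

lemma theq_lazification:
  assumes "lazification zs ws" "tpath zs"
  shows "zs \<simeq> ws"
proof -
  have main: "zs \<simeq> map (\<lambda>j. zs ! p j) [0..<Suc m]"
    if "length zs = Suc n" "mono_on {0..m} p" "p ` {0..m} = {0..n}" "tpath zs"
    for m n p and zs
    using that
  proof (induction m arbitrary: n zs)
    case 0
    have "card (p ` {0..0}) = card {0..n}" using 0(3) by simp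
    then have "n = 0" by simp
    moreover have "p 0 = 0" using 0(3) \<open>n = 0\<close> by simp
    ultimately show ?case using 0 by (cases zs) (auto intro: theq.refl)
  next
    case (Suc m)
    have mono: "p i \<le> p j" if "i \<le> j" "j \<le> Suc m" for i j
      using Suc.prems(2) that by (auto simp: mono_on_def)
    have le: "p j \<le> n" if "j \<le> Suc m" for j
      using Suc.prems(3) that by auto
    have top: "p (Suc m) = n"
    proof -
      have "n \<in> p ` {0..Suc m}" using Suc.prems(3) by simp
      then obtain j where "j \<le> Suc m" "p j = n" by auto
      then show ?thesis using mono[of j "Suc m"] le[of "Suc m"] by simp
    qed
    have img: "insert n (p ` {0..m}) = {0..n}"
      using Suc.prems(3) top by (simp add: atLeast0_atMost_Suc)
    have mono': "mono_on {0..m} p" using Suc.prems(2) by (auto simp: mono_on_def)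
    have nth: "zs ! n = last zs" using Suc.prems(1) by (simp add: last_conv_nth flip: length_greater_0_conv)
    show ?case
    proof (cases "p m = n")
      case True
      then have "p ` {0..m} = {0..n}" using img by (metis atLeastAtMost_iff image_eqI insert_absorb le0 le_refl)
      from Suc.IH[OF Suc.prems(1) mono' this Suc.prems(4)]
      have IH: "zs \<simeq> map (\<lambda>j. zs ! p j) [0..<Suc m]" .
      also have "\<dots> = map (\<lambda>j. zs ! p j) [0..<m] @ [zs ! n] @ []" using True by simp
      also have "\<dots> \<simeq> map (\<lambda>j. zs ! p j) [0..<m] @ [zs ! n, zs ! n] @ []"
        by (rule stutter) (use theqD(2)[OF calculation] in simp)
      finally show ?thesis using True top by simp
    next
      case False
      have lt: "p j < n" if "j \<le> m" for j
        using False le[of m] mono[of j m] that by simp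
      then obtain k where k: "n = Suc k" by (cases n) auto
      have img': "p ` {0..m} = {0..k}"
      proof -
        have "n \<notin> p ` {0..m}" using lt by fastforce
        then have "p ` {0..m} = {0..n} - {n}" using img by blast
        then show ?thesis using k by auto
      qed
      have b: "length (butlast zs) = Suc k" "zs = butlast zs @ [zs ! n]"
        using Suc.prems(1) k nth by (auto simp: append_butlast_last_id simp flip: length_greater_0_conv)
      have tb: "tpath (butlast zs)"
        using Suc.prems(4) b by (metis append_eq_conv_conj list.size(3) nat.distinct(1) successively_append_iff tpath_iff)
      from Suc.IH[OF b(1) mono' img' tb]
      have "butlast zs \<simeq> map (\<lambda>j. butlast zs ! p j) [0..<Suc m]" .
      also have "\<dots> = map (\<lambda>j. zs ! p j) [0..<Suc m]"
        using lt Suc.prems(1) k by (auto simp: nth_butlast less_Suc_eq_le simp del: upt_Suc)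
      finally have "butlast zs @ [zs ! n] \<simeq> map (\<lambda>j. zs ! p j) [0..<Suc m] @ [zs ! n]"
        using theq_context[of "butlast zs" _ "[]" "[zs ! n]"] b(2) Suc.prems(4) by (simp del: upt_Suc)
      moreover have "map (\<lambda>j. zs ! p j) [0..<Suc m] @ [zs ! n] = map (\<lambda>j. zs ! p j) [0..<Suc (Suc m)]"
        using top by simp
      ultimately show ?thesis using b(2) by metis
    qed
  qed
  show ?thesis using assms main unfolding lazification_def by blast
qed

text \<open>The Lipschitz bound at grid neighbours makes every row a theta-path and successive rows
  adjacent, so \<open>theq_row_fixed\<close> applies row by row.\<close>

lemma theq_grid_homotopic:
  assumes "grid_homotopic \<rho> \<theta> zs ws"
  shows "zs \<simeq> ws"
proof -
  obtain n m H where H: "\<forall>i\<in>{0..n}. \<forall>i'\<in>{0..n}. \<forall>j\<in>{0..m}. \<forall>j'\<in>{0..m}.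
           \<rho> (H i j) (H i' j') \<le> \<theta> * (\<bar>real i - real i'\<bar> + \<bar>real j - real j'\<bar>)"
    and zs: "zs = map (\<lambda>i. H i 0) [0..<Suc n]" and ws: "ws = map (\<lambda>i. H i m) [0..<Suc n]"
    and ends: "\<forall>j\<in>{0..m}. H 0 j = H 0 0 \<and> H n j = H n 0"
    using assms unfolding grid_homotopic_def by blast
  define row where "row j = map (\<lambda>i. H i j) [0..<Suc n]" for j
  have t: "tpath (row j)" if "j \<le> m" for j
    unfolding theta_path_def row_def
  proof (intro conjI allI impI)
    fix i assume "Suc i < length (map (\<lambda>i. H i j) [0..<Suc n])"
    then have "Suc i \<le> n" by simp
    then show "near (map (\<lambda>i. H i j) [0..<Suc n] ! i) (map (\<lambda>i. H i j) [0..<Suc n] ! Suc i)"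
      using H[rule_format, of i "Suc i" j j] that by (simp del: upt_Suc)
  qed simp
  have step: "row j \<simeq> row (Suc j)" if "Suc j \<le> m" for j
  proof (rule theq_row_fixed)
    show "list_all2 near (row j) (row (Suc j))"
      unfolding list_all2_conv_all_nth row_def
    proof (intro conjI allI impI)
      fix i assume "i < length (map (\<lambda>i. H i j) [0..<Suc n])"
      then show "near (map (\<lambda>i. H i j) [0..<Suc n] ! i) (map (\<lambda>i. H i (Suc j)) [0..<Suc n] ! i)"
        using H[rule_format, of i i j "Suc j"] that by (simp del: upt_Suc)
    qed simp
    show "hd (row j) = hd (row (Suc j))" "last (row j) = last (row (Suc j))"
      using bspec[OF ends, of j] bspec[OF ends, of "Suc j"] that
      by (auto simp: row_def hd_map simp del: upt_Suc) (simp_all add: hd_map)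
  qed (use t that in auto)
  have "row 0 \<simeq> row j" if "j \<le> m" for j
    using that by (induction j) (auto intro: theq.refl theq.trans step t)
  then show ?thesis using zs ws by (simp add: row_def)
qed

lemma theta_homotopic_iff:
  assumes "tpath zs"
  shows "theta_homotopic \<rho> \<theta> zs ws \<longleftrightarrow> zs \<simeq> ws"
proof
  let ?R = "\<lambda>zs ws. tpath zs \<and> tpath ws \<and> (lazification zs ws \<or> grid_homotopic \<rho> \<theta> zs ws)"
  have R: "zs \<simeq> ws" if "?R zs ws" for zs ws
    using that theq_lazification theq_grid_homotopic by blast
  show "theta_homotopic \<rho> \<theta> zs ws \<Longrightarrow> zs \<simeq> ws"
    unfolding theta_homotopic_def
  proof (induction rule: equivclp_induct)
    case base
    show ?case by (rule refl) (rule assms)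
  next
    case (step y z)
    then show ?case using R sym trans by blast
  qed
  have L: "equivclp ?R (xs @ [a] @ ys) (xs @ [a, a] @ ys)" if "tpath (xs @ [a] @ ys)" for xs a ys
    using that theqD(2)[OF stutter[OF that]] lazification_stutter[of xs a ys] by (intro r_into_equivclp) simp
  show "theta_homotopic \<rho> \<theta> zs ws" if "zs \<simeq> ws"
    using that unfolding theta_homotopic_def
  proof induction
    case (stutter xs a ys)
    then show ?case by (rule L)
  next
    case (square xs a b c ys d)
    have nr: "near a b" "near b c" "near a d" "near d c"
      using square by (auto simp: tpath_append)
    \<comment> \<open>The vertices \<open>b\<close> and \<open>d\<close> need not be near, so the
      two given paths need not be adjacent rows. Delaying one path at \<open>c\<close> and the other
      at \<open>a\<close> gives the columns \<open>a, a\<close> and \<open>b, a\<close> and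
      \<open>c, d\<close> and \<open>c, c\<close>, all of them near.\<close>
    have 1: "equivclp ?R (xs @ [a, b, c] @ ys) (xs @ [a, b, c, c] @ ys)"
      using L[of "xs @ [a, b]" c ys] square by simp
    have 2: "equivclp ?R (xs @ [a, d, c] @ ys) (xs @ [a, a, d, c] @ ys)"
      using L[of xs a "[d, c] @ ys"] square by simp
    have t: "tpath (xs @ [a, b, c, c] @ ys)" "tpath (xs @ [a, a, d, c] @ ys)"
      using square by (auto simp: tpath_append)
    have "list_all2 near (xs @ [a, b, c, c] @ ys) (xs @ [a, a, d, c] @ ys)"
      by (intro list_all2_appendI) (use nr in \<open>auto intro!: list.rel_refl simp: near_sym\<close>)
    then have "grid_homotopic \<rho> \<theta> (xs @ [a, b, c, c] @ ys) (xs @ [a, a, d, c] @ ys)"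
      by (rule grid_homotopic_row[OF _ t]) (auto simp: hd_append last_append)
    then have "equivclp ?R (xs @ [a, b, c, c] @ ys) (xs @ [a, a, d, c] @ ys)"
      by (intro r_into_equivclp) (use t in auto)
    then show ?case using 1 2 by (meson equivclp_sym equivclp_trans)
  qed (auto intro: equivclp_sym equivclp_trans)
qed

section \<open>The group of homotopy classes of closed theta-paths\<close>

abbreviation cls :: "'z list \<Rightarrow> 'z list set" where
  "cls \<equiv> theta_class \<rho> \<theta>"

lemma mem_cls: "tpath zs \<Longrightarrow> ws \<in> cls zs \<longleftrightarrow> zs \<simeq> ws"
  by (simp add: theta_class_def theta_homotopic_iff)

lemma cls_eq_iff: "tpath zs \<Longrightarrow> tpath ws \<Longrightarrow> cls zs = cls ws \<longleftrightarrow> zs \<simeq> ws"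
  by (auto simp: set_eq_iff mem_cls intro: refl sym trans)

lemma theq_join_cong:
  assumes "zs \<simeq> zs'" "ws \<simeq> ws'" "last zs = hd ws"
  shows "zs @ tl ws \<simeq> zs' @ tl ws'"
proof -
  have "zs @ tl ws \<simeq> zs @ ws" using assms by (intro theq_join) (auto dest: theqD)
  also have "\<dots> \<simeq> zs' @ ws'" using assms by (intro theq_append) simp_all
  also have "\<dots> \<simeq> zs' @ tl ws'"
    using assms(3) theqD[OF assms(1)] theqD[OF assms(2)] by (intro sym[OF theq_join]) simp_all
  finally show ?thesis .
qed

text \<open>The representative \<open>zs @ ws\<close> keeps the junction twice, so that
  associativity in \<open>group_discrete_pi1\<close> is that of append.\<close>

lemma mult_cls:
  assumes "tpath zs" "tpath ws" "last zs = hd ws"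
  shows "cls zs \<otimes>\<^bsub>discrete_pi1 \<rho> \<theta> z0\<^esub> cls ws = cls (zs @ ws)"
proof -
  have "cls (zs' @ tl ws') = cls (zs @ ws)" if "zs' \<in> cls zs" "ws' \<in> cls ws" for zs' ws'
  proof -
    have "zs \<simeq> zs'" "ws \<simeq> ws'" using that assms by (auto simp: mem_cls)
    from theq_join_cong[OF this assms(3)] theq_join[OF assms] have "zs' @ tl ws' \<simeq> zs @ ws"
      by (blast intro: sym trans)
    then show ?thesis by (simp add: cls_eq_iff theqD)
  qed
  moreover have "zs \<in> cls zs" "ws \<in> cls ws" using assms by (auto simp: mem_cls refl)
  ultimately show ?thesis by (auto simp: discrete_pi1_def)
qed

lemma carrier_discrete_pi1:
  "carrier (discrete_pi1 \<rho> \<theta> z0) = cls ` {zs. tpath zs \<and> hd zs = z0 \<and> last zs = z0}"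
  by (simp add: discrete_pi1_def)

lemma one_discrete_pi1: "\<one>\<^bsub>discrete_pi1 \<rho> \<theta> z0\<^esub> = cls [z0]"
  by (simp add: discrete_pi1_def)

lemma tpath_rev: "tpath (rev zs) \<longleftrightarrow> tpath zs"
  by (simp add: tpath_iff successively_rev near_sym)

text \<open>Cancellation starts at the turning point in the middle: \<open>b, a, a, b\<close> loses
  its repetition, then its backtracking, and the tail \<open>zs\<close> is left in the same
  situation.\<close>

lemma theq_rev_append: "tpath zs \<Longrightarrow> rev zs @ zs \<simeq> [last zs]"
proof (induction zs)
  case (Cons a zs)
  have t: "tpath (rev (a # zs) @ a # zs)"
    using Cons.prems tpath_rev[of "a # zs"] by (simp add: tpath_iff successively_append_iff[of _ "rev (a # zs)"] last_rev del: rev.simps)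
  show ?case
  proof (cases zs)
    case Nil
    then show ?thesis using sym[OF theq_stutter1[of a "[]"]] by (simp add: tpath_iff)
  next
    case (Cons b bs)
    have t1: "tpath (b # zs)" "near a b" "tpath zs"
      using Cons.prems Cons by (auto simp: tpath_iff)
    have "rev bs @ (b # a # a # zs) @ [] \<simeq> rev bs @ (b # a # zs) @ []"
      by (intro theq_context[OF theq_Cons[OF sym[OF theq_stutter1]]])
        (use t Cons Cons.prems t1 in \<open>auto simp: near_sym\<close>)
    also have "\<dots> \<simeq> rev bs @ (b # zs) @ []"
    proof (rule theq_context)
      show "b # a # zs \<simeq> b # zs"
        using theq_backtrack[of b a bs] theq_stutter1[of b bs] t1 Cons near_sym by (auto intro: trans)
    qed (use theqD(2)[OF calculation] in simp)
    also have "\<dots> \<simeq> [last zs]" using Cons.IH t1 Cons by simp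
    finally show ?thesis using Cons by simp
  qed
qed (simp add: tpath_iff)

lemma group_discrete_pi1: "group (discrete_pi1 \<rho> \<theta> z0)"
proof (rule groupI)
  let ?P = "discrete_pi1 \<rho> \<theta> z0"
  show "\<one>\<^bsub>?P\<^esub> \<in> carrier ?P"
    unfolding one_discrete_pi1 carrier_discrete_pi1 by (rule imageI) (simp add: tpath_iff)
  fix A assume "A \<in> carrier ?P"
  then obtain zs where A: "A = cls zs" and zs: "tpath zs" "hd zs = z0" "last zs = z0"
    by (auto simp: carrier_discrete_pi1)
  have "[z0] @ zs \<simeq> zs"
    using zs sym[OF theq_stutter1[of z0 "tl zs"]] by (cases zs) (auto simp: tpath_iff)
  then show "\<one>\<^bsub>?P\<^esub> \<otimes>\<^bsub>?P\<^esub> A = A"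
    unfolding A one_discrete_pi1 using zs
    by (subst mult_cls) (auto simp: tpath_iff[of "[_]"] cls_eq_iff theqD)
  have "cls (rev zs) \<otimes>\<^bsub>?P\<^esub> A = \<one>\<^bsub>?P\<^esub>"
    unfolding A one_discrete_pi1 using zs theq_rev_append[OF zs(1)]
    by (subst mult_cls) (auto simp: tpath_rev last_rev tpath_iff[of "[_]"] cls_eq_iff theqD)
  moreover have "cls (rev zs) \<in> carrier ?P"
    unfolding carrier_discrete_pi1 using zs by (intro imageI) (auto simp: tpath_rev last_rev hd_rev)
  ultimately show "\<exists>B\<in>carrier ?P. B \<otimes>\<^bsub>?P\<^esub> A = \<one>\<^bsub>?P\<^esub>" by blast
  fix B assume "B \<in> carrier ?P"
  then obtain ws where B: "B = cls ws" and ws: "tpath ws" "hd ws = z0" "last ws = z0"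
    by (auto simp: carrier_discrete_pi1)
  have t: "tpath (zs @ ws)" using zs ws by (simp add: tpath_iff successively_append_iff)
  show "A \<otimes>\<^bsub>?P\<^esub> B \<in> carrier ?P"
    unfolding A B using zs ws t
    by (subst mult_cls) (auto simp: carrier_discrete_pi1 tpath_iff intro!: imageI)
  fix C assume "C \<in> carrier ?P"
  then obtain vs where C: "C = cls vs" and vs: "tpath vs" "hd vs = z0" "last vs = z0"
    by (auto simp: carrier_discrete_pi1)
  have t': "tpath (ws @ vs)" using vs ws by (simp add: tpath_iff successively_append_iff)
  have ne: "zs \<noteq> []" "ws \<noteq> []" "vs \<noteq> []" using zs ws vs by (auto simp: tpath_iff)
  show "A \<otimes>\<^bsub>?P\<^esub> B \<otimes>\<^bsub>?P\<^esub> C = A \<otimes>\<^bsub>?P\<^esub> (B \<otimes>\<^bsub>?P\<^esub> C)"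
    unfolding A B C using zs ws vs t t' ne by (simp add: mult_cls)
qed

text \<open>This is what survives a change of base point: classes at different vertices lie in
  different groups, but triviality can still be compared, by \<open>null_conj\<close>.\<close>

definition null :: "'z list \<Rightarrow> bool" where
  "null zs \<longleftrightarrow> zs \<simeq> [hd zs]"

lemma null_theq: "zs \<simeq> ws \<Longrightarrow> null zs \<longleftrightarrow> null ws"
  unfolding null_def by (metis sym trans theqD(3))

lemma null_conj:
  assumes "tpath zs" "hd zs = last zs" "near a (hd zs)"
  shows "null (a # zs @ [a]) \<longleftrightarrow> null zs"
proof
  have t: "tpath (a # zs @ [a])"
    using assms by (auto simp: tpath_iff successively_Cons successively_append_iff near_sym)
  have na: "near (hd zs) a" using assms(3) near_sym by blast
  {
    assume n: "null zs"
    then have "[a] @ zs @ [a] \<simeq> [a] @ [hd zs] @ [a]"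
      by (intro theq_context) (use t in \<open>auto simp: null_def\<close>)
    also have "\<dots> \<simeq> [a]" using theq_backtrack[of a "hd zs" "[]"] assms by (simp add: tpath_iff)
    finally show "null (a # zs @ [a])" by (simp add: null_def)
  next
    assume n: "null (a # zs @ [a])"
    obtain z zs' where zs: "zs = z # zs'" using assms(1) by (cases zs) (auto simp: tpath_iff)
    have lz: "last zs = z" using assms zs by simp
    have "zs = [] @ zs @ []" by simp
    \<comment> \<open>The conjugation is undone by conjugating back with the same edge. The result
      contracts to \<open>[z]\<close>, while removing the backtrackings at its two ends returns
      \<open>zs\<close>.\<close>
    have "[z] @ (a # zs @ [a]) @ [z] \<simeq> [z] @ [a] @ [z]"
    proof (rule theq_context)
      show "tpath ([z] @ (a # zs @ [a]) @ [z])"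
        using t zs na lz assms(3) by (cases "zs' = []") (auto simp: tpath_iff successively_append_iff successively_Cons)
    qed (use n in \<open>simp add: null_def\<close>)
    also have "\<dots> \<simeq> [z]" using theq_backtrack[of z a "[]"] na zs by (simp add: tpath_iff)
    finally have 1: "z # a # zs @ [a, z] \<simeq> [z]" by simp
    have "z # a # zs @ [a, z] \<simeq> zs @ [a, z]"
      using theq_backtrack[of z a "zs' @ [a, z]"] theqD(1)[OF 1] zs na assms(3)
      by (cases "zs' = []") (auto simp: tpath_iff successively_Cons)
    moreover have "zs @ [a, z] \<simeq> zs"
    proof -
      have e: "zs = butlast zs @ [z]" using zs lz by (metis append_butlast_last_id list.discI)
      have "butlast zs @ [z, a, z] @ [] \<simeq> butlast zs @ [z] @ []"
        by (rule theq_context, use theq_backtrack[of z a "[]"] na zs in \<open>simp add: tpath_iff\<close>)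
          (use theqD(2)[OF calculation] e in \<open>metis append.assoc append_Cons append_Nil append_Nil2\<close>)
      then show ?thesis using e by (metis append.assoc append_Cons append_Nil append_Nil2)
    qed
    ultimately show "null zs" using 1 zs unfolding null_def by (metis list.sel(1) sym trans)
  }
qed

end

section \<open>Reparametrised paths\<close>

text \<open>The parameter interval is convex, so \<open>f\<close> can be moved to \<open>f'\<close>
  along straight lines whatever the target space is. All homotopies between constant, reversed and
  subdivided paths below are of this kind.\<close>

lemma homotopic_paths_reparam:
  fixes g :: "real \<Rightarrow> 'a::topological_space" and f f' :: "real \<Rightarrow> real"
  assumes g: "path g"
    and f: "continuous_on {0..1} f" "f ` {0..1} \<subseteq> {0..1}"
    and f': "continuous_on {0..1} f'" "f' ` {0..1} \<subseteq> {0..1}"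
    and ends: "f 0 = f' 0" "f 1 = f' 1"
    and p: "\<And>u. u \<in> {0..1} \<Longrightarrow> p u = g (f u)"
    and q: "\<And>u. u \<in> {0..1} \<Longrightarrow> q u = g (f' u)"
  shows "homotopic_paths UNIV p q"
  unfolding homotopic_paths
proof (intro exI conjI ballI)
  \<comment> \<open>\<open>fst z\<close> is the time and \<open>snd z\<close> the path parameter,
    the order used by \<open>homotopic_paths\<close>; spatial homotopies use the opposite
    order.\<close>
  define F where "F z = (1 - fst z) * f (snd z) + fst z * f' (snd z)" for z :: "real \<times> real"
  have cf: "continuous_on ({0..1} \<times> {0..1}) F"
    unfolding F_def
    by (intro continuous_intros continuous_on_compose2[OF f(1)] continuous_on_compose2[OF f'(1)]) auto
  have img: "F z \<in> {0..1}" if "z \<in> {0..1} \<times> {0..1}" for z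
  proof -
    have "f (snd z) \<in> {0..1}" "f' (snd z) \<in> {0..1}" using f(2) f'(2) that by auto
    then show ?thesis
      using that convex_bound_le[of "f (snd z)" 1 "f' (snd z)" "1 - fst z" "fst z"]
      by (auto simp: F_def)
  qed
  show "continuous_on ({0..1} \<times> {0..1}) (\<lambda>z. g (F z))"
    by (rule continuous_on_compose2[OF _ cf]) (use g img in \<open>auto simp: path_def\<close>)
  show "pathstart ((\<lambda>z. g (F z)) \<circ> Pair t) = pathstart p"
    "pathfinish ((\<lambda>z. g (F z)) \<circ> Pair t) = pathfinish p" for t
    using p[of 0] p[of 1] ends by (simp_all add: pathstart_def pathfinish_def F_def algebra_simps)
qed (auto simp: p q)

lemma homotopic_paths_const_join:
  fixes g :: "real \<Rightarrow> 'a::topological_space"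
  assumes "path g"
  shows "homotopic_paths UNIV ((\<lambda>_. g 0) +++ g) g"
  proof (rule homotopic_paths_reparam[OF assms, where f = "\<lambda>u. max 0 (2 * u - 1)" and f' = "\<lambda>u. u"])
  fix u :: real assume "u \<in> {0..1}"
  then show "((\<lambda>_. g 0) +++ g) u = g (max 0 (2 * u - 1))"
    by (cases u "1 / 2 :: real" rule: linorder_cases) (auto simp: joinpaths_def mult.commute[of 2])
qed (auto intro!: continuous_intros)

lemma homotopic_paths_join_const:
  fixes g :: "real \<Rightarrow> 'a::topological_space"
  assumes "path g"
  shows "homotopic_paths UNIV (g +++ (\<lambda>_. g 1)) g"
  proof (rule homotopic_paths_reparam[OF assms, where f = "\<lambda>u. min 1 (2 * u)" and f' = "\<lambda>u. u"])
  fix u :: real assume "u \<in> {0..1}"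
  then show "(g +++ (\<lambda>_. g 1)) u = g (min 1 (2 * u))"
    by (cases u "1 / 2 :: real" rule: linorder_cases) (auto simp: joinpaths_def mult.commute[of 2])
qed (auto intro!: continuous_intros)

text \<open>Running backwards and then forwards along \<open>g\<close> means taking \<open>g\<close>
  at the parameter \<open>\<bar>2 * u - 1\<bar>\<close>, which is moved to the constant parameter
  1.\<close>

lemma homotopic_paths_reverse_join:
  fixes g :: "real \<Rightarrow> 'a::topological_space"
  assumes "path g"
  shows "homotopic_paths UNIV (reversepath g +++ g) (\<lambda>_. g 1)"
proof (rule homotopic_paths_reparam[OF assms, where f = "\<lambda>u. \<bar>2 * u - 1\<bar>" and f' = "\<lambda>u. 1"])
  fix u :: real assume "u \<in> {0..1}"
  then show "(reversepath g +++ g) u = g \<bar>2 * u - 1\<bar>"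
    by (cases u "1 / 2 :: real" rule: linorder_cases) (auto simp: joinpaths_def mult.commute[of 2] reversepath_def abs_if)
qed (auto intro!: continuous_intros)

definition seg :: "real \<Rightarrow> real \<Rightarrow> (real \<Rightarrow> 'a) \<Rightarrow> real \<Rightarrow> 'a" where
  "seg a b g u = g (a + (b - a) * u)"

lemma homotopic_paths_seg_join:
  fixes g :: "real \<Rightarrow> 'a::topological_space"
  assumes "path g" "0 \<le> a" "a \<le> b" "b \<le> c" "c \<le> 1"
  shows "homotopic_paths UNIV (seg a b g +++ seg b c g) (seg a c g)"
\<comment> \<open>\<open>f\<close> crosses \<open>[a, b]\<close> in the first half of the time and
  \<open>[b, c]\<close> in the second, whereas \<open>f'\<close> crosses \<open>[a, c]\<close> at
  constant speed.\<close>
proof (rule homotopic_paths_reparam[OF assms(1),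
    where f = "\<lambda>u. a + (b - a) * min 1 (2 * u) + (c - b) * max 0 (2 * u - 1)" and f' = "\<lambda>u. a + (c - a) * u"])
  show "(\<lambda>u. a + (c - a) * u) ` {0..1} \<subseteq> {0..1}"
  proof clarify
    fix u :: real assume u: "u \<in> {0..1}"
    then have "(c - a) * u \<le> (c - a) * 1" by (intro mult_left_mono) (use assms in auto)
    then show "a + (c - a) * u \<in> {0..1}" using u assms by simp
  qed
  show "(\<lambda>u. a + (b - a) * min 1 (2 * u) + (c - b) * max 0 (2 * u - 1)) ` {0..1} \<subseteq> {0..1}"
  proof clarify
    fix u :: real assume u: "u \<in> {0..1}"
    have "(b - a) * min 1 (2 * u) \<le> (b - a) * 1" "(c - b) * max 0 (2 * u - 1) \<le> (c - b) * 1"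
      by (rule mult_left_mono; use assms u in \<open>auto simp: min_def max_def\<close>)+
    moreover have "0 \<le> (b - a) * min 1 (2 * u)" "0 \<le> (c - b) * max 0 (2 * u - 1)"
      using assms u by auto
    ultimately show "a + (b - a) * min 1 (2 * u) + (c - b) * max 0 (2 * u - 1) \<in> {0..1}"
      using assms by auto
  qed
  fix u :: real assume "u \<in> {0..1}"
  then show "(seg a b g +++ seg b c g) u =
      g (a + (b - a) * min 1 (2 * u) + (c - b) * max 0 (2 * u - 1))"
    by (cases "u \<le> 1 / 2") (auto simp: joinpaths_def seg_def algebra_simps max_def min_def)
qed (auto intro!: continuous_intros simp: seg_def algebra_simps)

section \<open>The calculus of jumping-paths\<close>

lemma jumping_path_single: "jumping_path S \<phi> ([g], []) \<longleftrightarrow> path g"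
  by (simp add: jumping_path_def)

lemma jumping_path_Cons: "jumping_path S \<phi> (g # gs, l # ls) \<longleftrightarrow>
    path g \<and> l \<in> letters S \<and> gs \<noteq> [] \<and> hd gs 0 = \<phi> [l] (g 1) \<and> jumping_path S \<phi> (gs, ls)"
proof -
  have "hd gs = gs ! 0" if "gs \<noteq> []" using that by (rule hd_conv_nth)
  then show ?thesis
    by (cases gs) (auto simp: jumping_path_def less_Suc_eq_0_disj)
qed

lemma jumping_path_append:
  assumes "length gs = Suc (length ss)" "length hs = Suc (length ts)"
  shows "jumping_path S \<phi> (gs @ hs, ss @ l # ts) \<longleftrightarrow>
    jumping_path S \<phi> (gs, ss) \<and> l \<in> letters S \<and> hd hs 0 = \<phi> [l] (last gs 1) \<and> jumping_path S \<phi> (hs, ts)"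
  using assms
proof (induction ss arbitrary: gs)
  case Nil
  then obtain g where "gs = [g]" by (cases gs) auto
  then show ?case using Nil by (auto simp: jumping_path_Cons jumping_path_single)
next
  case (Cons s ss)
  then obtain g gs' where "gs = g # gs'" by (cases gs) auto
  moreover from this have "gs' \<noteq> []" using Cons.prems by auto
  ultimately show ?case using Cons by (auto simp: jumping_path_Cons)
qed

lemma jumping_path_induct [consumes 1, case_names single Cons]:
  assumes "jumping_path S \<phi> p"
    and "\<And>g. path g \<Longrightarrow> P ([g], [])"
    and "\<And>g l p. path g \<Longrightarrow> l \<in> letters S \<Longrightarrow> jumping_path S \<phi> p \<Longrightarrow> jstart p = \<phi> [l] (g 1) \<Longrightarrow> P p \<Longrightarrow>
      P (g # pieces p, l # jumps p)"
  shows "P p"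
proof -
  obtain gs ls where p: "p = (gs, ls)" by (cases p)
  have "P (gs, ls)" if "jumping_path S \<phi> (gs, ls)" using that
  proof (induction ls arbitrary: gs)
    case Nil
    then obtain g where "gs = [g]" by (cases gs) (auto simp: jumping_path_def)
    then show ?case using Nil assms(2) by (simp add: jumping_path_single)
  next
    case (Cons l ls)
    then obtain g gs' where "gs = g # gs'" by (cases gs) (auto simp: jumping_path_def)
    then show ?case using Cons assms(3)[of g l "(gs', ls)"] by (auto simp: jumping_path_Cons jstart_def)
  qed
  then show ?thesis using assms(1) p by simp
qed

lemma jumping_path_cases [consumes 1, case_names single Cons]:
  assumes "jumping_path S \<phi> p"
  obtains g where "p = ([g], [])" "path g"
  | g l p' where "p = (g # pieces p', l # jumps p')" "path g" "l \<in> letters S" "jumping_path S \<phi> p'"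
      "jstart p' = \<phi> [l] (g 1)"
proof -
  have "(\<exists>g. p = ([g], []) \<and> path g) \<or> (\<exists>g l p'. p = (g # pieces p', l # jumps p') \<and> path g \<and>
      l \<in> letters S \<and> jumping_path S \<phi> p' \<and> jstart p' = \<phi> [l] (g 1))"
    using assms by (induction rule: jumping_path_induct) blast+
  then show thesis using that by blast
qed

lemma jumping_path_pieces: "jumping_path S \<phi> p \<Longrightarrow> length (pieces p) = Suc (length (jumps p))"
  by (simp add: jumping_path_def)

lemma jumping_path_nonempty: "jumping_path S \<phi> p \<Longrightarrow> pieces p \<noteq> []"
  by (auto simp: jumping_path_def)

lemma jstart_nth: "jumping_path S \<phi> p \<Longrightarrow> jstart p = (pieces p ! 0) 0"
  by (simp add: jstart_def hd_conv_nth jumping_path_nonempty)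

lemma jfinish_nth: "jumping_path S \<phi> p \<Longrightarrow> jfinish p = (pieces p ! length (jumps p)) 1"
  by (simp add: jfinish_def last_conv_nth jumping_path_nonempty jumping_path_pieces)

lemma jstart_single [simp]: "jstart ([g], ls) = g 0"
  and jfinish_single [simp]: "jfinish ([g], ls) = g 1"
  by (simp_all add: jstart_def jfinish_def)

lemma jstart_Cons [simp]: "jstart (g # gs, ls) = g 0"
  and jfinish_Cons: "gs \<noteq> [] \<Longrightarrow> jfinish (g # gs, ls) = jfinish (gs, ls')"
  by (simp_all add: jstart_def jfinish_def)

lemma jconcat_Cons: "gs \<noteq> [] \<Longrightarrow>
    jconcat (g # gs, l # ls) q = (g # pieces (jconcat (gs, ls) q), l # jumps (jconcat (gs, ls) q))"
  by (simp add: jconcat_def)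

lemma jconcat_single: "jconcat ([g], []) q = ((g +++ hd (pieces q)) # tl (pieces q), jumps q)"
  by (simp add: jconcat_def)

lemma pieces_jconcat_nonempty [simp]: "pieces (jconcat p q) \<noteq> []"
  by (simp add: jconcat_def)

lemma jumping_path_jconcat:
  assumes "jumping_path S \<phi> p" "jumping_path S \<phi> q" "jfinish p = jstart q"
  shows "jumping_path S \<phi> (jconcat p q)" "jstart (jconcat p q) = jstart p" "jfinish (jconcat p q) = jfinish q"
proof -
  have "jumping_path S \<phi> (jconcat p q) \<and> jstart (jconcat p q) = jstart p \<and> jfinish (jconcat p q) = jfinish q"
    using assms
  proof (induction rule: jumping_path_induct)
    case (single g)
    have join: "path (g +++ h)" "(g +++ h) 0 = g 0" "(g +++ h) 1 = h 1" if "path h" "g 1 = h 0" for h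
      using single(1) that path_join_imp[of g h] by (auto simp: pathstart_def pathfinish_def joinpaths_def)
    from single(2) show ?case
    proof (cases rule: jumping_path_cases)
      case (single h)
      then show ?thesis using join[of h] \<open>jfinish ([g], []) = jstart q\<close>
        by (simp add: jconcat_single jumping_path_single)
    next
      case (Cons h l q')
      then show ?thesis using join[of h] \<open>jfinish ([g], []) = jstart q\<close> jumping_path_nonempty[OF Cons(4)]
        by (simp add: jconcat_single jumping_path_Cons jfinish_def)
          (simp add: jstart_def)
    qed
  next
    case (Cons g l p)
    have ne: "pieces p \<noteq> []" by (rule jumping_path_nonempty[OF Cons(3)])
    have f: "jfinish p = jstart q"
      using Cons.prems ne by (simp add: jfinish_Cons[of _ _ _ "jumps p"])
    have s: "hd (pieces (jconcat p q)) 0 = jstart (jconcat p q)" by (simp add: jstart_def)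
    show ?case
      using Cons.IH[OF Cons.prems(1) f] Cons.hyps ne s
      by (simp add: jconcat_Cons jumping_path_Cons jfinish_Cons[of _ _ _ "jumps (jconcat p q)"])
  qed
  then show "jumping_path S \<phi> (jconcat p q)" "jstart (jconcat p q) = jstart p" "jfinish (jconcat p q) = jfinish q"
    by auto
qed

lemma nth_pieces_jconcat:
  assumes "length (pieces p) = Suc n" "pieces q \<noteq> []"
  shows "pieces (jconcat p q) ! i =
    (if i < n then pieces p ! i else if i = n then pieces p ! n +++ pieces q ! 0 else pieces q ! (i - n))"
proof -
  obtain h hs where q: "pieces q = h # hs" using assms(2) by (cases "pieces q") auto
  obtain gs g where p: "pieces p = gs @ [g]" "length gs = n"
    using assms(1) by (metis append_butlast_last_id diff_Suc_1 length_butlast list.size(3) nat.distinct(1))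
  have "i = n \<or> i < n \<or> (\<exists>k. i = Suc (n + k))" by (metis less_imp_Suc_add linorder_neqE_nat)
  then show ?thesis using q p by (auto simp: jconcat_def nth_append)
qed

section \<open>Cutting a rectifiable path into short pieces\<close>

text \<open>A real-valued form of the sums in \<open>path_length\<close>, so that differences can be
  estimated by linear arithmetic; \<open>variation_sum\<close> gives the translation.\<close>

fun variation :: "(real \<Rightarrow> 'a::metric_space) \<Rightarrow> real list \<Rightarrow> real" where
  "variation g (s # t # ts) = dist (g s) (g t) + variation g (t # ts)"
| "variation g _ = 0"

lemma variation_nonneg: "0 \<le> variation g ts"
  by (induction g ts rule: variation.induct) auto

lemma variation_sum:
  "(\<Sum>i<length ts - 1. ennreal (dist (g (ts ! i)) (g (ts ! Suc i)))) = ennreal (variation g ts)"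
proof (induction g ts rule: variation.induct)
  case (1 g s t ts)
  have "(\<Sum>i<length (s # t # ts) - 1. ennreal (dist (g ((s # t # ts) ! i)) (g ((s # t # ts) ! Suc i)))) =
      ennreal (dist (g s) (g t)) +
      (\<Sum>i<length (t # ts) - 1. ennreal (dist (g ((t # ts) ! i)) (g ((t # ts) ! Suc i))))"
    by (simp add: sum.lessThan_Suc_shift del: sum.lessThan_Suc)
  then show ?case using 1 by (simp add: variation_nonneg flip: ennreal_plus)
qed simp_all

lemma path_length_variation:
  "path_length g = (SUP ts\<in>{ts. sorted ts \<and> set ts \<subseteq> {0..1}}. ennreal (variation g ts))"
  unfolding path_length_def variation_sum ..

lemma variation_append: "variation g (xs @ [t] @ ys) = variation g (xs @ [t]) + variation g (t # ys)"
proof (induction xs)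
  case (Cons x xs)
  then show ?case by (cases xs) simp_all
qed simp

text \<open>By the triangle inequality; a node added at one end contributes a nonnegative extra
  term.\<close>

lemma variation_insert: "variation g (xs @ ys) \<le> variation g (xs @ [t] @ ys)"
proof (induction xs)
  case Nil
  then show ?case by (cases ys) simp_all
next
  case (Cons x xs)
  show ?case
  proof (cases xs)
    case Nil
    have "dist (g x) (g y) \<le> dist (g x) (g t) + dist (g t) (g y)" for y by (rule dist_triangle)
    then show ?thesis using Nil by (cases ys) (simp_all add: add.assoc[symmetric] add_right_mono)
  qed (use Cons in simp)
qed

lemma variation_map: "variation g (map f ts) = variation (\<lambda>u. g (f u)) ts"
  by (induction "\<lambda>u. g (f u)" ts rule: variation.induct) auto

text \<open>Refining a partition whose sum is within \<open>e / 2\<close> of the supremum gains at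
  most \<open>e / 2\<close>, so on an interval without interior nodes the length exceeds the chord
  by at most \<open>e / 2\<close>. By continuity the chords of sufficiently short intervals are at
  most \<open>e / 2\<close> too, and \<open>Q\<close> passes from these intervals to
  \<open>[0, 1]\<close> by compactness.\<close>

lemma rectifiable_path_induct:
  fixes g :: "real \<Rightarrow> 'a::metric_space"
  assumes g: "path g" and fin: "path_length g < \<infinity>" and e: "0 < e"
    and short: "\<And>a b. 0 \<le> a \<Longrightarrow> a \<le> b \<Longrightarrow> b \<le> 1 \<Longrightarrow> path_length (seg a b g) \<le> ennreal e \<Longrightarrow> Q a b"
    and join: "\<And>a b c. 0 \<le> a \<Longrightarrow> a \<le> b \<Longrightarrow> b \<le> c \<Longrightarrow> c \<le> 1 \<Longrightarrow> Q a b \<Longrightarrow> Q b c \<Longrightarrow> Q a c"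
  shows "Q 0 1"
proof -
  let ?T = "{ts :: real list. sorted ts \<and> set ts \<subseteq> {0..1}}"
  have ne: "[] \<in> ?T" by simp
  obtain L where L: "path_length g = ennreal L" "0 \<le> L"
    using fin by (cases "path_length g" rule: ennreal_cases) auto
  have bound: "variation g ts \<le> L" if "ts \<in> ?T" for ts
  proof -
    have "ennreal (variation g ts) \<le> path_length g"
      unfolding path_length_variation using that by (rule SUP_upper)
    then show ?thesis using L by (simp add: ennreal_le_iff)
  qed
  define B where "B = (SUP ts\<in>?T. variation g ts)"
  have bdd: "bdd_above (variation g ` ?T)"
    using bound by (intro bdd_aboveI[of _ L]) auto
  have upB: "variation g ts \<le> B" if "ts \<in> ?T" for ts
    unfolding B_def using that bdd by (rule cSUP_upper)
  have "\<exists>ts\<in>?T. B - e / 2 < variation g ts"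
  proof (rule ccontr)
    assume "\<not> ?thesis"
    then have "(SUP ts\<in>?T. variation g ts) \<le> B - e / 2"
      using ne by (intro cSUP_least) (blast, force simp: not_less)
    then have "B \<le> B - e / 2" unfolding B_def .
    then show False using e by simp
  qed
  then obtain ts where ts: "sorted ts" "set ts \<subseteq> {0..1}" "B - e / 2 < variation g ts" by auto
  have piece: "Q a b"
    if ab: "0 \<le> a" "a \<le> b" "b \<le> 1" "\<And>t. t \<in> set ts \<Longrightarrow> a < t \<Longrightarrow> b \<le> t" "dist (g a) (g b) \<le> e / 2" for a b
  proof (rule short[OF ab(1-3)])
    \<comment> \<open>No node of \<open>ts\<close> lies strictly between \<open>a\<close> and
      \<open>b\<close>, so \<open>ts\<close> splits into the nodes up to \<open>a\<close> and those
      from \<open>b\<close> on, and any \<open>us\<close> in \<open>[a, b]\<close> fits in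
      between.\<close>
    define xs where "xs = takeWhile (\<lambda>t. t \<le> a) ts"
    define zs where "zs = dropWhile (\<lambda>t. t \<le> a) ts"
    have tz: "ts = xs @ zs" by (simp add: xs_def zs_def)
    have xs: "t \<le> a" if "t \<in> set xs" for t using that by (auto simp: xs_def dest: set_takeWhileD)
    have zs: "b \<le> t" if "t \<in> set zs" for t
    proof -
      have "zs \<noteq> []" "sorted zs" using that ts(1) tz by (auto simp: sorted_append)
      moreover have "a < hd zs" using hd_dropWhile[of "\<lambda>t. t \<le> a" ts] calculation(1) by (simp add: zs_def)
      moreover have "hd zs \<le> t" using \<open>sorted zs\<close> that by (cases zs) auto
      ultimately show ?thesis using ab(4)[of t] that tz by simp
    qed
    have var: "variation g us \<le> e" if us: "sorted us" "set us \<subseteq> {a..b}" for us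
    proof -
      have "sorted (xs @ [a] @ us @ [b] @ zs)"
        using us ts(1) tz xs zs ab(2) by (fastforce simp: sorted_append)
      moreover have "set (xs @ [a] @ us @ [b] @ zs) \<subseteq> {0..1}"
        using ts(2) tz us ab by auto
      ultimately have "variation g (xs @ [a] @ us @ [b] @ zs) \<le> B" by (intro upB) simp
      moreover have "variation g (xs @ [a] @ us @ [b] @ zs) =
          variation g (xs @ [a]) + (variation g ([a] @ us @ [b]) + variation g (b # zs))"
        using variation_append[of g xs a "us @ [b] @ zs"] variation_append[of g "[a] @ us" b zs] by simp
      moreover have "variation g us \<le> variation g ([a] @ us @ [b])"
        using variation_insert[of g "[]" us a] variation_insert[of g "a # us" "[]" b] by simp
      moreover have "variation g ts \<le> variation g (xs @ [a]) + (dist (g a) (g b) + variation g (b # zs))"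
      proof -
        have "variation g ts \<le> variation g (xs @ [a] @ zs)" unfolding tz by (rule variation_insert)
        also have "\<dots> \<le> variation g ((xs @ [a]) @ [b] @ zs)" using variation_insert[of g "xs @ [a]" zs b] by simp
        also have "\<dots> = variation g (xs @ [a]) + (dist (g a) (g b) + variation g (b # zs))"
          using variation_append[of g xs a "b # zs"] by simp
        finally show ?thesis .
      qed
      ultimately show ?thesis using ts(3) ab(5) by linarith
    qed
    show "path_length (seg a b g) \<le> ennreal e"
      unfolding path_length_variation
    proof (rule SUP_least)
      fix us assume us: "us \<in> ?T"
      have "variation (seg a b g) us = variation g (map (\<lambda>u. a + (b - a) * u) us)"
        by (simp add: variation_map seg_def[abs_def])
      also have "\<dots> \<le> e"
      proof (rule var)
        have "mono (\<lambda>u. a + (b - a) * u)" using ab(2) by (intro monoI) (simp add: mult_left_mono)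
        then show "sorted (map (\<lambda>u. a + (b - a) * u) us)" using us
          by (auto simp: sorted_wrt_map mono_def intro: sorted_wrt_mono_rel[rotated])
        have "a + (b - a) * u \<in> {a..b}" if "u \<in> {0..1}" for u
          using that ab(2) mult_left_le[of u "b - a"] by auto
        then show "set (map (\<lambda>u. a + (b - a) * u) us) \<subseteq> {a..b}" using us by fastforce
      qed
      finally show "ennreal (variation (seg a b g) us) \<le> ennreal e" by (rule ennreal_leI)
    qed
  qed
  have "0 \<le> (0::real) \<and> (1::real) \<le> 1 \<longrightarrow> Q 0 1"
  proof (rule Bolzano[where P = "\<lambda>a b. 0 \<le> a \<and> b \<le> 1 \<longrightarrow> Q a b"])
    fix x :: real assume x: "0 \<le> x" "x \<le> 1"
    have "uniformly_continuous_on {0..1} g"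
      using g by (simp add: path_def compact_uniformly_continuous)
    then obtain d where d: "0 < d" "\<And>s t. s \<in> {0..1} \<Longrightarrow> t \<in> {0..1} \<Longrightarrow> dist t s < d \<Longrightarrow> dist (g t) (g s) < e / 2"
      unfolding uniformly_continuous_on_def using e half_gt_zero by metis
    \<comment> \<open>\<open>d'\<close> separates \<open>x\<close> from all other nodes. Since
      \<open>x\<close> may be a node itself, an interval around \<open>x\<close> is cut at
      \<open>x\<close> before \<open>piece\<close> is applied to its two parts.\<close>
    obtain d' where d': "0 < d'" "\<forall>t\<in>set ts. t \<noteq> x \<longrightarrow> d' \<le> dist x t"
      using finite_set_avoid[of "set ts" x] by auto
    show "\<exists>d>0. \<forall>a b. a \<le> x \<and> x \<le> b \<and> b - a < d \<longrightarrow> (0 \<le> a \<and> b \<le> 1 \<longrightarrow> Q a b)"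
    proof (intro exI[of _ "min d d'"] conjI allI impI)
      fix a b assume ab: "a \<le> x \<and> x \<le> b \<and> b - a < min d d'" "0 \<le> a \<and> b \<le> 1"
      have "x \<le> t" if "t \<in> set ts" "a < t" for t
        using d'(2) that ab by (force simp: dist_real_def)
      moreover have "dist (g a) (g x) \<le> e / 2"
        using d(2)[of x a] ab x by (simp add: dist_real_def less_imp_le)
      ultimately have 1: "Q a x" using ab x by (intro piece) auto
      have "b \<le> t" if "t \<in> set ts" "x < t" for t
        using d'(2) that ab by (force simp: dist_real_def)
      moreover have "dist (g x) (g b) \<le> e / 2"
        using d(2)[of b x] ab x by (simp add: dist_real_def less_imp_le)
      ultimately have 2: "Q x b" using ab x by (intro piece) auto
      show "Q a b" using join[OF _ _ _ _ 1 2] ab by simp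
    qed (use d d' in simp)
  qed (use join in auto)
  then show ?thesis by simp
qed

section \<open>Homotopies of jumping-paths\<close>

lemma const_path_ends: "const_path c \<Longrightarrow> c 1 = c 0"
  unfolding const_path_def by (erule ballE[where x = 1]) simp_all

locale warped_action =
  fixes S :: "'s set" and \<phi> :: "'s letter list \<Rightarrow> 'a::metric_space \<Rightarrow> 'a"
  assumes acts: "acts_by_homeomorphisms S \<phi>"
begin

lemma letter_in_carrier: "l \<in> letters S \<Longrightarrow> [l] \<in> carrier (free_group S)"
  by (simp add: free_group_def)

lemma act_inv [simp]: "l \<in> letters S \<Longrightarrow> \<phi> [letter_inv l] (\<phi> [l] x) = x"
proof -
  assume l: "l \<in> letters S"
  have ga: "group_action (free_group S) UNIV \<phi>"
    using acts by (simp add: acts_by_homeomorphisms_def)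
  have "\<phi> ([letter_inv l] \<otimes>\<^bsub>free_group S\<^esub> [l]) x = \<phi> [letter_inv l] (\<phi> [l] x)"
    by (rule group_action.composition_rule[OF ga]) (simp_all add: letter_in_carrier l)
  moreover have "\<phi> \<one>\<^bsub>free_group S\<^esub> x = x"
    using fun_cong[OF group_action.id_eq_one[OF ga], of x] by simp
  ultimately show ?thesis by (simp add: free_group_def)
qed

abbreviation jp :: "('s, 'a) jpath \<Rightarrow> bool" where "jp \<equiv> jumping_path S \<phi>"
abbreviation cjp :: "('s, 'a) jpath \<Rightarrow> bool" where "cjp \<equiv> closed_jumping_path S \<phi>"

abbreviation jeq :: "('s, 'a) jpath \<Rightarrow> ('s, 'a) jpath \<Rightarrow> bool" (infix "\<asymp>" 50) where
  "p \<asymp> q \<equiv> jhomotopic S \<phi> p q"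

abbreviation feq :: "('s, 'a) jpath \<Rightarrow> ('s, 'a) jpath \<Rightarrow> bool" (infix "\<frown>" 50) where
  "p \<frown> q \<equiv> freely_jhomotopic S \<phi> p q"

abbreviation jmult :: "('s, 'a) jpath \<Rightarrow> ('s, 'a) jpath \<Rightarrow> ('s, 'a) jpath" (infixr "\<cdot>" 70) where
  "p \<cdot> q \<equiv> jconcat p q"

definition jconst :: "'a \<Rightarrow> ('s, 'a) jpath" where
  "jconst x = ([\<lambda>_. x], [])"

lemma jp_jconst [simp]: "jp (jconst x)" "jstart (jconst x) = x" "jfinish (jconst x) = x"
  by (simp_all add: jconst_def jumping_path_single path_def)

lemma jeq_refl [simp]: "p \<asymp> p"
  by (simp add: jhomotopic_def)

lemma jeq_sym: "p \<asymp> q \<Longrightarrow> q \<asymp> p"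
  unfolding jhomotopic_def by (rule equivclp_sym)

lemma jeq_trans [trans]: "p \<asymp> q \<Longrightarrow> q \<asymp> r \<Longrightarrow> p \<asymp> r"
  unfolding jhomotopic_def by (rule equivclp_trans)

lemma feq_refl [simp]: "p \<frown> p"
  by (simp add: freely_jhomotopic_def)

lemma feq_sym: "p \<frown> q \<Longrightarrow> q \<frown> p"
  unfolding freely_jhomotopic_def by (rule equivclp_sym)

lemma feq_trans [trans]: "p \<frown> q \<Longrightarrow> q \<frown> r \<Longrightarrow> p \<frown> r"
  unfolding freely_jhomotopic_def by (rule equivclp_trans)

lemma spatially_homotopic_ends:
  assumes "spatially_homotopic \<phi> p q"
  shows "jstart q = jstart p" "jfinish q = jfinish p"
  using assms unfolding spatially_homotopic_def by force+

lemma contraction_ends: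
  assumes "contraction p q"
  shows "jstart q = jstart p" "jfinish q = jfinish p"
proof -
  obtain gs g c h hs ss l ts where
    "p = (gs @ [g, c, h] @ hs, ss @ [l, letter_inv l] @ ts)" "q = (gs @ [g +++ h] @ hs, ss @ ts)"
    using assms unfolding contraction_def by blast
  then show "jstart q = jstart p" "jfinish q = jfinish p"
    by (auto simp: jstart_def jfinish_def joinpaths_def hd_append)
qed

lemma jeqD:
  assumes "p \<asymp> q" "jp p"
  shows "jp q" "jstart q = jstart p" "jfinish q = jfinish p"
proof -
  have "jp q \<and> jstart q = jstart p \<and> jfinish q = jfinish p"
    using assms(1) unfolding jhomotopic_def
  proof (induction rule: equivclp_induct)
    case (step y z)
    then show ?case using spatially_homotopic_ends contraction_ends by metis
  qed (use assms in auto)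
  then show "jp q" "jstart q = jstart p" "jfinish q = jfinish p" by auto
qed

lemma jeq_spatial: "jp p \<Longrightarrow> jp q \<Longrightarrow> spatially_homotopic \<phi> p q \<Longrightarrow> p \<asymp> q"
  unfolding jhomotopic_def by (rule r_into_equivclp) simp

lemma jeq_contraction: "jp p \<Longrightarrow> jp q \<Longrightarrow> contraction p q \<Longrightarrow> p \<asymp> q"
  unfolding jhomotopic_def by (rule r_into_equivclp) simp

lemma spatially_homotopic_imp_freely:
  assumes "spatially_homotopic \<phi> p q" "jstart p = jfinish p"
  shows "freely_spatially_homotopic \<phi> p q"
  using assms unfolding spatially_homotopic_def freely_spatially_homotopic_def by metis

text \<open>Spatial homotopies and contractions keep the ends, so all intermediate jumping-paths
  stay closed and each move is also a free one.\<close>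

lemma jeq_imp_feq:
  assumes "p \<asymp> q" "cjp p"
  shows "p \<frown> q"
proof -
  have "cjp q \<and> p \<frown> q"
    using assms(1) unfolding jhomotopic_def
  proof (induction rule: equivclp_induct)
    case (step y z)
    then have c: "cjp z"
      unfolding closed_jumping_path_def using spatially_homotopic_ends contraction_ends by metis
    have "a \<frown> b" if "cjp a" "cjp b" "spatially_homotopic \<phi> a b \<or> contraction a b" for a b
      unfolding freely_jhomotopic_def
      using that spatially_homotopic_imp_freely[of a b] unfolding closed_jumping_path_def
      by (intro r_into_equivclp) blast
    then have "y \<frown> z" using step c feq_sym by blast
    then show ?case using step c feq_trans by blast
  qed (use assms in auto)
  then show ?thesis by simp
qed

section \<open>Gluing spatial homotopies along concatenations\<close>

lemma jumps_jconcat: "jumps (p \<cdot> q) = jumps p @ jumps q"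
  by (simp add: jconcat_def)

text \<open>Here \<open>n\<close> is the index of the last piece of the first jumping-path. It is
  merged with piece 0 of the second one, so later pieces are shifted by \<open>n\<close> and not by
  \<open>n + 1\<close>; the merged piece is joined at each time separately.\<close>

definition hjoin :: "nat \<Rightarrow> (nat \<Rightarrow> real \<times> real \<Rightarrow> 'a) \<Rightarrow> (nat \<Rightarrow> real \<times> real \<Rightarrow> 'a) \<Rightarrow> nat \<Rightarrow> real \<times> real \<Rightarrow> 'a"
  where "hjoin n H K i =
    (if i < n then H i
     else if i = n then (\<lambda>z. ((\<lambda>u. H n (u, snd z)) +++ (\<lambda>u. K 0 (u, snd z))) (fst z))
     else K (i - n))"

lemma hjoin_start: "hjoin n H K 0 (0, t) = H 0 (0, t)"
  by (auto simp: hjoin_def joinpaths_def)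

lemma hjoin_finish: "hjoin n H K (n + m) (1, t) = K m (1, t)"
  by (auto simp: hjoin_def joinpaths_def)

lemma continuous_on_hjoin:
  fixes H K :: "real \<times> real \<Rightarrow> 'a"
  assumes H: "continuous_on ({0..1} \<times> {0..1}) H" and K: "continuous_on ({0..1} \<times> {0..1}) K"
    and m: "\<And>t. t \<in> {0..1} \<Longrightarrow> H (1, t) = K (0, t)"
  shows "continuous_on ({0..1::real} \<times> {0..1::real})
    (\<lambda>z. ((\<lambda>u. H (u, snd z)) +++ (\<lambda>u. K (u, snd z))) (fst z))"
proof -
  \<comment> \<open>The coordinates are exchanged because the joining lemma for homotopies takes the
    time first.\<close>
  have sw: "continuous_on ({0..1} \<times> {0..1}) (\<lambda>y. F (snd y, fst y))"
    if "continuous_on ({0..1} \<times> {0..1}) F" for F :: "real \<times> real \<Rightarrow> 'a"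
    by (rule continuous_on_compose2[OF that]) (auto intro!: continuous_intros)
  have "continuous_on ({0..1} \<times> {0..1})
      (\<lambda>y. ((\<lambda>t u. H (u, t)) (fst y) +++ (\<lambda>t u. K (u, t)) (fst y)) (snd y))"
    by (rule continuous_on_homotopic_join_lemma)
      (use sw[OF H] sw[OF K] m in \<open>auto simp: pathstart_def pathfinish_def\<close>)
  from sw[of "\<lambda>y. ((\<lambda>t u. H (u, t)) (fst y) +++ (\<lambda>t u. K (u, t)) (fst y)) (snd y)", OF this]
  show ?thesis by simp
qed

text \<open>Only the junction is constrained. The outer ends may move, so the statement serves based
  and free homotopies alike.\<close>

lemma spatial_homotopy_jconcat:
  assumes H: "spatial_homotopy \<phi> H p p'" and K: "spatial_homotopy \<phi> K q q'"
    and lp: "length (pieces p) = Suc n" "length (jumps p) = n"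
    and lq: "length (pieces q) = Suc (length (jumps q))"
    and m: "\<And>t. t \<in> {0..1} \<Longrightarrow> H n (1, t) = K 0 (0, t)"
  shows "spatial_homotopy \<phi> (hjoin n H K) (p \<cdot> q) (p' \<cdot> q')"
proof -
  have lens: "length (pieces p') = Suc n" "length (pieces q') = Suc (length (jumps q))"
    "jumps p' = jumps p" "jumps q' = jumps q"
    using H K lp lq by (auto simp: spatial_homotopy_def)
  have ne: "pieces q \<noteq> []" "pieces q' \<noteq> []" using lens lq by auto
  have len: "length (pieces (a \<cdot> b)) = Suc n + length (jumps q)"
    if "length (pieces a) = Suc n" "length (pieces b) = Suc (length (jumps q))" for a b
    using that by (simp add: jconcat_def)
  show ?thesis
    unfolding spatial_homotopy_def
  proof (intro conjI allI impI ballI)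
    show "jumps (p \<cdot> q) = jumps (p' \<cdot> q')" using lens by (simp add: jconcat_def)
    show "length (pieces (p \<cdot> q)) = length (pieces (p' \<cdot> q'))"
      using lens lp lq by (simp add: len)
  next
    fix i assume "i < length (pieces (p \<cdot> q))"
    then have i: "i < Suc n + length (jumps q)" using lp lq by (simp add: len)
    consider "i < n" | "i = n" | k where "i = n + k" "0 < k" "k < length (pieces q)"
      using i lq by (metis add_Suc_right add_less_cancel_left add_Suc less_imp_add_positive linorder_neqE_nat)
    then show "continuous_on ({0..1} \<times> {0..1}) (hjoin n H K i)"
    proof cases
      case 2
      then show ?thesis
        using continuous_on_hjoin[of "H n" "K 0"] H K lp lq m unfolding hjoin_def spatial_homotopy_def
        by simp
    qed (use H K lp in \<open>auto simp: hjoin_def spatial_homotopy_def\<close>)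
    fix u :: real assume u: "u \<in> {0..1}"
    show "hjoin n H K i (u, 0) = (pieces (p \<cdot> q) ! i) u" "hjoin n H K i (u, 1) = (pieces (p' \<cdot> q') ! i) u"
      using H K u i lp lq ne lens
      by (auto simp: nth_pieces_jconcat hjoin_def spatial_homotopy_def joinpaths_def)
  next
    fix i and t :: real assume "i < length (jumps (p \<cdot> q))" and t: "t \<in> {0..1}"
    then have i: "i < n + length (jumps q)" using lp by (simp add: jconcat_def)
    have j: "jumps (p \<cdot> q) ! i = (if i < n then jumps p ! i else jumps q ! (i - n))"
      using lp by (simp add: jconcat_def nth_append)
    show "hjoin n H K (Suc i) (0, t) = \<phi> [jumps (p \<cdot> q) ! i] (hjoin n H K i (1, t))"
    proof (cases "i < n")
      case True
      have "hjoin n H K (Suc i) (0, t) = H (Suc i) (0, t)" "hjoin n H K i (1, t) = H i (1, t)"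
        using True by (cases "Suc i = n"; simp add: hjoin_def joinpaths_def)+
      then show ?thesis using True H t lp unfolding j spatial_homotopy_def by auto
    next
      case False
      then obtain k where k: "i = n + k" by (metis le_iff_add not_less)
      have "hjoin n H K (Suc i) (0, t) = K (Suc k) (0, t)" "hjoin n H K i (1, t) = K k (1, t)"
        using k by (auto simp: hjoin_def joinpaths_def)
      then show ?thesis using k K t i unfolding j spatial_homotopy_def by auto
    qed
  qed
qed

lemma spatially_homotopic_jconcat:
  assumes "jp p" "jp q" "jfinish p = jstart q"
    and "spatially_homotopic \<phi> p p'" "spatially_homotopic \<phi> q q'"
  shows "spatially_homotopic \<phi> (p \<cdot> q) (p' \<cdot> q')"
proof -
  let ?n = "length (jumps p)"
  obtain H K where H: "spatial_homotopy \<phi> H p p'" and K: "spatial_homotopy \<phi> K q q'"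
    and eH: "\<forall>t\<in>{0..1}. H 0 (0, t) = jstart p \<and> H 0 (0, t) = jstart p' \<and>
           H ?n (1, t) = jfinish p \<and> H ?n (1, t) = jfinish p'"
    and eK: "\<forall>t\<in>{0..1}. K 0 (0, t) = jstart q \<and> K 0 (0, t) = jstart q' \<and>
           K (length (jumps q)) (1, t) = jfinish q \<and> K (length (jumps q)) (1, t) = jfinish q'"
    using assms(4,5) unfolding spatially_homotopic_def by blast
  have lens: "length (pieces p) = Suc ?n" "length (pieces q) = Suc (length (jumps q))"
    using assms(1,2) jumping_path_pieces by blast+
  have "spatial_homotopy \<phi> (hjoin ?n H K) (p \<cdot> q) (p' \<cdot> q')"
    by (rule spatial_homotopy_jconcat[OF H K _ _ lens(2)]) (use lens eH eK assms(3) in auto)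
  moreover have ends: "jstart (p \<cdot> q) = jstart p" "jfinish (p \<cdot> q) = jfinish q"
    using jumping_path_jconcat[OF assms(1-3)] by auto
  moreover have "jstart (p' \<cdot> q') = H 0 (0, 1)" "jfinish (p' \<cdot> q') = K (length (jumps q)) (1, 1)"
  proof -
    have l': "length (pieces p') = Suc ?n" "length (pieces q') = Suc (length (jumps q))"
      using H K lens by (auto simp: spatial_homotopy_def)
    then have ne: "pieces q' \<noteq> []" by auto
    have "(pieces p' ! 0) 0 = H 0 (0, 1)" "(pieces q' ! length (jumps q)) 1 = K (length (jumps q)) (1, 1)"
      using H K lens unfolding spatial_homotopy_def by simp_all
    moreover have "jstart (p' \<cdot> q') = (pieces (p' \<cdot> q') ! 0) 0"
      by (simp add: jstart_def hd_conv_nth)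
    moreover have "jfinish (p' \<cdot> q') = (pieces (p' \<cdot> q') ! (?n + length (jumps q))) 1"
      using l' by (simp add: jfinish_def last_conv_nth) (simp add: jconcat_def l')
    ultimately show "jstart (p' \<cdot> q') = H 0 (0, 1)" "jfinish (p' \<cdot> q') = K (length (jumps q)) (1, 1)"
      using l' ne by (auto simp: nth_pieces_jconcat[OF l'(1) ne] joinpaths_def)
  qed
  ultimately show ?thesis
    unfolding spatially_homotopic_def
    by (intro exI[of _ "hjoin ?n H K"])
      (use eH eK in \<open>simp add: hjoin_start hjoin_finish jumps_jconcat\<close>)
qed

lemma spatial_homotopy_const:
  assumes "jp p"
  shows "spatial_homotopy \<phi> (\<lambda>i z. (pieces p ! i) (fst z)) p p"
  unfolding spatial_homotopy_def
proof (intro conjI allI impI ballI)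
  fix i assume "i < length (pieces p)"
  then have "path (pieces p ! i)" using assms by (auto simp: jumping_path_def)
  then show "continuous_on ({0..1} \<times> {0..1}) (\<lambda>z. (pieces p ! i) (fst z))"
    unfolding path_def by (rule continuous_on_compose2) (auto intro!: continuous_intros)
qed (use assms in \<open>auto simp: jumping_path_def\<close>)

lemma spatially_homotopic_refl: "jp p \<Longrightarrow> spatially_homotopic \<phi> p p"
  unfolding spatially_homotopic_def
  using spatial_homotopy_const by (fastforce simp: jstart_nth jfinish_nth)

text \<open>A homotopy relative to the ends leaves both ends of each piece at rest, so the jump
  conditions hold at all times.\<close>

lemma spatially_homotopic_pieces:
  assumes "jp (gs, ls)" and h: "list_all2 (homotopic_paths UNIV) gs gs'"
  shows "jp (gs', ls)" "spatially_homotopic \<phi> (gs, ls) (gs', ls)"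
proof -
  have len: "length gs' = length gs" "length gs = Suc (length ls)"
    using h assms(1) by (auto dest: list_all2_lengthD jumping_path_pieces)
  have hp: "homotopic_paths UNIV (gs ! i) (gs' ! i)" if "i < length gs" for i
    using h that by (simp add: list_all2_conv_all_nth)
  have ends: "(gs' ! i) 0 = (gs ! i) 0" "(gs' ! i) 1 = (gs ! i) 1" if "i < length gs" for i
    using homotopic_paths_imp_pathstart[OF hp[OF that]] homotopic_paths_imp_pathfinish[OF hp[OF that]]
    by (auto simp: pathstart_def pathfinish_def)
  show j: "jp (gs', ls)"
    using assms(1) len ends homotopic_paths_imp_path[OF hp] by (auto simp: jumping_path_def in_set_conv_nth)
  have "\<forall>i\<in>{..<length gs}. \<exists>K :: real \<times> real \<Rightarrow> 'a. continuous_on ({0..1} \<times> {0..1}) K \<and>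
      (\<forall>u\<in>{0..1}. K (0, u) = (gs ! i) u) \<and> (\<forall>u\<in>{0..1}. K (1, u) = (gs' ! i) u) \<and>
      (\<forall>t\<in>{0..1}. K (t, 0) = (gs ! i) 0 \<and> K (t, 1) = (gs ! i) 1)"
  proof
    fix i assume "i \<in> {..<length gs}"
    then obtain K :: "real \<times> real \<Rightarrow> 'a" where "continuous_on ({0..1} \<times> {0..1}) K" "\<forall>u\<in>{0..1}. K (0, u) = (gs ! i) u"
      "\<forall>u\<in>{0..1}. K (1, u) = (gs' ! i) u" "\<forall>t\<in>{0..1}. K (t, 0) = (gs ! i) 0 \<and> K (t, 1) = (gs ! i) 1"
      using hp[of i] unfolding homotopic_paths pathstart_def pathfinish_def comp_def by auto
    then show "\<exists>K :: real \<times> real \<Rightarrow> 'a. continuous_on ({0..1} \<times> {0..1}) K \<and>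
      (\<forall>u\<in>{0..1}. K (0, u) = (gs ! i) u) \<and> (\<forall>u\<in>{0..1}. K (1, u) = (gs' ! i) u) \<and>
      (\<forall>t\<in>{0..1}. K (t, 0) = (gs ! i) 0 \<and> K (t, 1) = (gs ! i) 1)"
      by (intro exI[of _ K]) simp
  qed
  then obtain K :: "nat \<Rightarrow> real \<times> real \<Rightarrow> 'a" where K: "\<And>i. i < length gs \<Longrightarrow> continuous_on ({0..1} \<times> {0..1}) (K i) \<and>
      (\<forall>u\<in>{0..1}. K i (0, u) = (gs ! i) u) \<and> (\<forall>u\<in>{0..1}. K i (1, u) = (gs' ! i) u) \<and>
      (\<forall>t\<in>{0..1}. K i (t, 0) = (gs ! i) 0 \<and> K i (t, 1) = (gs ! i) 1)"
    by (metis lessThan_iff)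
  have "continuous_on ({0..1} \<times> {0..1}) (\<lambda>z. K i (snd z, fst z))" if "i < length gs" for i
    by (rule continuous_on_compose2[OF conjunct1[OF K[OF that]]]) (auto intro!: continuous_intros)
  then have "spatial_homotopy \<phi> (\<lambda>i z. K i (snd z, fst z)) (gs, ls) (gs', ls)"
    unfolding spatial_homotopy_def using K len assms(1) by (simp add: jumping_path_def)
  then show "spatially_homotopic \<phi> (gs, ls) (gs', ls)"
    unfolding spatially_homotopic_def jstart_nth[OF assms(1)] jstart_nth[OF j] jfinish_nth[OF assms(1)] jfinish_nth[OF j]
    using K[of 0] K[of "length ls"] len ends[of 0] ends[of "length ls"]
    by (intro exI[of _ "\<lambda>i z. K i (snd z, fst z)"]) simp
qed

lemma jeq_pieces:
  assumes "jp (gs, ls)" "list_all2 (homotopic_paths UNIV) gs gs'"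
  shows "(gs, ls) \<asymp> (gs', ls)"
  using spatially_homotopic_pieces[OF assms] assms jeq_spatial by blast

lemma jeq_piece:
  assumes "jp (gs @ [g] @ hs, ls)" "homotopic_paths UNIV g g'"
  shows "(gs @ [g] @ hs, ls) \<asymp> (gs @ [g'] @ hs, ls)"
proof (rule jeq_pieces[OF assms(1)])
  have "homotopic_paths UNIV h h" if "h \<in> set gs \<union> set hs" for h
    using assms(1) that by (auto simp: jumping_path_def)
  then show "list_all2 (homotopic_paths UNIV) (gs @ [g] @ hs) (gs @ [g'] @ hs)"
    using assms(2) by (intro list_all2_appendI) (auto intro: list.rel_refl_strong)
qed

lemma jpath_snocE:
  assumes "jp p" obtains gs g ss where "p = (gs @ [g], ss)" "length gs = length ss" "g 1 = jfinish p" "path g"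
proof -
  obtain g gs where e: "pieces p = gs @ [g]"
    using jumping_path_nonempty[OF assms] by (metis append_butlast_last_id)
  then show thesis using that[of gs g "jumps p"] jumping_path_pieces[OF assms] assms
    by (cases p) (auto simp: jfinish_def jumping_path_def)
qed

lemma jpath_ConsE:
  assumes "jp p" obtains gs g ss where "p = (g # gs, ss)" "length gs = length ss" "g 0 = jstart p" "path g"
proof -
  obtain g gs where e: "pieces p = g # gs"
    using jumping_path_nonempty[OF assms] by (cases "pieces p") auto
  then show thesis using that[of g gs "jumps p"] jumping_path_pieces[OF assms] assms
    by (cases p) (auto simp: jstart_def jumping_path_def)
qed

section \<open>Concatenation up to homotopy: associativity, units, congruence\<close>

lemma homotopic_paths_join_assoc:
  assumes "path g" "path h" "path k" "g 1 = h 0" "h 1 = (k 0 :: 'a)"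
  shows "homotopic_paths UNIV ((g +++ h) +++ k) (g +++ (h +++ k))"
  using assms homotopic_paths_sym[OF homotopic_paths_assoc[of g UNIV h k]]
  by (auto simp: pathstart_def pathfinish_def)

text \<open>The bracketing matters only when \<open>q\<close> is a single piece, which is then
  merged on both sides; otherwise the two sides are the same lists.\<close>

lemma jconcat_assoc:
  assumes "jp p" "jp q" "jp r" "jfinish p = jstart q" "jfinish q = jstart r"
  shows "(p \<cdot> q) \<cdot> r \<asymp> p \<cdot> (q \<cdot> r)"
proof -
  obtain gs g ss where p: "p = (gs @ [g], ss)" "g 1 = jfinish p" "path g" by (rule jpath_snocE[OF assms(1)])
  obtain ks k ts where r: "r = (k # ks, ts)" "k 0 = jstart r" "path k" by (rule jpath_ConsE[OF assms(3)])
  have pq: "jp (p \<cdot> q)" "jfinish (p \<cdot> q) = jstart r" using jumping_path_jconcat[OF assms(1,2,4)] assms(5) by auto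
  have pqr: "jp ((p \<cdot> q) \<cdot> r)" by (rule jumping_path_jconcat(1)[OF pq(1) assms(3) pq(2)])
  show ?thesis
  proof (cases "jumps q")
    case Nil
    then obtain h where q: "q = ([h], [])" "path h"
      using assms(2) Nil by (metis jumping_path_cases list.distinct(1) snd_conv)
    have "(gs @ [(g +++ h) +++ k] @ ks, ss @ ts) \<asymp> (gs @ [g +++ (h +++ k)] @ ks, ss @ ts)"
    proof (rule jeq_piece)
      show "jp (gs @ [(g +++ h) +++ k] @ ks, ss @ ts)"
        using pqr p r q by (simp add: jconcat_def)
      show "homotopic_paths UNIV ((g +++ h) +++ k) (g +++ (h +++ k))"
        by (rule homotopic_paths_join_assoc) (use p r q assms in auto)
    qed
    then show ?thesis using p r q by (simp add: jconcat_def)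
  next
    case (Cons l ls)
    then obtain h h' hs where "pieces q = h # hs @ [h']"
      using jumping_path_pieces[OF assms(2)] by (metis append_butlast_last_id length_0_conv length_Cons list.exhaust nat.distinct(1) nat.inject)
    then show ?thesis using p r by (simp add: jconcat_def butlast_append)
  qed
qed

lemma jconst_jconcat:
  assumes "jp p"
  shows "jconst (jstart p) \<cdot> p \<asymp> p"
proof -
  obtain g gs ss where p: "p = (g # gs, ss)" "g 0 = jstart p" "path g" by (rule jpath_ConsE[OF assms])
  have "([] @ [g] @ gs, ss) \<asymp> ([] @ [(\<lambda>_. g 0) +++ g] @ gs, ss)"
    by (rule jeq_piece) (use assms p(1) homotopic_paths_sym[OF homotopic_paths_const_join[OF p(3)]] in simp_all)
  then have "([\<lambda>_. g 0], []) \<cdot> p \<asymp> p"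
    unfolding p(1) by - (rule jeq_sym, simp add: jconcat_single)
  then show ?thesis using p(2) by (simp add: jconst_def)
qed

lemma jconcat_jconst:
  assumes "jp p"
  shows "p \<cdot> jconst (jfinish p) \<asymp> p"
proof -
  obtain gs g ss where p: "p = (gs @ [g], ss)" "g 1 = jfinish p" "path g" by (rule jpath_snocE[OF assms])
  have "(gs @ [g] @ [], ss) \<asymp> (gs @ [g +++ (\<lambda>_. g 1)] @ [], ss)"
    by (rule jeq_piece) (use assms p(1) homotopic_paths_sym[OF homotopic_paths_join_const[OF p(3)]] in simp_all)
  then have "p \<cdot> ([\<lambda>_. g 1], []) \<asymp> p"
    unfolding p(1) by - (rule jeq_sym, simp add: jconcat_def)
  then show ?thesis using p(2) by (simp add: jconst_def)
qed

text \<open>If the removed jumps follow the first piece of \<open>q\<close>, contracting before or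
  after the concatenation brackets three merged paths differently, and a homotopy of that piece
  mends this. Otherwise the concatenations are themselves related by a contraction.\<close>

lemma contraction_jconcat_left:
  assumes "contraction q q'" "jp p" "jp q" "jp q'" "jfinish p = jstart q"
  shows "p \<cdot> q \<asymp> p \<cdot> q'"
proof -
  obtain as a us where p: "p = (as @ [a], us)" "length as = length us" "a 1 = jfinish p" "path a"
    by (rule jpath_snocE[OF assms(2)])
  obtain gs g c h hs ss l ts where *: "length gs = length ss" "const_path c"
    "q = (gs @ [g, c, h] @ hs, ss @ [l, letter_inv l] @ ts)" "q' = (gs @ [g +++ h] @ hs, ss @ ts)"
    using assms(1) unfolding contraction_def by blast
  have e': "jfinish p = jstart q'" using contraction_ends[OF assms(1)] assms(5) by simp
  note j = jumping_path_jconcat(1)[OF assms(2,3,5)] jumping_path_jconcat(1)[OF assms(2,4) e']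
  show ?thesis
  proof (cases gs)
    case Nil
    have paths: "path g" "path h" "path c" using assms(3) * by (auto simp: jumping_path_def)
    \<comment> \<open>The jump, the constant piece and the inverse jump lead back to the point of
      departure.\<close>
    have gh: "g 1 = h 0"
    proof -
      have "l \<in> letters S" "c 0 = \<phi> [l] (g 1)" "h 0 = \<phi> [letter_inv l] (c 1)"
        using assms(3) * Nil by (simp_all add: jumping_path_Cons)
      moreover have "c 1 = c 0" using *(2) by (rule const_path_ends)
      ultimately show ?thesis by simp
    qed
    have h: "homotopic_paths UNIV ((a +++ g) +++ h) (a +++ (g +++ h))"
    proof (rule homotopic_paths_join_assoc)
      show "a 1 = g 0" using p(3) assms(5) *(3) Nil by simp
    qed (fact p(4) paths gh)+
    have jpc: "jp (as @ [a +++ (g +++ h)] @ hs, us @ ts)"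
      using j(2) p * Nil by (simp add: jconcat_def)
    have "list_all2 (homotopic_paths UNIV) (as @ [a +++ (g +++ h)] @ hs) (as @ [(a +++ g) +++ h] @ hs)"
      by (intro list_all2_appendI)
        (use homotopic_paths_sym[OF h] jpc in \<open>auto intro!: list.rel_refl_strong simp: jumping_path_def\<close>)
    note sp = spatially_homotopic_pieces[OF jpc this]
    have "p \<cdot> q = (as @ [a +++ g, c, h] @ hs, us @ [l, letter_inv l] @ ts)"
      using p * Nil by (simp add: jconcat_def)
    then have "contraction (p \<cdot> q) (as @ [(a +++ g) +++ h] @ hs, us @ ts)"
      unfolding contraction_def using p * Nil by blast
    then have "p \<cdot> q \<asymp> (as @ [(a +++ g) +++ h] @ hs, us @ ts)"
      by (rule jeq_contraction[OF j(1) sp(1)])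
    also have "\<dots> \<asymp> (as @ [a +++ (g +++ h)] @ hs, us @ ts)"
      by (rule jeq_sym, rule jeq_spatial[OF jpc sp])
    finally show ?thesis using p * Nil by (simp add: jconcat_def)
  next
    case (Cons b bs)
    have "contraction (p \<cdot> q) (p \<cdot> q')"
      unfolding contraction_def
      by (rule exI[of _ "as @ [a +++ b] @ bs"], rule exI[of _ g], rule exI[of _ c], rule exI[of _ h],
          rule exI[of _ hs], rule exI[of _ "us @ ss"], rule exI[of _ l], rule exI[of _ ts])
        (use p * Cons in \<open>simp add: jconcat_def\<close>)
    then show ?thesis by (rule jeq_contraction[OF j])
  qed
qed

text \<open>Mirror image of the previous case: the bracketing differs when the piece after the
  removed jumps is the last one of \<open>p\<close>.\<close>

lemma contraction_jconcat_right:
  assumes "contraction p p'" "jp p" "jp p'" "jp q" "jfinish p = jstart q"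
  shows "p \<cdot> q \<asymp> p' \<cdot> q"
proof -
  obtain a as us where q: "q = (a # as, us)" "length as = length us" "a 0 = jstart q" "path a"
    by (rule jpath_ConsE[OF assms(4)])
  obtain gs g c h hs ss l ts where *: "length gs = length ss" "const_path c"
    "p = (gs @ [g, c, h] @ hs, ss @ [l, letter_inv l] @ ts)" "p' = (gs @ [g +++ h] @ hs, ss @ ts)"
    using assms(1) unfolding contraction_def by blast
  have e': "jfinish p' = jstart q" using contraction_ends[OF assms(1)] assms(5) by simp
  note j = jumping_path_jconcat(1)[OF assms(2,4,5)] jumping_path_jconcat(1)[OF assms(3,4) e']
  show ?thesis
  proof (cases hs rule: rev_cases)
    case Nil
    have paths: "path g" "path h" "path c" using assms(2) * by (auto simp: jumping_path_def)
    have i: "(pieces p ! Suc i) 0 = \<phi> [jumps p ! i] ((pieces p ! i) 1)" if "i < length (jumps p)" for i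
      using assms(2) that by (auto simp: jumping_path_def)
    have "l \<in> letters S" using assms(2) * by (auto simp: jumping_path_def)
    then have gh: "g 1 = h 0"
      using i[of "length gs"] i[of "Suc (length gs)"] *(1,3,4) const_path_ends[OF *(2)] by (auto simp: nth_append)
    have h: "homotopic_paths UNIV ((g +++ h) +++ a) (g +++ (h +++ a))"
    proof (rule homotopic_paths_join_assoc)
      show "h 1 = a 0" using q(3) assms(5) *(3) Nil by (simp add: jfinish_def)
    qed (fact q(4) paths gh)+
    have jpc: "jp (gs @ [(g +++ h) +++ a] @ as, ss @ ts @ us)"
      using j(2) q * Nil by (simp add: jconcat_def)
    have "list_all2 (homotopic_paths UNIV) (gs @ [(g +++ h) +++ a] @ as) (gs @ [g +++ (h +++ a)] @ as)"
      by (intro list_all2_appendI)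
        (use h jpc in \<open>auto intro!: list.rel_refl_strong simp: jumping_path_def\<close>)
    note sp = spatially_homotopic_pieces[OF jpc this]
    have "p \<cdot> q = (gs @ [g, c, h +++ a] @ as, ss @ [l, letter_inv l] @ ts @ us)"
      using q * Nil by (simp add: jconcat_def butlast_append)
    then have "contraction (p \<cdot> q) (gs @ [g +++ (h +++ a)] @ as, ss @ ts @ us)"
      unfolding contraction_def using q * Nil by blast
    then have "p \<cdot> q \<asymp> (gs @ [g +++ (h +++ a)] @ as, ss @ ts @ us)"
      by (rule jeq_contraction[OF j(1) sp(1)])
    also have "\<dots> \<asymp> (gs @ [(g +++ h) +++ a] @ as, ss @ ts @ us)"
      by (rule jeq_sym, rule jeq_spatial[OF jpc sp])
    finally show ?thesis using q * Nil by (simp add: jconcat_def butlast_append)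
  next
    case (snoc bs b)
    have "contraction (p \<cdot> q) (p' \<cdot> q)"
      unfolding contraction_def
      by (rule exI[of _ gs], rule exI[of _ g], rule exI[of _ c], rule exI[of _ h],
          rule exI[of _ "bs @ [b +++ a] @ as"], rule exI[of _ ss], rule exI[of _ l], rule exI[of _ "ts @ us"])
        (use q * snoc in \<open>simp add: jconcat_def butlast_append\<close>)
    then show ?thesis by (rule jeq_contraction[OF j])
  qed
qed

lemma jconcat_cong_right:
  assumes "q \<asymp> q'" "jp p" "jp q" "jfinish p = jstart q"
  shows "p \<cdot> q \<asymp> p \<cdot> q'"
proof -
  have "equivclp (\<lambda>p q. jp p \<and> jp q \<and> (spatially_homotopic \<phi> p q \<or> contraction p q)) q q'"
    using assms(1) by (simp add: jhomotopic_def)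
  then show ?thesis
  proof (induction rule: equivclp_induct)
    case (step y z)
    have yz: "jp y" "jp z" using step by auto
    have "q \<asymp> y" using step unfolding jhomotopic_def by simp
    then have y: "jfinish p = jstart y" using jeqD assms(3,4) by metis
    then have z: "jfinish p = jstart z" using step spatially_homotopic_ends contraction_ends by metis
    have one: "p \<cdot> a \<asymp> p \<cdot> b"
      if "jp a" "jp b" "spatially_homotopic \<phi> a b \<or> contraction a b" "jfinish p = jstart a" "jfinish p = jstart b" for a b
      using that contraction_jconcat_left[OF _ assms(2)]
        spatially_homotopic_jconcat[OF assms(2) that(1,4) spatially_homotopic_refl[OF assms(2)]]
        jeq_spatial jumping_path_jconcat(1)[OF assms(2)] by metis
    have "p \<cdot> y \<asymp> p \<cdot> z"
      using step one[of y z] one[of z y] y z yz jeq_sym by blast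
    then show ?case using step jeq_trans by blast
  qed simp
qed

lemma jconcat_cong_left:
  assumes "p \<asymp> p'" "jp p" "jp q" "jfinish p = jstart q"
  shows "p \<cdot> q \<asymp> p' \<cdot> q"
proof -
  have "equivclp (\<lambda>p q. jp p \<and> jp q \<and> (spatially_homotopic \<phi> p q \<or> contraction p q)) p p'"
    using assms(1) by (simp add: jhomotopic_def)
  then show ?thesis
  proof (induction rule: equivclp_induct)
    case (step y z)
    have yz: "jp y" "jp z" using step by auto
    have "p \<asymp> y" using step unfolding jhomotopic_def by simp
    then have y: "jfinish y = jstart q" using jeqD assms(2,4) by metis
    then have z: "jfinish z = jstart q" using step spatially_homotopic_ends contraction_ends by metis
    have one: "a \<cdot> q \<asymp> b \<cdot> q"
      if "jp a" "jp b" "spatially_homotopic \<phi> a b \<or> contraction a b" "jfinish a = jstart q" "jfinish b = jstart q" for a b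
      using that contraction_jconcat_right[OF _ that(1,2) assms(3)]
        spatially_homotopic_jconcat[OF that(1) assms(3) that(4) _ spatially_homotopic_refl[OF assms(3)]]
        jeq_spatial jumping_path_jconcat(1)[OF _ assms(3)] by metis
    have "y \<cdot> q \<asymp> z \<cdot> q"
      using step one[of y z] one[of z y] y z yz jeq_sym by blast
    then show ?case using step jeq_trans by blast
  qed simp
qed

lemma jconcat_cong:
  assumes "p \<asymp> p'" "q \<asymp> q'" "jp p" "jp q" "jfinish p = jstart q"
  shows "p \<cdot> q \<asymp> p' \<cdot> q'"
  using jconcat_cong_left[OF assms(1,3,4,5)] jconcat_cong_right[OF assms(2) jeqD(1)[OF assms(1,3)] assms(4)]
    jeqD(3)[OF assms(1,3)] assms(5) jeq_trans by metis


section \<open>Inverses, and generation by continuous paths and single jumps\<close>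

lemmas jp_jconcat [simp] = jumping_path_jconcat[of S \<phi>]

lemma jp_piece: "path g \<Longrightarrow> jp ([g], [])"
  by (simp add: jumping_path_single)

lemma jeq_single: "homotopic_paths UNIV g h \<Longrightarrow> ([g], []) \<asymp> ([h], [])"
  using jeq_pieces[of "[g]" "[]" "[h]"] homotopic_paths_imp_path by (auto simp: jumping_path_single)

text \<open>Inverses in the groupoid of homotopy classes, as a relation between representatives.
  They are built by \<open>jpath_step_induct\<close> and unique up to homotopy only, so no formula
  for a reversed jumping-path has to be fixed.\<close>

definition jinverse :: "('s, 'a) jpath \<Rightarrow> ('s, 'a) jpath \<Rightarrow> bool" where
  "jinverse p q \<longleftrightarrow> jp p \<and> jp q \<and> jstart q = jfinish p \<and> jfinish q = jstart p \<and>
     p \<cdot> q \<asymp> jconst (jstart p) \<and> q \<cdot> p \<asymp> jconst (jfinish p)"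

lemma jinverse_sym: "jinverse p q \<Longrightarrow> jinverse q p"
  by (auto simp: jinverse_def)

lemma jinverse_single:
  assumes "path g"
  shows "jinverse ([g], []) ([reversepath g], [])"
proof -
  have 1: "homotopic_paths UNIV (reversepath g +++ g) (\<lambda>_. g 1)"
    using assms by (rule homotopic_paths_reverse_join)
  have 2: "homotopic_paths UNIV (g +++ reversepath g) (\<lambda>_. g 0)"
    using homotopic_paths_reverse_join[of "reversepath g"] assms
    by (simp add: path_reversepath) (simp add: reversepath_def)
  show ?thesis
    unfolding jinverse_def using assms jeq_single[OF 1] jeq_single[OF 2]
    by (simp add: jp_piece jconcat_single jconst_def path_reversepath) (simp add: reversepath_def)
qed

text \<open>Together with the continuous paths, these jumps between constant pieces generate the
  groupoid of jumping-paths up to homotopy.\<close>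

definition leap :: "'s letter \<Rightarrow> 'a \<Rightarrow> ('s, 'a) jpath" where
  "leap l x = ([\<lambda>_. x, \<lambda>_. \<phi> [l] x], [l])"

lemma jp_leap [simp]: "l \<in> letters S \<Longrightarrow> jp (leap l x)" "jstart (leap l x) = x" "jfinish (leap l x) = \<phi> [l] x"
  by (simp_all add: leap_def jumping_path_Cons jumping_path_single jfinish_def path_def)

lemma leap_leap:
  assumes "l \<in> letters S"
  shows "leap l x \<cdot> leap (letter_inv l) (\<phi> [l] x) \<asymp> jconst x"
proof -
  let ?p = "leap l x \<cdot> leap (letter_inv l) (\<phi> [l] x)"
  have c: "(\<lambda>_. a) +++ (\<lambda>_. a) = (\<lambda>_. a)" for a :: 'a by (simp add: joinpaths_def fun_eq_iff)
  have p: "?p = ([] @ [\<lambda>_. x, \<lambda>_. \<phi> [l] x, \<lambda>_. x] @ [], [] @ [l, letter_inv l] @ [])"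
    using assms by (simp add: jconcat_def leap_def c)
  have "contraction ?p ([] @ [(\<lambda>_. x) +++ (\<lambda>_. x)] @ [], [] @ [])"
    unfolding contraction_def p by (intro exI conjI) (auto simp: const_path_def)
  then have "contraction ?p (jconst x)" by (simp add: c jconst_def)
  then show ?thesis using assms by (intro jeq_contraction) simp_all
qed

lemma jinverse_leap:
  assumes "l \<in> letters S"
  shows "jinverse (leap l x) (leap (letter_inv l) (\<phi> [l] x))"
  using leap_leap[OF assms, of x] leap_leap[of "letter_inv l" "\<phi> [l] x"] assms
  by (simp add: jinverse_def)

lemma jinverse_jconcat:
  assumes "jinverse p p'" "jinverse q q'" "jfinish p = jstart q"
  shows "jinverse (p \<cdot> q) (q' \<cdot> p')"
proof -
  have half: "(p \<cdot> q) \<cdot> (q' \<cdot> p') \<asymp> jconst (jstart p)"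
    if a: "jinverse p p'" "jinverse q q'" "jfinish p = jstart q" for p p' q q'
  proof -
    have j: "jp p" "jp q" "jp p'" "jp q'" "jfinish q = jstart q'" "jfinish q' = jstart p'"
      "jfinish p = jstart p'" "jfinish q' = jstart q"
      using a by (auto simp: jinverse_def)
    have "(p \<cdot> q) \<cdot> (q' \<cdot> p') \<asymp> p \<cdot> (q \<cdot> (q' \<cdot> p'))"
      using j a(3) by (intro jconcat_assoc) simp_all
    also have "\<dots> \<asymp> p \<cdot> ((q \<cdot> q') \<cdot> p')"
      using j a(3) by (intro jconcat_cong_right jeq_sym[OF jconcat_assoc]) simp_all
    also have "\<dots> \<asymp> p \<cdot> (jconst (jstart q) \<cdot> p')"
    proof (intro jconcat_cong_right jconcat_cong_left)
      show "q \<cdot> q' \<asymp> jconst (jstart q)" using a(2) by (simp add: jinverse_def)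
    qed (use j a(3) in simp_all)
    also have "\<dots> \<asymp> p \<cdot> p'"
      using j a jconst_jconcat[of p'] by (intro jconcat_cong_right) simp_all
    also have "\<dots> \<asymp> jconst (jstart p)" using a by (simp add: jinverse_def)
    finally show ?thesis .
  qed
  have e: "jfinish q' = jstart p'" using assms by (auto simp: jinverse_def)
  show ?thesis
    unfolding jinverse_def
    using half[OF assms] half[OF jinverse_sym[OF assms(2)] jinverse_sym[OF assms(1)] e] assms e
    by (auto simp: jinverse_def)
qed

text \<open>The constant pieces of the leap are absorbed by the neighbouring pieces \<open>g\<close>
  and \<open>hd (pieces p)\<close>, by a homotopy of each.\<close>

lemma jeq_leap_Cons:
  assumes "path g" "l \<in> letters S" "jp p" "jstart p = \<phi> [l] (g 1)"
  shows "(g # pieces p, l # jumps p) \<asymp> ([g], []) \<cdot> (leap l (g 1) \<cdot> p)"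
proof -
  obtain h hs ls where p: "p = (h # hs, ls)" "h 0 = jstart p" "path h"
    using jpath_ConsE[OF assms(3)] by metis
  have h0: "\<phi> [l] (g 1) = h 0" using assms(4) p(2) by simp
  have jg: "jp (g # h # hs, l # ls)"
    using assms(1,2,3) p(1) h0[symmetric] by (simp add: jumping_path_Cons)
  have "path k" if "k \<in> set hs" for k using that assms(3) p(1) by (simp add: jumping_path_def)
  then have "list_all2 (homotopic_paths UNIV) (g # h # hs) ((g +++ (\<lambda>_. g 1)) # ((\<lambda>_. h 0) +++ h) # hs)"
    using homotopic_paths_sym[OF homotopic_paths_join_const[OF assms(1)]]
      homotopic_paths_sym[OF homotopic_paths_const_join[OF p(3)]]
    by (auto intro!: list.rel_refl_strong)
  from jeq_pieces[OF jg this] show ?thesis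
    unfolding p(1) leap_def h0 by (simp add: jconcat_def)
qed

text \<open>Induction over the generators of the groupoid. The decomposition in
  \<open>jeq_leap_Cons\<close> holds only up to homotopy, which is why invariance of
  \<open>P\<close> appears as a case.\<close>

lemma jpath_step_induct [consumes 1, case_names jeq single leap jconcat]:
  assumes "jp p"
    and jeq: "\<And>p q. jp p \<Longrightarrow> p \<asymp> q \<Longrightarrow> P p \<Longrightarrow> P q"
    and single: "\<And>g. path g \<Longrightarrow> P ([g], [])"
    and leap: "\<And>l x. l \<in> letters S \<Longrightarrow> P (leap l x)"
    and jconcat: "\<And>p q. jp p \<Longrightarrow> jp q \<Longrightarrow> jfinish p = jstart q \<Longrightarrow> P p \<Longrightarrow> P q \<Longrightarrow> P (p \<cdot> q)"
  shows "P p"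
  using assms(1)
proof (induction rule: jumping_path_induct)
  case (Cons g l p)
  have j: "jp (([g], []) \<cdot> (leap l (g 1) \<cdot> p))" "jp (leap l (g 1) \<cdot> p)" "jfinish (leap l (g 1)) = jstart p"
    using Cons by (simp_all add: jp_piece)
  have "P (([g], []) \<cdot> (leap l (g 1) \<cdot> p))"
    using Cons j by (intro jconcat single leap) (simp_all add: jp_piece)
  then show ?case
    using jeq[OF j(1) jeq_sym[OF jeq_leap_Cons[OF Cons(1-4)]]] by blast
qed (rule single)

lemma jinverse_jeq:
  assumes "jp p" "p \<asymp> p'" "jinverse p q"
  shows "jinverse p' q"
proof -
  have "p' \<cdot> q \<asymp> p \<cdot> q" "q \<cdot> p' \<asymp> q \<cdot> p"
    using assms jeqD[OF assms(2,1)] jeq_sym[OF assms(2)]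
    by (auto intro!: jconcat_cong_left jconcat_cong_right simp: jinverse_def)
  then show ?thesis
    using assms jeqD[OF assms(2,1)] jeq_trans unfolding jinverse_def by metis
qed

lemma jinverse_exists: "jp p \<Longrightarrow> \<exists>q. jinverse p q"
proof (induction rule: jpath_step_induct)
  case (jeq p q)
  then show ?case using jinverse_jeq by blast
next
  case (single g)
  then show ?case using jinverse_single by blast
next
  case (leap l x)
  then show ?case using jinverse_leap by blast
next
  case (jconcat p q)
  then show ?case using jinverse_jconcat by blast
qed

lemma jinverse_unique:
  assumes "jinverse p q" "jinverse p q'"
  shows "q \<asymp> q'"
proof -
  have j: "jp p" "jp q" "jp q'" "jfinish p = jstart q" "jfinish p = jstart q'" "jfinish q = jstart p" "jfinish q' = jstart p"
    using assms by (auto simp: jinverse_def)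
  have "q' \<asymp> jconst (jfinish p) \<cdot> q'" using jeq_sym[OF jconst_jconcat[of q']] j by simp
  also have "\<dots> \<asymp> (q \<cdot> p) \<cdot> q'"
    using j assms(1) by (intro jconcat_cong_left) (auto simp: jinverse_def jeq_sym)
  also have "\<dots> \<asymp> q \<cdot> (p \<cdot> q')" using j by (intro jconcat_assoc) auto
  also have "\<dots> \<asymp> q \<cdot> jconst (jstart p)"
    using j assms(2) by (intro jconcat_cong_right) (auto simp: jinverse_def)
  also have "\<dots> \<asymp> q" using jconcat_jconst[of q] j by simp
  finally show ?thesis by (rule jeq_sym)
qed

section \<open>The group of jumping-paths\<close>

abbreviation jcl :: "('s, 'a) jpath \<Rightarrow> ('s, 'a) jpath set" where "jcl \<equiv> jclass S \<phi>"

abbreviation J :: "'a \<Rightarrow> ('s, 'a) jpath set monoid" where "J \<equiv> jumping_pi1 S \<phi>"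

lemma jcl_eq_iff: "jcl p = jcl q \<longleftrightarrow> p \<asymp> q"
  unfolding jclass_def set_eq_iff mem_Collect_eq using jeq_trans jeq_sym jeq_refl by metis

lemma mem_jcl: "q \<in> jcl p \<longleftrightarrow> p \<asymp> q"
  by (simp add: jclass_def)

lemma mult_jcl:
  assumes "jp p" "jp q" "jfinish p = jstart q"
  shows "jcl p \<otimes>\<^bsub>J x0\<^esub> jcl q = jcl (p \<cdot> q)"
proof -
  have "jcl (p' \<cdot> q') = jcl (p \<cdot> q)" if "p' \<in> jcl p" "q' \<in> jcl q" for p' q'
    using jconcat_cong[of p p' q q'] that assms jeq_sym unfolding jcl_eq_iff mem_jcl by blast
  then have "(\<Union>p'\<in>jcl p. \<Union>q'\<in>jcl q. jcl (p' \<cdot> q')) = (\<Union>p'\<in>jcl p. \<Union>q'\<in>jcl q. jcl (p \<cdot> q))"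
    by (intro SUP_cong) auto
  also have "\<dots> = jcl (p \<cdot> q)"
    using jeq_refl[of p] jeq_refl[of q] unfolding mem_jcl[symmetric] by blast
  finally show ?thesis by (simp add: jumping_pi1_def)
qed

lemma carrier_J: "carrier (J x0) = jcl ` {p. jp p \<and> jstart p = x0 \<and> jfinish p = x0}"
  by (auto simp: jumping_pi1_def closed_jumping_path_def)

lemma one_J: "\<one>\<^bsub>J x0\<^esub> = jcl (jconst x0)"
  by (simp add: jumping_pi1_def jconst_def)

lemma group_J: "group (J x0)"
proof (rule groupI)
  show "\<one>\<^bsub>J x0\<^esub> \<in> carrier (J x0)" by (auto simp: carrier_J one_J)
  fix A assume "A \<in> carrier (J x0)"
  then obtain p where A: "A = jcl p" "jp p" "jstart p = x0" "jfinish p = x0" by (auto simp: carrier_J)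
  show "\<one>\<^bsub>J x0\<^esub> \<otimes>\<^bsub>J x0\<^esub> A = A"
    using A jconst_jconcat[of p] by (simp add: one_J mult_jcl jcl_eq_iff)
  obtain q where "jinverse p q" using jinverse_exists A by blast
  then show "\<exists>B\<in>carrier (J x0). B \<otimes>\<^bsub>J x0\<^esub> A = \<one>\<^bsub>J x0\<^esub>"
    using A by (intro bexI[of _ "jcl q"]) (auto simp: one_J mult_jcl jcl_eq_iff carrier_J jinverse_def)
  fix B assume "B \<in> carrier (J x0)"
  then obtain q where B: "B = jcl q" "jp q" "jstart q = x0" "jfinish q = x0" by (auto simp: carrier_J)
  show "A \<otimes>\<^bsub>J x0\<^esub> B \<in> carrier (J x0)"
    using A B by (auto simp: mult_jcl carrier_J)
  fix C assume "C \<in> carrier (J x0)"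
  then obtain r where C: "C = jcl r" "jp r" "jstart r = x0" "jfinish r = x0" by (auto simp: carrier_J)
  show "A \<otimes>\<^bsub>J x0\<^esub> B \<otimes>\<^bsub>J x0\<^esub> C = A \<otimes>\<^bsub>J x0\<^esub> (B \<otimes>\<^bsub>J x0\<^esub> C)"
    using A B C by (simp add: mult_jcl jcl_eq_iff jconcat_assoc)
qed

lemma inv_jcl:
  assumes "jinverse p q" "jstart p = x0" "jfinish p = x0"
  shows "inv\<^bsub>J x0\<^esub> jcl p = jcl q"
  using assms by (intro group.inv_equality[OF group_J])
    (auto simp: one_J mult_jcl jcl_eq_iff carrier_J jinverse_def)

section \<open>Conjugation is a free homotopy\<close>

lemma feq_spatial: "cjp p \<Longrightarrow> cjp q \<Longrightarrow> freely_spatially_homotopic \<phi> p q \<Longrightarrow> p \<frown> q"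
  unfolding freely_jhomotopic_def by (rule r_into_equivclp) simp

lemma feq_cyclic: "cjp p \<Longrightarrow> cjp q \<Longrightarrow> cyclic_contraction p q \<Longrightarrow> p \<frown> q"
  unfolding freely_jhomotopic_def by (rule r_into_equivclp) simp

lemma cjp_conj:
  assumes "jinverse a b" "cjp w" "jfinish a = jstart w"
  shows "jp (w \<cdot> b)" "jstart (w \<cdot> b) = jstart w" "cjp (a \<cdot> (w \<cdot> b))" "jstart (a \<cdot> (w \<cdot> b)) = jstart a"
  using assms by (auto simp: jinverse_def closed_jumping_path_def)

text \<open>The free moves below lead to \<open>w\<close> with constant paths attached at both ends;
  this removes them.\<close>

lemma feq_conj_const:
  assumes "cjp w"
  shows "jconst (jstart w) \<cdot> (w \<cdot> jconst (jstart w)) \<frown> w"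
proof -
  have w: "jp w" "jfinish w = jstart w" using assms by (auto simp: closed_jumping_path_def)
  have "w \<cdot> jconst (jstart w) \<asymp> w" using jconcat_jconst[of w] w by simp
  then have "jconst (jstart w) \<cdot> (w \<cdot> jconst (jstart w)) \<asymp> jconst (jstart w) \<cdot> w"
    using w by (intro jconcat_cong_right) simp_all
  also have "\<dots> \<asymp> w" using w jconst_jconcat by simp
  finally have "w \<asymp> jconst (jstart w) \<cdot> (w \<cdot> jconst (jstart w))" by (rule jeq_sym)
  from feq_sym[OF jeq_imp_feq[OF this assms]] show ?thesis .
qed

text \<open>The path \<open>g\<close> is retracted along itself: at time \<open>t\<close> the base
  point is \<open>g t\<close>, the first part runs from \<open>g t\<close> to \<open>g 1\<close>,
  \<open>w\<close> stays put, and the way back runs from \<open>g 1\<close> to \<open>g t\<close>.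
  At time 1 only constants remain around \<open>w\<close>.\<close>

lemma feq_conj_single:
  assumes g: "path g" and w: "cjp w" "jstart w = g 1"
  shows "([g], []) \<cdot> (w \<cdot> ([reversepath g], [])) \<frown> w"
proof -
  let ?n = "length (jumps w)"
  let ?r = "([reversepath g], []) :: ('s, 'a) jpath"
  define K where "K = hjoin ?n (\<lambda>i z. (pieces w ! i) (fst z)) (\<lambda>i z. g (1 - fst z * (1 - snd z)))"
  define H where "H = hjoin 0 (\<lambda>i z. g (snd z + (1 - snd z) * fst z)) K"
  have jw: "jp w" "jfinish w = g 1" using w by (auto simp: closed_jumping_path_def)
  have lw: "length (pieces w) = Suc ?n" using jumping_path_pieces[OF jw(1)] .
  have b: "t + (1 - t) * u \<in> {0..1}" "1 - u * (1 - t) \<in> {0..1}" if "u \<in> {0..1}" "t \<in> {0..1}" for t u :: real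
    using that convex_bound_le[of 1 1 u "t" "1 - t"] mult_left_le[of "1 - t" u] by auto
  have cg: "continuous_on {0..1} g" using g by (simp add: path_def)
  have s1: "spatial_homotopy \<phi> (\<lambda>i z. g (snd z + (1 - snd z) * fst z)) ([g], []) (jconst (g 1))"
    unfolding spatial_homotopy_def jconst_def
    by (auto intro!: continuous_on_compose2[OF cg] continuous_intros) (use b in force)+
  have s2: "spatial_homotopy \<phi> (\<lambda>i z. g (1 - fst z * (1 - snd z))) ?r (jconst (g 1))"
    unfolding spatial_homotopy_def jconst_def reversepath_def
    by (auto intro!: continuous_on_compose2[OF cg] continuous_intros) (use b in force)+
  have sK: "spatial_homotopy \<phi> K (w \<cdot> ?r) (w \<cdot> jconst (g 1))"
    unfolding K_def
    by (rule spatial_homotopy_jconcat[OF spatial_homotopy_const[OF jw(1)] s2 lw])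
      (use jw in \<open>auto simp: jfinish_nth\<close>)
  have jr: "jinverse ([g], []) ?r" using jinverse_single[OF g] .
  have jc: "jinverse (jconst (g 1)) (jconst (g 1))"
    using jinverse_single[of "\<lambda>_. g 1"] by (simp add: jconst_def path_def reversepath_def)
  have K0: "K 0 (0, t) = g 1" if "t \<in> {0..1}" for t
    unfolding K_def hjoin_start using w(2) jw(1) by (simp add: jstart_nth)
  have sH: "spatial_homotopy \<phi> H (([g], []) \<cdot> (w \<cdot> ?r)) (jconst (g 1) \<cdot> (w \<cdot> jconst (g 1)))"
    unfolding H_def
    by (rule spatial_homotopy_jconcat[OF s1 sK])
      (use K0 jumping_path_pieces[OF cjp_conj(1)[OF jr w(1)]] w in \<open>auto simp: jstart_nth\<close>)
  have "H 0 (0, t) = H (length (jumps (([g], []) \<cdot> (w \<cdot> ?r)))) (1, t)" if "t \<in> {0..1}" for t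
  proof -
    have "H 0 (0, t) = g t" by (simp add: H_def hjoin_start)
    moreover have "length (jumps (([g], []) \<cdot> (w \<cdot> ?r))) = 0 + (?n + 0)" by (simp add: jumps_jconcat)
    moreover have "H (0 + (?n + 0)) (1, t) = g t"
      unfolding H_def hjoin_finish K_def by simp
    ultimately show ?thesis by simp
  qed
  then have "freely_spatially_homotopic \<phi> (([g], []) \<cdot> (w \<cdot> ?r)) (jconst (g 1) \<cdot> (w \<cdot> jconst (g 1)))"
    unfolding freely_spatially_homotopic_def using sH by blast
  then have "([g], []) \<cdot> (w \<cdot> ?r) \<frown> jconst (g 1) \<cdot> (w \<cdot> jconst (g 1))"
    using cjp_conj(3)[OF jr w(1)] cjp_conj(3)[OF jc w(1)] w by (intro feq_spatial) auto
  also have "\<dots> \<frown> w" using feq_conj_const[OF w(1)] w(2) by simp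
  finally show ?thesis .
qed

text \<open>Concatenation merges the inner constant pieces of the leaps into \<open>w\<close>. The
  conjugate is then literally \<open>w\<close>, padded by constants, between a jump and its inverse,
  so a cyclic contraction applies.\<close>

lemma feq_conj_leap:
  assumes l: "l \<in> letters S" and w: "cjp w" "jstart w = \<phi> [l] x"
  shows "leap l x \<cdot> (w \<cdot> leap (letter_inv l) (\<phi> [l] x)) \<frown> w"
proof -
  let ?c = "jconst (\<phi> [l] x)"
  have jc: "jinverse ?c ?c"
    using jinverse_single[of "\<lambda>_. \<phi> [l] x"] by (simp add: jconst_def path_def reversepath_def)
  have "leap l x \<cdot> (w \<cdot> leap (letter_inv l) (\<phi> [l] x)) =
      ([\<lambda>_. x] @ pieces (?c \<cdot> (w \<cdot> ?c)) @ [\<lambda>_. x], [l] @ jumps (?c \<cdot> (w \<cdot> ?c)) @ [letter_inv l])"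
  proof -
    obtain gs g ss where e: "w = (gs @ [g], ss)"
      using jpath_snocE[of w] w(1) unfolding closed_jumping_path_def by metis
    then show ?thesis using l by (cases gs) (simp_all add: jconcat_def jconst_def leap_def)
  qed
  then have "cyclic_contraction (leap l x \<cdot> (w \<cdot> leap (letter_inv l) (\<phi> [l] x))) (?c \<cdot> (w \<cdot> ?c))"
    unfolding cyclic_contraction_def by (auto simp: const_path_def)
  then have "leap l x \<cdot> (w \<cdot> leap (letter_inv l) (\<phi> [l] x)) \<frown> ?c \<cdot> (w \<cdot> ?c)"
    using cjp_conj(3)[OF jinverse_leap[OF l] w(1), of x] cjp_conj(3)[OF jc w(1)] w
    by (intro feq_cyclic) auto
  also have "\<dots> \<frown> w" using feq_conj_const[OF w(1)] w(2) by simp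
  finally show ?thesis .
qed

text \<open>Induction over the generators of \<open>a\<close>; a composite conjugates twice. The
  induction quantifies over all inverses \<open>b\<close>, and \<open>uniq\<close> allows the one at
  hand to be exchanged for an explicit one, as inverses agree up to homotopy.\<close>

lemma feq_conj:
  assumes "jinverse a b" "cjp w" "jfinish a = jstart w"
  shows "a \<cdot> (w \<cdot> b) \<frown> w"
proof -
  have uniq: "a \<cdot> (w \<cdot> b) \<asymp> a' \<cdot> (w \<cdot> b')"
    if "a \<asymp> a'" "jinverse a b" "jinverse a' b'" "cjp w" "jfinish a = jstart w" for a a' b b' w
  proof -
    have "jp a" using that(2) by (simp add: jinverse_def)
    then have "jinverse a' b" using that(1,2) jinverse_jeq by blast
    then have "b \<asymp> b'" using jinverse_unique that by blast
    then show ?thesis using that cjp_conj(1,2)[OF that(2,4,5)]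
      by (intro jconcat_cong) (auto simp: jinverse_def closed_jumping_path_def)
  qed
  have "jp a" using assms by (simp add: jinverse_def)
  then have "\<forall>b w. jinverse a b \<longrightarrow> cjp w \<longrightarrow> jfinish a = jstart w \<longrightarrow> a \<cdot> (w \<cdot> b) \<frown> w"
  proof (induction rule: jpath_step_induct)
    case (jeq p q)
    show ?case
    proof (intro allI impI)
      fix b w assume a: "jinverse q b" "cjp w" "jfinish q = jstart w"
      then have b: "jinverse p b" "jfinish p = jstart w"
        using jinverse_jeq[OF _ jeq_sym[OF jeq(2)]] jeqD[OF jeq(2,1)] by auto
      then have "p \<cdot> (w \<cdot> b) \<frown> w" using jeq a by blast
      moreover have "p \<cdot> (w \<cdot> b) \<frown> q \<cdot> (w \<cdot> b)"
        using uniq[OF jeq(2) b(1) a(1,2) b(2)] cjp_conj[OF b(1) a(2) b(2)] by (intro jeq_imp_feq)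
      ultimately show "q \<cdot> (w \<cdot> b) \<frown> w" using feq_sym feq_trans by blast
    qed
  next
    case (single g)
    let ?g = "([g], []) :: ('s, 'a) jpath"
    show ?case
    proof (intro allI impI)
      fix b w assume a: "jinverse ?g b" "cjp w" "jfinish ?g = jstart w"
      have "?g \<cdot> (w \<cdot> b) \<frown> ?g \<cdot> (w \<cdot> ([reversepath g], []))"
        using uniq[OF jeq_refl a(1) jinverse_single[OF single] a(2,3)] cjp_conj[OF a] by (intro jeq_imp_feq)
      also have "\<dots> \<frown> w" using feq_conj_single[OF single a(2)] a(3) by simp
      finally show "?g \<cdot> (w \<cdot> b) \<frown> w" .
    qed
  next
    case (leap l x)
    show ?case
    proof (intro allI impI)
      fix b w assume a: "jinverse (leap l x) b" "cjp w" "jfinish (leap l x) = jstart w"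
      have "leap l x \<cdot> (w \<cdot> b) \<frown> leap l x \<cdot> (w \<cdot> leap (letter_inv l) (\<phi> [l] x))"
        using uniq[OF jeq_refl a(1) jinverse_leap[OF leap] a(2,3)] cjp_conj[OF a] by (intro jeq_imp_feq)
      also have "\<dots> \<frown> w" using feq_conj_leap[OF leap a(2), of x] a(3) by simp
      finally show "leap l x \<cdot> (w \<cdot> b) \<frown> w" .
    qed
  next
    case (jconcat p q)
    obtain p' q' where i: "jinverse p p'" "jinverse q q'"
      using jinverse_exists[OF jconcat(1)] jinverse_exists[OF jconcat(2)] by metis
    show ?case
    proof (intro allI impI)
      fix b w assume a: "jinverse (p \<cdot> q) b" "cjp w" "jfinish (p \<cdot> q) = jstart w"
      have e: "jfinish q = jstart w" "jstart p' = jstart q" "jfinish q' = jstart q" "jstart q' = jstart w"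
        "jfinish w = jstart w" "jp p'" "jp q'" "jp w" "jp p" "jp q"
        using a i jconcat by (auto simp: jinverse_def closed_jumping_path_def)
      note c = cjp_conj[OF i(2) a(2) e(1)]
      have "(p \<cdot> q) \<cdot> (w \<cdot> b) \<asymp> (p \<cdot> q) \<cdot> (w \<cdot> (q' \<cdot> p'))"
        using uniq[OF jeq_refl a(1) jinverse_jconcat[OF i jconcat(3)] a(2,3)] .
      also have "\<dots> \<asymp> p \<cdot> (q \<cdot> (w \<cdot> (q' \<cdot> p')))"
        using e jconcat by (intro jconcat_assoc) simp_all
      also have "\<dots> \<asymp> p \<cdot> (q \<cdot> ((w \<cdot> q') \<cdot> p'))"
        using e jconcat by (intro jconcat_cong_right jeq_sym[OF jconcat_assoc]) simp_all
      also have "\<dots> \<asymp> p \<cdot> ((q \<cdot> (w \<cdot> q')) \<cdot> p')"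
        using e jconcat by (intro jconcat_cong_right jeq_sym[OF jconcat_assoc]) simp_all
      finally have "(p \<cdot> q) \<cdot> (w \<cdot> b) \<frown> p \<cdot> ((q \<cdot> (w \<cdot> q')) \<cdot> p')"
        using cjp_conj[OF a] by (intro jeq_imp_feq)
      also have "\<dots> \<frown> q \<cdot> (w \<cdot> q')"
        using jconcat(4)[rule_format, OF i(1) c(3)] c(4) jconcat(3) by simp
      also have "\<dots> \<frown> w" using jconcat(5) i(2) a(2) e(1) by blast
      finally show "(p \<cdot> q) \<cdot> (w \<cdot> b) \<frown> w" .
    qed
  qed
  then show ?thesis using assms by blast
qed

end

section \<open>Discretisations\<close>

locale warped_scale = warped_action S \<phi>
  for S :: "'s set" and \<phi> :: "'s letter list \<Rightarrow> 'a::metric_space \<Rightarrow> 'a" +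
  fixes \<theta> :: real
  assumes theta_ge_1: "1 \<le> \<theta>"
begin

abbreviation \<delta> :: "'a \<Rightarrow> 'a \<Rightarrow> real" where "\<delta> \<equiv> warped_dist S \<phi>"

sublocale theta_space \<delta> \<theta>
  using warped_dist_greatest(1)[of S \<phi>] theta_ge_1
  by (simp add: is_warping_metric_def theta_space_def theta_space_axioms_def)

notation theq (infix "\<simeq>" 50)

lemma warped_dist_le_dist: "\<delta> x y \<le> dist x y"
  using warped_dist_greatest(1)[of S \<phi>] by (simp add: is_warping_metric_def)

text \<open>For an inverse letter the defining bound is applied at the image point, from which the
  generator leads back to \<open>x\<close>.\<close>

lemma warped_dist_jump: "l \<in> letters S \<Longrightarrow> \<delta> x (\<phi> [l] x) \<le> 1"
proof (cases l)
  case (Gen s)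
  assume "l \<in> letters S"
  then show ?thesis
    using Gen warped_dist_greatest(1)[of S \<phi>] by (auto simp: is_warping_metric_def letters_def)
next
  case (GenInv s)
  assume l: "l \<in> letters S"
  then have "s \<in> S" using GenInv by (simp add: letters_def)
  then have "\<delta> (\<phi> [l] x) (\<phi> [Gen s] (\<phi> [l] x)) \<le> 1"
    using warped_dist_greatest(1)[of S \<phi>] by (auto simp: is_warping_metric_def)
  moreover have "\<phi> [Gen s] (\<phi> [l] x) = x" using act_inv[OF l, of x] GenInv by simp
  ultimately show ?thesis using commute[of x "\<phi> [l] x"] by simp
qed

lemma near_dist: "dist x y \<le> \<theta> \<Longrightarrow> near x y"
  using warped_dist_le_dist[of x y] by simp

lemma near_jump: "l \<in> letters S \<Longrightarrow> near x (\<phi> [l] x)"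
  using warped_dist_jump[of l x] theta_ge_1 by simp

text \<open>Lists of times replace the indexed sequence, so that refinements can be treated by
  induction on lists.\<close>

lemma path_discretisation_iff:
  "path_discretisation \<theta> g zs \<longleftrightarrow>
    (\<exists>ts. ts \<noteq> [] \<and> hd ts = 0 \<and> last ts = 1 \<and>
      successively (\<lambda>a b. a < b \<and> g ` {a..b} \<subseteq> cball (g a) \<theta>) ts \<and> zs = map g ts)"
proof
  assume "path_discretisation \<theta> g zs"
  then obtain m t where t: "t 0 = 0" "t m = (1::real)" "\<forall>i<m. t i < t (Suc i)"
    "\<forall>i<m. g ` {t i..t (Suc i)} \<subseteq> cball (g (t i)) \<theta>" "zs = map (\<lambda>i. g (t i)) [0..<Suc m]"
    unfolding path_discretisation_def by blast
  then show "\<exists>ts. ts \<noteq> [] \<and> hd ts = 0 \<and> last ts = 1 \<and>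
      successively (\<lambda>a b. a < b \<and> g ` {a..b} \<subseteq> cball (g a) \<theta>) ts \<and> zs = map g ts"
    by (intro exI[of _ "map t [0..<Suc m]"])
      (auto simp: hd_map last_map successively_conv_nth simp del: upt_Suc)
next
  assume "\<exists>ts. ts \<noteq> [] \<and> hd ts = 0 \<and> last ts = 1 \<and>
      successively (\<lambda>a b. a < b \<and> g ` {a..b} \<subseteq> cball (g a) \<theta>) ts \<and> zs = map g ts"
  then obtain ts where ts: "ts \<noteq> []" "hd ts = 0" "last ts = 1"
      "successively (\<lambda>a b. a < b \<and> g ` {a..b} \<subseteq> cball (g a) \<theta>) ts" "zs = map g ts" by blast
  define m where "m = length ts - 1"
  have len: "length ts = Suc m" using ts(1) by (simp add: m_def)
  have "zs = map (\<lambda>i. g (ts ! i)) [0..<Suc m]"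
    unfolding ts(5) using len by (intro nth_equalityI) (simp_all del: upt_Suc)
  then show "path_discretisation \<theta> g zs"
    unfolding path_discretisation_def using ts len
    by (intro exI[of _ m] exI[of _ "\<lambda>i. ts ! i"])
      (simp add: hd_conv_nth last_conv_nth successively_conv_nth del: upt_Suc)
qed

section \<open>Comparing the discretisations of one path through fine samples\<close>

lemma sorted_set_subset: "sorted ts \<Longrightarrow> ts \<noteq> [] \<Longrightarrow> set ts \<subseteq> {hd ts..last (ts :: real list)}"
  by (induction ts) force+

lemma successively_le_iff_sorted: "successively (\<le>) ts \<longleftrightarrow> sorted (ts :: real list)"
  by (simp add: successively_conv_sorted_wrt)

lemma path_discretisation_props:
  assumes "path_discretisation \<theta> g zs"
  shows "tpath zs" "hd zs = g 0" "last zs = g 1" "set zs \<subseteq> g ` {0..1}"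
proof -
  obtain ts where ts: "ts \<noteq> []" "hd ts = 0" "last ts = 1"
      "successively (\<lambda>a b. a < b \<and> g ` {a..b} \<subseteq> cball (g a) \<theta>) ts" "zs = map g ts"
    using assms unfolding path_discretisation_iff by blast
  have "successively (\<lambda>a b. near (g a) (g b)) ts"
    using ts(4)
  proof (rule successively_mono)
    fix x y :: real assume "x < y \<and> g ` {x..y} \<subseteq> cball (g x) \<theta>"
    then have "g y \<in> cball (g x) \<theta>" by (meson atLeastAtMost_iff image_subset_iff less_imp_le order_refl)
    then show "near (g x) (g y)" by (intro near_dist) simp
  qed
  then show "tpath zs" using ts by (simp add: tpath_iff successively_map)
  show "hd zs = g 0" "last zs = g 1" using ts by (simp_all add: hd_map last_map)
  have "sorted ts"
    using successively_mono[OF ts(4), of "(\<le>)"] by (simp add: successively_le_iff_sorted)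
  then show "set zs \<subseteq> g ` {0..1}" using sorted_set_subset[of ts] ts by auto
qed

text \<open>Unlike in a discretisation, repeated times are allowed, so that two lists of times can
  be merged by \<open>insort\<close> without leaving the notion.\<close>

definition finely :: "real \<Rightarrow> real list \<Rightarrow> bool" where
  "finely d ts \<longleftrightarrow> ts \<noteq> [] \<and> successively (\<lambda>a b. a \<le> b \<and> b - a < d) ts"

definition modulus :: "(real \<Rightarrow> 'a) \<Rightarrow> real \<Rightarrow> bool" where
  "modulus g d \<longleftrightarrow> 0 < d \<and> (\<forall>s\<in>{0..1}. \<forall>t\<in>{0..1}. \<bar>s - t\<bar> < d \<longrightarrow> dist (g s) (g t) \<le> \<theta>)"

lemma modulus_exists: "path g \<Longrightarrow> \<exists>d. modulus g d"
proof -
  assume "path g"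
  then have "uniformly_continuous_on {0..1} g"
    by (simp add: path_def compact_uniformly_continuous)
  then obtain d where "d > 0" "\<forall>s\<in>{0..1}. \<forall>t\<in>{0..1}. dist t s < d \<longrightarrow> dist (g t) (g s) < \<theta>"
    unfolding uniformly_continuous_on_def using theta_ge_1 by (metis less_le_trans zero_less_one)
  then show ?thesis unfolding modulus_def dist_real_def
    by (intro exI[of _ d]) (auto intro: less_imp_le)
qed

lemma fine_near:
  assumes "modulus g d" "finely d ts" "set ts \<subseteq> {0..1}"
  shows "tpath (map g ts)"
proof -
  have "successively (\<lambda>a b. near (g a) (g b)) ts"
    using assms(2)[unfolded finely_def, THEN conjunct2]
  proof (rule successively_mono)
    fix x y assume "x \<in> set ts" "y \<in> set ts" "x \<le> y \<and> y - x < d"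
    then show "near (g x) (g y)"
      using assms(1,3) unfolding modulus_def by (intro near_dist) (auto simp: subset_iff)
  qed
  then show ?thesis using assms(2) by (simp add: tpath_iff successively_map finely_def)
qed

text \<open>The new time falls between two neighbours less than \<open>d\<close> apart, so the three
  values are near one another and \<open>theq_drop_near\<close> applies; a time that coincides with
  the first one gives a repetition.\<close>

lemma fine_insort:
  assumes "modulus g d" "finely d ts" "set ts \<subseteq> {0..1}" "hd ts \<le> x" "x \<le> last ts"
  shows "finely d (insort x ts) \<and> hd (insort x ts) = hd ts \<and> map g ts \<simeq> map g (insort x ts)"
  using assms(2-)
proof (induction ts)
  case (Cons a ts)
  have ta: "tpath (map g (a # ts))" by (rule fine_near[OF assms(1) Cons.prems(1,2)])
  show ?case
  proof (cases ts)
    case Nil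
    then have "x = a" using Cons.prems by simp
    then show ?thesis using Nil assms(1) theq_stutter1[of "g a" "[]"]
      by (simp add: finely_def modulus_def tpath_iff)
  next
    case c: (Cons b us)
    have ab: "a \<le> b" "b - a < d" and f: "finely d ts"
      using Cons.prems(1) c by (auto simp: finely_def)
    have in01: "a \<in> {0..1}" "b \<in> {0..1}" using Cons.prems(2) c by auto
    have nr: "near (g s) (g t)" if "s \<in> {a..b}" "t \<in> {a..b}" for s t
      using assms(1) that ab in01 unfolding modulus_def by (intro near_dist) auto
    consider "x = a" | "a < x" "x \<le> b" | "b < x" using Cons.prems(3) by fastforce
    then show ?thesis
    proof cases
      case 1
      then show ?thesis
        using ta theq_stutter1[of "g a" "map g ts"] Cons.prems(1) assms(1) by (simp add: finely_def modulus_def)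
    next
      case 2
      have e: "insort x (a # ts) = a # x # b # us" using 2 c by simp
      have "tpath (map g (a # x # b # us))"
        using ta c nr[of a x] nr[of x b] 2 ab by (simp add: tpath_iff)
      then have "map g (a # ts) \<simeq> map g (insort x (a # ts))"
        using theq_drop_near[of "g a" "g x" "g b" "map g us"] nr[of a b] ab c unfolding e
        by (auto intro: sym)
      then show ?thesis
        unfolding e using Cons.prems(1) 2 ab f c by (simp add: finely_def)
    next
      case 3
      have ih: "finely d (insort x ts) \<and> hd (insort x ts) = hd ts \<and> map g ts \<simeq> map g (insort x ts)"
        by (rule Cons.IH) (use f Cons.prems c 3 in auto)
      have e: "insort x (a # ts) = a # insort x ts" using 3 ab by simp
      have ne: "insort x ts \<noteq> []" using ih by (simp add: finely_def)
      have "map g (a # ts) \<simeq> map g (insort x (a # ts))"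
        unfolding e using ih nr[of a b] ab c theq_Cons[of "map g ts" _ "g a"] by simp
      then show ?thesis
        unfolding e using ih ab c ne by (cases "insort x ts") (auto simp: finely_def)
    qed
  qed
qed (simp add: finely_def)

lemma last_insort: "sorted ts \<Longrightarrow> ts \<noteq> [] \<Longrightarrow> x \<le> last ts \<Longrightarrow> last (insort x ts) = last (ts :: real list)"
proof (induction ts)
  case (Cons a ts)
  then show ?case by (cases ts) auto
qed simp

lemma fine_sorted: "finely d ts \<Longrightarrow> sorted ts"
  unfolding finely_def successively_le_iff_sorted[symmetric] by (auto elim: successively_mono)

lemma fine_foldr_insort:
  assumes "modulus g d" "finely d ts" "hd ts = 0" "last ts = 1" "set us \<subseteq> {0..1}" "set ts \<subseteq> {0..1}"
  shows "map g ts \<simeq> map g (foldr insort us ts)"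
proof -
  have "finely d (foldr insort us ts) \<and> hd (foldr insort us ts) = 0 \<and> last (foldr insort us ts) = 1 \<and>
      set (foldr insort us ts) \<subseteq> {0..1} \<and> map g ts \<simeq> map g (foldr insort us ts)"
    using assms(5)
  proof (induction us)
    case Nil
    then show ?case using assms fine_near by (auto intro: refl)
  next
    case (Cons x us)
    let ?ts = "foldr insort us ts"
    have ih: "finely d ?ts" "hd ?ts = 0" "last ?ts = 1" "set ?ts \<subseteq> {0..1}" "map g ts \<simeq> map g ?ts"
      using Cons by auto
    have x: "0 \<le> x" "x \<le> 1" using Cons.prems by auto
    have ne: "?ts \<noteq> []" using ih(1) by (simp add: finely_def)
    have "finely d (insort x ?ts) \<and> hd (insort x ?ts) = hd ?ts \<and> map g ?ts \<simeq> map g (insort x ?ts)"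
      by (rule fine_insort[OF assms(1) ih(1,4)]) (use ih x in auto)
    moreover have "last (insort x ?ts) = 1"
      using last_insort[OF fine_sorted[OF ih(1)] ne] ih x by simp
    ultimately show ?case using ih x trans by (auto simp: set_insort_key)
  qed
  then show ?thesis by simp
qed

text \<open>Inserting either list of times into the other produces the same sorted list, a common
  refinement.\<close>

lemma fine_unique:
  assumes "modulus g d" "finely d ts" "hd ts = 0" "last ts = 1" "set ts \<subseteq> {0..1}"
    and "finely d us" "hd us = 0" "last us = 1" "set us \<subseteq> {0..1}"
  shows "map g ts \<simeq> map g us"
proof -
  have *: "foldr insort vs ws = sort (vs @ ws)" if "sorted ws" for vs ws :: "real list"
    using that by (simp add: sort_key_def[of "\<lambda>x. x" "vs @ ws"] sort_key_def[symmetric] sorted_sort_id)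
  have "sort (us @ ts) = sort (ts @ us)"
    by (rule properties_for_sort) auto
  then have "foldr insort us ts = foldr insort ts us"
    using * fine_sorted assms(2,6) by simp
  then show ?thesis
    using fine_foldr_insort[OF assms(1-4,9,5)] fine_foldr_insort[OF assms(1,6-8,5,9)] sym trans by metis
qed

lemma fine_segment:
  assumes "0 < d" "a \<le> b"
  shows "\<exists>vs. finely d vs \<and> hd vs = a \<and> last vs = b \<and> set vs \<subseteq> {a..b}"
proof -
  obtain N where N: "(b - a) / d < real N" using reals_Archimedean2 by blast
  have Npos: "0 < N" using N assms by (cases N) (auto simp: divide_less_0_iff)
  define vs where "vs = map (\<lambda>k. a + (b - a) * (real k / real N)) [0..<Suc N]"
  have gap: "(b - a) / real N < d" using N assms Npos by (simp add: field_simps)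
  have step: "a + (b - a) * (real (Suc k) / N) - (a + (b - a) * (real k / N)) = (b - a) / N" for k
    using Npos by (simp add: field_simps)
  have "finely d vs"
    unfolding finely_def successively_conv_nth vs_def
  proof (intro conjI allI impI)
    fix k assume k: "Suc k < length (map (\<lambda>k. a + (b - a) * (real k / real N)) [0..<Suc N])"
    then show "map (\<lambda>k. a + (b - a) * (real k / real N)) [0..<Suc N] ! k
        \<le> map (\<lambda>k. a + (b - a) * (real k / real N)) [0..<Suc N] ! Suc k"
      using assms by (simp del: upt_Suc add: divide_right_mono mult_left_mono)
    show "map (\<lambda>k. a + (b - a) * (real k / real N)) [0..<Suc N] ! Suc k -
        map (\<lambda>k. a + (b - a) * (real k / real N)) [0..<Suc N] ! k < d"
      using k step[of k] gap by (simp del: upt_Suc of_nat_Suc)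
  qed simp
  moreover have "hd vs = a" "last vs = b"
    using Npos by (simp_all add: vs_def hd_map last_map del: upt_Suc)
  moreover have "set vs \<subseteq> {a..b}"
  proof
    fix v assume "v \<in> set vs"
    then obtain k where k: "k \<le> N" "v = a + (b - a) * (real k / N)" by (auto simp: vs_def less_Suc_eq_le simp del: upt_Suc)
    have "(b - a) * (real k / N) \<le> (b - a) * 1" "0 \<le> (b - a) * (real k / N)"
      using k assms Npos by (intro mult_left_mono, auto)
    then show "v \<in> {a..b}" using k(2) by simp
  qed
  ultimately show ?thesis by blast
qed

text \<open>A single step of a discretisation may take a long time, during which the values are only
  known to stay in the ball about its first point. Fine times inserted into the step are therefore
  collapsed by \<open>theq_star\<close>, centred at that point.\<close>

lemma refine_discretisation:
  assumes "modulus g d" "ts \<noteq> []" "set ts \<subseteq> {0..1}"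
    and "successively (\<lambda>a b. a < b \<and> g ` {a..b} \<subseteq> cball (g a) \<theta>) ts"
  shows "\<exists>us. finely d us \<and> hd us = hd ts \<and> last us = last ts \<and> set us \<subseteq> {0..1} \<and> map g ts \<simeq> map g us"
  using assms(2-)
proof (induction ts)
  case (Cons a ts)
  have d: "0 < d" using assms(1) by (simp add: modulus_def)
  show ?case
  proof (cases ts)
    case Nil
    then show ?thesis
      using Cons.prems by (intro exI[of _ "[a]"]) (auto simp: finely_def tpath_iff intro!: refl)
  next
    case c: (Cons b bs)
    have ab: "a < b" "g ` {a..b} \<subseteq> cball (g a) \<theta>" "a \<in> {0..1}" "b \<in> {0..1}"
      using Cons.prems c by auto
    obtain us where us: "finely d us" "hd us = b" "last us = last ts" "set us \<subseteq> {0..1}" "map g ts \<simeq> map g us"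
      using Cons.IH Cons.prems c by auto
    obtain vs where vs: "finely d vs" "hd vs = a" "last vs = b" "set vs \<subseteq> {a..b}"
      using fine_segment[OF d, of a b] ab by auto
    obtain v vs' where v: "vs = a # vs'" using vs by (cases vs) (auto simp: finely_def)
    have vs01: "set vs \<subseteq> {0..1}" using vs(4) ab by force
    have tv: "tpath (map g vs)" by (rule fine_near[OF assms(1) vs(1) vs01])
    have ne: "vs' \<noteq> []" using v vs(3) ab by auto
    have "map g vs \<simeq> [g a, last (map g vs')]"
      unfolding v list.map by (rule theq_star)
        (use tv v ne vs(4) ab(2) in \<open>auto intro!: near_dist simp: subset_iff image_subset_iff\<close>)
    then have "map g vs \<simeq> [g a, g b]" using v vs(3) ne by (simp add: last_map)
    \<comment> \<open>The time \<open>b\<close> ends \<open>vs\<close> and begins \<open>us\<close>,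
      and correspondingly \<open>g b\<close> occurs twice on the left, where the repetition is
      removed below.\<close>
    then have "[g a, g b] @ map g ts \<simeq> map g vs @ map g us"
      using us c by (intro theq_append) (auto intro: sym)
    then have "[g a] @ (g b # g b # map g bs) \<simeq> map g (vs @ us)" using c by simp
    moreover have "g a # (g b # map g bs) \<simeq> g a # (g b # g b # map g bs)"
      using theq_Cons[OF theq_stutter1[of "g b" "map g bs"], of "g a"] theqD(1)[OF us(5)] near_dist[of "g a" "g b"] ab c
      by (auto simp: image_subset_iff)
    ultimately have "map g (a # ts) \<simeq> map g (vs @ us)" using c trans by simp
    moreover have "finely d (vs @ us)"
      using vs us d by (simp add: finely_def successively_append_iff)
    ultimately show ?thesis
      using v us vs vs01 c by (intro exI[of _ "vs @ us"]) (auto simp: finely_def)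
  qed
qed simp

lemma path_discretisation_unique:
  assumes "path g" "path_discretisation \<theta> g zs" "path_discretisation \<theta> g ws"
  shows "zs \<simeq> ws"
proof -
  obtain d where d: "modulus g d" using modulus_exists[OF assms(1)] by blast
  have *: "\<exists>us. finely d us \<and> hd us = 0 \<and> last us = 1 \<and> set us \<subseteq> {0..1} \<and> zs \<simeq> map g us"
    if zs: "path_discretisation \<theta> g zs" for zs
  proof -
    obtain ts where ts: "ts \<noteq> []" "hd ts = 0" "last ts = 1"
      "successively (\<lambda>a b. a < b \<and> g ` {a..b} \<subseteq> cball (g a) \<theta>) ts" "zs = map g ts"
      using zs unfolding path_discretisation_iff by blast
    have s: "sorted ts"
      using successively_mono[OF ts(4), of "(\<le>)"] by (simp add: successively_le_iff_sorted)
    have "set ts \<subseteq> {0..1}"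
      using sorted_set_subset[OF s ts(1)] ts(2,3) by simp
    from refine_discretisation[OF d ts(1) this ts(4)] show ?thesis using ts by simp
  qed
  show ?thesis using *[OF assms(2)] *[OF assms(3)] fine_unique[OF d] sym trans by meson
qed

lemma uniform_discretisation:
  assumes N: "0 < N" and h: "\<And>s t. s \<in> {0..1} \<Longrightarrow> t \<in> {0..1} \<Longrightarrow> \<bar>s - t\<bar> \<le> 1 / real N \<Longrightarrow> dist (g s) (g t) \<le> \<theta>"
  shows "path_discretisation \<theta> g (map (\<lambda>k. g (real k / real N)) [0..<Suc N])"
  unfolding path_discretisation_def
proof (intro exI conjI allI impI)
  fix i assume i: "i < N"
  show "real i / N < real (Suc i) / N" using N by (simp add: divide_strict_right_mono)
  have b: "real (Suc i) / N \<le> 1" "0 \<le> real i / N" using i N by (simp_all add: field_simps)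
  show "g ` {real i / N..real (Suc i) / N} \<subseteq> cball (g (real i / N)) \<theta>"
  proof clarify
    fix s assume s: "s \<in> {real i / N..real (Suc i) / N}"
    then have "\<bar>real i / N - s\<bar> \<le> 1 / N" by (auto simp: add_divide_distrib)
    moreover have "0 \<le> s" using s b(2) by (meson atLeastAtMost_iff order_trans)
    moreover have "s \<le> 1" using s b(1) by (meson atLeastAtMost_iff order_trans)
    moreover have "real i / N \<in> {0..1}" using s calculation by auto
    ultimately show "g s \<in> cball (g (real i / N)) \<theta>" using h by simp
  qed
qed (use N in auto)



section \<open>Discretisations of jumping-paths and of concatenations\<close>

abbreviation jdisc :: "('s, 'a) jpath \<Rightarrow> 'a list \<Rightarrow> bool" where
  "jdisc \<equiv> jpath_discretisation \<theta>"

lemma jdisc_single: "jdisc ([g], ls) zs \<longleftrightarrow> path_discretisation \<theta> g zs"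
  by (auto simp: jpath_discretisation_def list_all2_Cons1)

lemma jdisc_Cons: "jdisc (g # gs, l # ls) zs \<longleftrightarrow>
    (\<exists>us vs. zs = us @ vs \<and> path_discretisation \<theta> g us \<and> jdisc (gs, ls) vs)"
proof
  assume "jdisc (g # gs, l # ls) zs"
  then obtain us zss where "path_discretisation \<theta> g us" "list_all2 (path_discretisation \<theta>) gs zss"
    "zs = concat (us # zss)"
    by (auto simp: jpath_discretisation_def list_all2_Cons1)
  then show "\<exists>us vs. zs = us @ vs \<and> path_discretisation \<theta> g us \<and> jdisc (gs, ls) vs"
    by (intro exI[of _ us] exI[of _ "concat zss"]) (auto simp: jpath_discretisation_def)
next
  assume "\<exists>us vs. zs = us @ vs \<and> path_discretisation \<theta> g us \<and> jdisc (gs, ls) vs"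
  then obtain us zss where "zs = us @ concat zss" "path_discretisation \<theta> g us"
    "list_all2 (path_discretisation \<theta>) gs zss"
    by (auto simp: jpath_discretisation_def)
  then show "jdisc (g # gs, l # ls) zs"
    unfolding jpath_discretisation_def by (intro exI[of _ "us # zss"]) simp
qed

lemma jdisc_props:
  assumes "jp p" "jdisc p zs"
  shows "tpath zs" "hd zs = jstart p" "last zs = jfinish p"
proof -
  have "tpath zs \<and> hd zs = jstart p \<and> last zs = jfinish p"
    using assms
  proof (induction arbitrary: zs rule: jumping_path_induct)
    case (single g)
    then show ?case using path_discretisation_props[of g zs] by (simp add: jdisc_single)
  next
    case (Cons g l p)
    obtain us vs where zs: "zs = us @ vs" "path_discretisation \<theta> g us" "jdisc p vs"
      using Cons.prems by (auto simp: jdisc_Cons)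
    have vs: "tpath vs" "hd vs = jstart p" "last vs = jfinish p" using Cons.IH[OF zs(3)] by auto
    have us: "tpath us" "hd us = g 0" "last us = g 1" using path_discretisation_props[OF zs(2)] by auto
    have "near (last us) (hd vs)" using us vs Cons.hyps near_jump by simp
    moreover have "jfinish (g # pieces p, l # jumps p) = jfinish p"
      using jumping_path_nonempty[OF Cons(3)] by (simp add: jfinish_def)
    ultimately show ?case
      using us vs zs(1) by (simp add: tpath_iff successively_append_iff)
  qed
  then show "tpath zs" "hd zs = jstart p" "last zs = jfinish p" by auto
qed

lemma jdisc_unique:
  assumes "jp p" "jdisc p zs" "jdisc p ws"
  shows "zs \<simeq> ws"
  using assms
proof (induction arbitrary: zs ws rule: jumping_path_induct)
  case (single g)
  then show ?case using path_discretisation_unique by (simp add: jdisc_single)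
next
  case (Cons g l p)
  obtain us vs where zs: "zs = us @ vs" "path_discretisation \<theta> g us" "jdisc p vs"
    using Cons.prems(1) by (auto simp: jdisc_Cons)
  obtain us' vs' where ws: "ws = us' @ vs'" "path_discretisation \<theta> g us'" "jdisc p vs'"
    using Cons.prems(2) by (auto simp: jdisc_Cons)
  show ?case
    unfolding zs(1) ws(1)
    using path_discretisation_unique[OF Cons(1) zs(2) ws(2)] Cons.IH[OF zs(3) ws(3)]
      path_discretisation_props(3)[OF zs(2)] jdisc_props(2)[OF Cons(3) zs(3)] Cons.hyps near_jump
    by (intro theq_append) simp_all
qed

lemma path_discretisation_exists:
  fixes g :: "real \<Rightarrow> 'a"
  assumes "path g"
  shows "\<exists>zs. path_discretisation \<theta> g zs"
proof -
  obtain d where d: "modulus g d" using modulus_exists[OF assms] by blast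
  then have "0 < d" by (simp add: modulus_def)
  then obtain N where N: "0 < N" "1 / real N < d"
    using ex_inverse_of_nat_less[of d] by (auto simp: inverse_eq_divide)
  show ?thesis
    using uniform_discretisation[OF N(1), of g] d N unfolding modulus_def by force
qed

lemma jdisc_exists: "jp p \<Longrightarrow> \<exists>zs. jdisc p zs"
proof (induction rule: jumping_path_induct)
  case (single g)
  then show ?case using path_discretisation_exists by (simp add: jdisc_single)
next
  case (Cons g l p)
  then show ?case using path_discretisation_exists[of g] by (auto simp: jdisc_Cons) 
qed

lemma path_discretisation_join:
  assumes g: "path_discretisation \<theta> g zs" and h: "path_discretisation \<theta> h ws" and gh: "g 1 = h 0"
  shows "path_discretisation \<theta> (g +++ h) (zs @ tl ws)"
proof -
  let ?P = "\<lambda>g a b. a < b \<and> g ` {a..b} \<subseteq> cball (g a) \<theta>"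
  obtain ts where ts: "ts \<noteq> []" "hd ts = 0" "last ts = 1" "successively (?P g) ts" "zs = map g ts"
    using g unfolding path_discretisation_iff by blast
  obtain us where us: "us \<noteq> []" "hd us = 0" "last us = 1" "successively (?P h) us" "ws = map h us"
    using h unfolding path_discretisation_iff by blast
  have sts: "sorted ts" "sorted us"
    using successively_mono[OF ts(4), of "(\<le>)"] successively_mono[OF us(4), of "(\<le>)"]
    by (simp_all add: successively_le_iff_sorted)
  have ts01: "set ts \<subseteq> {0..1}" using sorted_set_subset[OF sts(1) ts(1)] ts by simp
  have us01: "set us \<subseteq> {0..1}" using sorted_set_subset[OF sts(2) us(1)] us by simp
  have e1: "(g +++ h) (t / 2) = g t" if "t \<le> 1" for t
    using that by (simp add: joinpaths_def)
  \<comment> \<open>At the midpoint the join takes its value from \<open>g\<close>, so the case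
    \<open>t = 0\<close> uses \<open>gh\<close>.\<close>
  have e2: "(g +++ h) ((t + 1) / 2) = h t" if "0 \<le> t" for t
    using that gh by (cases "t = 0") (simp_all add: joinpaths_def field_simps)
  \<comment> \<open>Both rescaled lists contain the midpoint; \<open>tl\<close> drops the second
    copy, in accordance with \<open>tl ws\<close>.\<close>
  let ?vs = "map (\<lambda>t. t / 2) ts @ tl (map (\<lambda>t. (t + 1) / 2) us)"
  have "successively (?P (g +++ h)) (map (\<lambda>t. t / 2) ts)"
    unfolding successively_map using ts(4)
  proof (rule successively_mono)
    fix a b assume ab: "a \<in> set ts" "b \<in> set ts" "?P g a b"
    have "(g +++ h) u \<in> cball (g a) \<theta>" if "u \<in> {a / 2..b / 2}" for u
    proof -
      have "2 * u \<in> {a..b}" using that by auto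
      moreover have "(g +++ h) u = g (2 * u)" using e1[of "2 * u"] that ab(2) ts01 by auto
      ultimately show ?thesis using ab(3) by (metis image_subset_iff)
    qed
    then show "?P (g +++ h) (a / 2) (b / 2)"
      using ab e1[of a] ts01 by (auto simp: image_subset_iff subset_iff)
  qed
  moreover have 2: "successively (?P (g +++ h)) (map (\<lambda>t. (t + 1) / 2) us)"
    unfolding successively_map using us(4)
  proof (rule successively_mono)
    fix a b assume ab: "a \<in> set us" "b \<in> set us" "?P h a b"
    have "(g +++ h) u \<in> cball (h a) \<theta>" if "u \<in> {(a + 1) / 2..(b + 1) / 2}" for u
    proof -
      have "2 * u - 1 \<in> {a..b}" using that by (auto simp: field_simps)
      moreover have "0 \<le> 2 * u - 1" using calculation ab(1) us01 by auto
      then have "(g +++ h) u = h (2 * u - 1)" using e2[of "2 * u - 1"] by simp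
      ultimately show ?thesis using ab(3) by (metis image_subset_iff)
    qed
    then show "?P (g +++ h) ((a + 1) / 2) ((b + 1) / 2)"
      using ab e2[of a] us01 by (auto simp: image_subset_iff subset_iff)
  qed
  ultimately have "successively (?P (g +++ h)) ?vs"
  proof -
    obtain us' where e: "us = 0 # us'" using us by (cases us) auto
    have "last (map (\<lambda>t. t / 2) ts) = hd (map (\<lambda>t. (t + 1) / 2) us)"
      using ts(1,3) us(1,2) by (simp add: last_map hd_map)
    with 2 show ?thesis
      using \<open>successively (?P (g +++ h)) (map (\<lambda>t. t / 2) ts)\<close> ts(1,3)
      unfolding e by (cases "us' = []") (auto simp: successively_append_iff successively_Cons last_map)
  qed
  moreover have "hd ?vs = 0" using ts by (simp add: hd_map)
  moreover have "last ?vs = 1"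
    using ts(1,3) us(1-3) by (cases us; cases "tl us = []") (auto simp: last_map last_append)
  moreover have "zs @ tl ws = map (g +++ h) ?vs"
  proof -
    have "map (g +++ h) (map (\<lambda>t. t / 2) ts) = zs"
      using e1 ts01 by (auto simp: ts(5) subset_iff)
    moreover have "map (g +++ h) (map (\<lambda>t. (t + 1) / 2) us) = ws"
      using e2 us01 by (auto simp: us(5) subset_iff)
    ultimately show ?thesis by (simp only: map_append map_tl)
  qed
  ultimately show ?thesis
    unfolding path_discretisation_iff using ts(1) by (intro exI[of _ ?vs]) simp
qed

lemma jdisc_jconcat:
  assumes "jp p" "jp q" "jfinish p = jstart q" "jdisc p zs" "jdisc q ws"
  shows "jdisc (p \<cdot> q) (zs @ tl ws)"
  using assms
proof (induction arbitrary: zs rule: jumping_path_induct)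
  case (single g)
  from single(2) show ?case
  proof (cases rule: jumping_path_cases)
    case (single h)
    then show ?thesis
      using path_discretisation_join[of g zs h ws] \<open>jfinish ([g], []) = jstart q\<close>
        \<open>jdisc ([g], []) zs\<close> \<open>jdisc q ws\<close> by (simp add: jconcat_single jdisc_single)
  next
    case (Cons h l q')
    then obtain us vs where ws: "ws = us @ vs" "path_discretisation \<theta> h us" "jdisc q' vs"
      using \<open>jdisc q ws\<close> by (auto simp: jdisc_Cons)
    have "us \<noteq> []" using path_discretisation_props(1)[OF ws(2)] by (simp add: tpath_iff)
    have "path_discretisation \<theta> (g +++ h) (zs @ tl us)"
      using path_discretisation_join[of g zs h us] \<open>jfinish ([g], []) = jstart q\<close>
        \<open>jdisc ([g], []) zs\<close> Cons(1) ws(2) by (simp add: jdisc_single)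
    moreover have "zs @ tl ws = (zs @ tl us) @ vs" using ws(1) \<open>us \<noteq> []\<close> by simp
    ultimately show ?thesis
      using Cons(1) ws(3) unfolding jconcat_single by (simp only: fst_conv snd_conv list.sel jdisc_Cons prod.collapse) blast
  qed
next
  case (Cons g l p)
  have ne: "pieces p \<noteq> []" by (rule jumping_path_nonempty[OF Cons(3)])
  obtain us vs where zs: "zs = us @ vs" "path_discretisation \<theta> g us" "jdisc p vs"
    using Cons.prems by (auto simp: jdisc_Cons)
  have "jfinish p = jstart q" using Cons.prems(2) ne by (simp add: jfinish_def)
  from Cons.IH[OF Cons.prems(1) this zs(3) Cons.prems(4)]
  have "jdisc (p \<cdot> q) (vs @ tl ws)" .
  then show ?case
    using zs ne by (auto simp: jconcat_Cons jdisc_Cons)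
qed

section \<open>Invariance of discretisations under homotopy and free homotopy\<close>

lemma const_path_discretisation:
  assumes "path_discretisation \<theta> c zs" "const_path c"
  shows "zs \<simeq> [c 0]"
proof (rule theq_singleton)
  have "c ` {0..1} \<subseteq> {c 0}" using assms(2) unfolding const_path_def by blast
  then show "set zs \<subseteq> {c 0}" using path_discretisation_props(4)[OF assms(1)] by (rule order_trans[rotated])
  show "zs \<noteq> []" using path_discretisation_props(1)[OF assms(1)] by (simp add: tpath_iff)
qed

text \<open>Up to homotopy the constant piece contributes the single vertex \<open>c 0\<close>, one
  jump away from the point where \<open>g\<close> and \<open>h\<close> meet. It is a backtracking,
  and its removal leaves a discretisation of \<open>g +++ h\<close>.\<close>

lemma jdisc_contraction:
  assumes "contraction p q" "jp p" "jp q" "jdisc p zs" "jdisc q ws"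
  shows "zs \<simeq> ws"
proof -
  obtain gs g c h hs ss l ts where *: "length gs = length ss" "const_path c"
    "p = (gs @ [g, c, h] @ hs, ss @ [l, letter_inv l] @ ts)" "q = (gs @ [g +++ h] @ hs, ss @ ts)"
    using assms(1) unfolding contraction_def by blast
  obtain zss where zss: "list_all2 (path_discretisation \<theta>) (gs @ [g, c, h] @ hs) zss" "zs = concat zss"
    using assms(4) * by (auto simp: jpath_discretisation_def)
  then obtain as bs us cs vs where z: "zss = as @ [us, cs, vs] @ bs"
    "list_all2 (path_discretisation \<theta>) gs as" "path_discretisation \<theta> g us"
    "path_discretisation \<theta> c cs" "path_discretisation \<theta> h vs"
    "list_all2 (path_discretisation \<theta>) hs bs"
    by (auto simp: list_all2_append1 list_all2_Cons1)
  have l: "l \<in> letters S" using assms(2) * by (auto simp: jumping_path_def)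
  have i: "(pieces p ! Suc i) 0 = \<phi> [jumps p ! i] ((pieces p ! i) 1)" if "i < length (jumps p)" for i
    using assms(2) that by (auto simp: jumping_path_def)
  have gc: "c 0 = \<phi> [l] (g 1)" "h 0 = \<phi> [letter_inv l] (c 1)"
    using i[of "length gs"] i[of "Suc (length gs)"] *(1,3) by (auto simp: nth_append)
  have gh: "g 1 = h 0"
    using gc const_path_ends[OF *(2)] l by simp
  have cs: "cs \<simeq> [c 0]" by (rule const_path_discretisation[OF z(4) *(2)])
  then have "cs \<noteq> []" using theqD(1) by (simp add: tpath_iff)
  have tp: "tpath (concat as @ us @ cs @ vs @ concat bs)"
    using jdisc_props(1)[OF assms(2,4)] zss(2) z(1) by simp
  have n: "near (g 1) (c 0)" using gc(1) l near_jump by simp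
  obtain vs' where vs: "vs = g 1 # vs'"
    using path_discretisation_props(1,2)[OF z(5)] gh by (cases vs) (auto simp: tpath_iff)
  have u: "tpath us" "last us = g 1" using path_discretisation_props[OF z(3)] by auto
  then obtain us' where us: "us = us' @ [g 1]"
    by (metis append_butlast_last_id tpath_iff)
  have "us @ cs @ vs \<simeq> us' @ [g 1, c 0, g 1] @ vs'"
  proof -
    have "us @ cs \<simeq> us @ [c 0]"
      using u n path_discretisation_props(2)[OF z(4)] by (intro theq_append cs refl) simp_all
    moreover have "last (us @ cs) = c 0"
      using path_discretisation_props(3)[OF z(4)] const_path_ends[OF *(2)] \<open>cs \<noteq> []\<close> by simp
    ultimately have "(us @ cs) @ vs \<simeq> (us @ [c 0]) @ vs"
      using n vs near_sym[of "c 0" "g 1"] path_discretisation_props(1)[OF z(5)]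
      by (intro theq_append[OF _ refl]) simp_all
    then show ?thesis using us vs by simp
  qed
  also have "\<dots> \<simeq> us' @ [g 1] @ vs'"
  proof -
    have "us' @ ([g 1, c 0, g 1] @ vs') @ [] \<simeq> us' @ (g 1 # vs') @ []"
    proof (rule theq_context)
      show "[g 1, c 0, g 1] @ vs' \<simeq> g 1 # vs'"
        using theq_backtrack[OF n, of vs'] path_discretisation_props(1)[OF z(5)] vs by simp
    qed (use theqD(2)[OF calculation] in simp)
    then show ?thesis by simp
  qed
  finally have "us @ cs @ vs \<simeq> us @ tl vs" using us vs by simp
  then have "concat as @ (us @ cs @ vs) @ concat bs \<simeq> concat as @ (us @ tl vs) @ concat bs"
    using tp by (intro theq_context) simp_all
  then have "zs \<simeq> concat as @ (us @ tl vs) @ concat bs" using z zss by simp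
  moreover have "jdisc q (concat as @ (us @ tl vs) @ concat bs)"
    unfolding jpath_discretisation_def *
    using path_discretisation_join[OF z(3,5) gh] z
    by (intro exI[of _ "as @ [us @ tl vs] @ bs"]) (auto intro!: list_all2_appendI)
  ultimately show ?thesis using jdisc_unique[OF assms(3) _ assms(5)] trans by blast
qed

text \<open>\<open>R t\<close> samples every piece of the time slice at \<open>N + 1\<close>
  equidistant parameters. Uniform continuity on the finitely many squares gives one \<open>N\<close>
  that controls both the steps along the pieces and those in time.\<close>

lemma spatial_homotopy_rows:
  assumes H: "spatial_homotopy \<phi> H p q" and "jp p" "jp q"
  obtains N R where "0 < (N :: nat)" "jdisc p (R 0)" "jdisc q (R 1)"
    "\<And>t. t \<in> {0..1::real} \<Longrightarrow> tpath (R t) \<and> hd (R t) = H 0 (0, t) \<and> last (R t) = H (length (jumps p)) (1, t)"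
    "\<And>t t'. t \<in> {0..1} \<Longrightarrow> t' \<in> {0..1} \<Longrightarrow> \<bar>t - t'\<bar> \<le> 1 / real N \<Longrightarrow> list_all2 near (R t) (R t')"
proof -
  let ?n = "length (jumps p)"
  have len: "length (pieces p) = Suc ?n" "length (pieces q) = Suc ?n" "jumps q = jumps p"
    using H jumping_path_pieces[OF assms(2)] by (auto simp: spatial_homotopy_def)
  have cont: "continuous_on ({0..1} \<times> {0..1}) (H i)" if "i \<le> ?n" for i
    using H that len by (auto simp: spatial_homotopy_def)
  have "\<exists>M. 0 < (M::nat) \<and> (\<forall>z\<in>{0..1} \<times> {0..1}. \<forall>z'\<in>{0..1} \<times> {0..1}. dist z z' \<le> 1 / M \<longrightarrow> dist (H i z) (H i z') \<le> \<theta>)"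
    if "i \<le> ?n" for i
  proof -
    have "uniformly_continuous_on ({0..1} \<times> {0..1}) (H i)"
      using cont[OF that] by (intro compact_uniformly_continuous) (auto intro: compact_Times)
    then obtain d where d: "d > 0" "\<forall>z\<in>{0..1} \<times> {0..1}. \<forall>z'\<in>{0..1} \<times> {0..1}. dist z' z < d \<longrightarrow> dist (H i z') (H i z) < \<theta>"
      using theta_ge_1 spec[of _ \<theta>] unfolding uniformly_continuous_on_def by (auto dest: spec[of _ \<theta>])
    obtain M where M: "0 < M" "1 / real M < d"
      using ex_inverse_of_nat_less[OF d(1)] by (auto simp: inverse_eq_divide)
    have "dist (H i z) (H i z') \<le> \<theta>"
      if "z \<in> {0..1} \<times> {0..1}" "z' \<in> {0..1} \<times> {0..1}" "dist z z' \<le> 1 / M" for z z'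
      using d(2)[rule_format, OF that(2,1)] that(3) M(2) by simp
    then show ?thesis using M(1) by (intro exI[of _ M]) simp
  qed
  then obtain M where M: "\<And>i. i \<le> ?n \<Longrightarrow> 0 < (M i :: nat)"
    "\<And>i z z'. i \<le> ?n \<Longrightarrow> z \<in> {0..1} \<times> {0..1} \<Longrightarrow> z' \<in> {0..1} \<times> {0..1} \<Longrightarrow> dist z z' \<le> 1 / M i \<Longrightarrow> dist (H i z) (H i z') \<le> \<theta>"
    by metis
  define N where "N = Max (M ` {..?n})"
  have MN: "M i \<le> N" if "i \<le> ?n" for i using that by (simp add: N_def)
  have N: "0 < N" using M(1)[of 0] MN[of 0] by simp
  have close: "dist (H i z) (H i z') \<le> \<theta>"
    if "i \<le> ?n" "z \<in> {0..1} \<times> {0..1}" "z' \<in> {0..1} \<times> {0..1}" "dist z z' \<le> 1 / N" for i z z'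
  proof (rule M(2)[OF that(1-3)])
    have "1 / real N \<le> 1 / real (M i)"
      using M(1)[OF that(1)] MN[OF that(1)] by (intro divide_left_mono) auto
    then show "dist z z' \<le> 1 / real (M i)" using that(4) by simp
  qed
  define row where "row t i = map (\<lambda>k. H i (real k / real N, t)) [0..<Suc N]" for t i
  define R where "R t = concat (map (row t) [0..<Suc ?n])" for t
  \<comment> \<open>The time slice as a jumping-path. \<open>R t\<close> is one of its
    discretisations, so \<open>jdisc_props\<close> shows that \<open>R t\<close> is a theta-path,
    jumps included, and identifies its ends.\<close>
  define P where "P t = (map (\<lambda>i u. H i (u, t)) [0..<Suc ?n], jumps p)" for t
  have k01: "real k / real N \<in> {0..1}" if "k \<le> N" for k using that N by simp
  have jP: "jp (P t)" if "t \<in> {0..1}" for t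
    unfolding jumping_path_def
  proof (intro conjI ballI allI impI)
    fix g assume "g \<in> set (pieces (P t))"
    then obtain i where i: "i \<le> ?n" "g = (\<lambda>u. H i (u, t))" by (auto simp: P_def less_Suc_eq_le simp del: upt_Suc)
    show "path g" unfolding path_def i(2)
      by (rule continuous_on_compose2[OF cont[OF i(1)]]) (use that in \<open>auto intro!: continuous_intros\<close>)
  next
    show "set (jumps (P t)) \<subseteq> letters S" using assms(2) by (simp add: P_def jumping_path_def)
  next
    fix i assume i: "i < length (jumps (P t))"
    then show "(pieces (P t) ! Suc i) 0 = \<phi> [jumps (P t) ! i] ((pieces (P t) ! i) 1)"
      using H that by (simp add: P_def spatial_homotopy_def del: upt_Suc)
  qed (simp add: P_def)
  have disc: "path_discretisation \<theta> g (row t i)"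
    if "i \<le> ?n" "t \<in> {0..1}" "\<And>u. u \<in> {0..1} \<Longrightarrow> g u = H i (u, t)" for g t i
  proof -
    have "row t i = map (\<lambda>k. g (real k / real N)) [0..<Suc N]"
      using that k01 by (simp add: row_def less_Suc_eq_le del: upt_Suc)
    moreover have "path_discretisation \<theta> g (map (\<lambda>k. g (real k / real N)) [0..<Suc N])"
    proof (rule uniform_discretisation[OF N])
      fix s s' :: real assume "s \<in> {0..1}" "s' \<in> {0..1}" "\<bar>s - s'\<bar> \<le> 1 / real N"
      then show "dist (g s) (g s') \<le> \<theta>"
        using close[OF that(1), of "(s, t)" "(s', t)"] that(2,3) by (simp add: dist_Pair_Pair dist_real_def)
    qed
    ultimately show ?thesis by simp
  qed
  have jd: "jdisc r (R t)"
    if "t \<in> {0..1}" "length (pieces r) = Suc ?n" "\<And>i u. i \<le> ?n \<Longrightarrow> u \<in> {0..1} \<Longrightarrow> (pieces r ! i) u = H i (u, t)" for r t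
    unfolding jpath_discretisation_def R_def
    by (intro exI[of _ "map (row t) [0..<Suc ?n]"])
      (use that disc in \<open>auto simp: list_all2_conv_all_nth less_Suc_eq_le simp del: upt_Suc\<close>)
  show thesis
  proof (rule that[of N R])
    show "0 < N" by (rule N)
    show "jdisc p (R 0)" "jdisc q (R 1)"
      by (rule jd; use H len in \<open>auto simp: spatial_homotopy_def\<close>)+
    fix t :: real assume t: "t \<in> {0..1}"
    have "jdisc (P t) (R t)"
      by (rule jd[OF t]) (auto simp: P_def simp del: upt_Suc)
    from jdisc_props[OF jP[OF t] this]
    show "tpath (R t) \<and> hd (R t) = H 0 (0, t) \<and> last (R t) = H ?n (1, t)"
      unfolding jstart_nth[OF jP[OF t]] jfinish_nth[OF jP[OF t]] by (simp add: P_def del: upt_Suc)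
    fix t' :: real assume t': "t' \<in> {0..1}" and tt: "\<bar>t - t'\<bar> \<le> 1 / real N"
    have "list_all2 near (row t i) (row t' i)" if "i \<le> ?n" for i
    proof -
      have "near (H i (real k / N, t)) (H i (real k / N, t'))" if "k \<le> N" for k
        using close[OF \<open>i \<le> ?n\<close>, of "(real k / N, t)" "(real k / N, t')"] k01[OF that] t t' tt
        by (intro near_dist) (simp add: dist_Pair_Pair dist_real_def)
      then show ?thesis by (auto simp: row_def list_all2_conv_all_nth less_Suc_eq_le simp del: upt_Suc)
    qed
    then have "list_all2 (list_all2 near) (map (row t) [0..<Suc ?n]) (map (row t') [0..<Suc ?n])"
      by (auto simp: list_all2_conv_all_nth[of "list_all2 near"] less_Suc_eq_le simp del: upt_Suc)
    then show "list_all2 near (R t) (R t')"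
      unfolding R_def by (rule concat_transfer[unfolded rel_fun_def, rule_format])
  qed
qed


lemma jdisc_spatially_homotopic:
  assumes "spatially_homotopic \<phi> p q" "jp p" "jp q" "jdisc p zs" "jdisc q ws"
  shows "zs \<simeq> ws"
proof -
  obtain H where H: "spatial_homotopy \<phi> H p q" and ends: "\<forall>t\<in>{0..1}. H 0 (0, t) = jstart p \<and> H 0 (0, t) = jstart q \<and>
           H (length (jumps p)) (1, t) = jfinish p \<and> H (length (jumps p)) (1, t) = jfinish q"
    using assms(1) unfolding spatially_homotopic_def by blast
  obtain N R where N: "0 < (N :: nat)" and R: "jdisc p (R 0)" "jdisc q (R 1)"
    "\<And>t. t \<in> {0..1::real} \<Longrightarrow> tpath (R t) \<and> hd (R t) = H 0 (0, t) \<and> last (R t) = H (length (jumps p)) (1, t)"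
    "\<And>t t'. t \<in> {0..1} \<Longrightarrow> t' \<in> {0..1} \<Longrightarrow> \<bar>t - t'\<bar> \<le> 1 / real N \<Longrightarrow> list_all2 near (R t) (R t')"
    using spatial_homotopy_rows[OF H assms(2,3)] by metis
  have "R 0 \<simeq> R (real j / N)" if "j \<le> N" for j
    using that
  proof (induction j)
    case 0
    then show ?case using R(3)[of 0] by (auto intro: refl)
  next
    case (Suc j)
    have t: "real j / N \<in> {0..1}" "real (Suc j) / N \<in> {0..1}" using Suc.prems N by auto
    have "R (real j / N) \<simeq> R (real (Suc j) / N)"
      using R(3)[OF t(1)] R(3)[OF t(2)] R(4)[OF t] ends t N
      by (intro theq_row_fixed) (auto simp: add_divide_distrib)
    then show ?case using Suc trans by simp
  qed
  from this[of N] have "R 0 \<simeq> R 1" using N by simp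
  then show ?thesis
    using jdisc_unique[OF assms(2,4) R(1)] jdisc_unique[OF assms(3) R(2) assms(5)] trans by blast
qed

text \<open>From one row to the next the base point moves by a single edge. By
  \<open>theq_row\<close> the earlier row is the later one conjugated by that edge, and
  \<open>null_conj\<close> compares the two.\<close>

lemma null_freely_spatially_homotopic:
  assumes "freely_spatially_homotopic \<phi> p q" "jp p" "jp q" "jdisc p zs" "jdisc q ws"
  shows "null zs \<longleftrightarrow> null ws"
proof -
  obtain H where H: "spatial_homotopy \<phi> H p q" and ends: "\<forall>t\<in>{0..1}. H 0 (0, t) = H (length (jumps p)) (1, t)"
    using assms(1) unfolding freely_spatially_homotopic_def by blast
  obtain N R where N: "0 < (N :: nat)" and R: "jdisc p (R 0)" "jdisc q (R 1)"
    "\<And>t. t \<in> {0..1::real} \<Longrightarrow> tpath (R t) \<and> hd (R t) = H 0 (0, t) \<and> last (R t) = H (length (jumps p)) (1, t)"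
    "\<And>t t'. t \<in> {0..1} \<Longrightarrow> t' \<in> {0..1} \<Longrightarrow> \<bar>t - t'\<bar> \<le> 1 / real N \<Longrightarrow> list_all2 near (R t) (R t')"
    using spatial_homotopy_rows[OF H assms(2,3)] by metis
  have "null (R 0) \<longleftrightarrow> null (R (real j / N))" if "j \<le> N" for j
    using that
  proof (induction j)
    case (Suc j)
    have t: "real j / N \<in> {0..1}" "real (Suc j) / N \<in> {0..1}" using Suc.prems N by auto
    let ?A = "R (real j / N)" and ?B = "R (real (Suc j) / N)"
    have la: "list_all2 near ?A ?B"
      using t N by (intro R(4)) (auto simp: add_divide_distrib)
    have A: "tpath ?A" "last ?A = hd ?A" and B: "tpath ?B" "hd ?B = last ?B"
      using R(3)[OF t(1)] R(3)[OF t(2)] ends t by auto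
    have "near (hd ?A) (hd ?B)"
      using la A(1) by (cases ?A; cases ?B) (auto simp: tpath_iff)
    from null_conj[OF B this] have "null (hd ?A # ?B @ [hd ?A]) \<longleftrightarrow> null ?B" .
    moreover have "null ?A \<longleftrightarrow> null (hd ?A # ?B @ [hd ?A])"
      using null_theq[OF theq_row[OF la A(1) B(1)]] A(2) by simp
    ultimately show ?case using Suc by simp
  qed simp
  from this[of N] have "null (R 0) \<longleftrightarrow> null (R 1)" using N by simp
  then show ?thesis
    using null_theq[OF jdisc_unique[OF assms(2,4) R(1)]] null_theq[OF jdisc_unique[OF assms(3) R(2) assms(5)]]
    by simp
qed

text \<open>The outer constant pieces shrink to the vertex \<open>c 0\<close>, one jump away from
  the base point of \<open>q\<close>, so what remains is a conjugate by that edge.\<close>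

lemma null_cyclic_contraction:
  assumes "cyclic_contraction p q" "cjp p" "cjp q" "jdisc p zs" "jdisc q ws"
  shows "null zs \<longleftrightarrow> null ws"
proof -
  obtain c c' l where *: "const_path c" "const_path c'"
    "p = ([c] @ pieces q @ [c'], [l] @ jumps q @ [letter_inv l])"
    using assms(1) unfolding cyclic_contraction_def by blast
  have jq: "jp q" "jfinish q = jstart q" and jpp: "jp p" "jstart p = jfinish p"
    using assms(2,3) by (auto simp: closed_jumping_path_def)
  obtain zss where zss: "list_all2 (path_discretisation \<theta>) ([c] @ pieces q @ [c']) zss" "zs = concat zss"
    using assms(4) unfolding *(3) jpath_discretisation_def by auto
  then obtain us xss where xss: "zss = us # xss" "path_discretisation \<theta> c us"
    "list_all2 (path_discretisation \<theta>) (pieces q @ [c']) xss"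
    by (auto simp: list_all2_Cons1)
  then obtain yss us' where yss: "xss = yss @ [us']" "list_all2 (path_discretisation \<theta>) (pieces q) yss"
    "path_discretisation \<theta> c' us'"
    by (auto simp: list_all2_append1 list_all2_Cons1)
  define vs where "vs = concat yss"
  have z: "zs = us @ vs @ us'" "path_discretisation \<theta> c us"
    "path_discretisation \<theta> c' us'" "jdisc q vs"
    using zss xss yss by (auto simp: vs_def jpath_discretisation_def)
  have l: "l \<in> letters S" using jpp(1) *(3) by (auto simp: jumping_path_def)
  have "jp (pieces q @ [c'], jumps q @ [letter_inv l])" "hd (pieces q @ [c']) 0 = \<phi> [l] (c 1)"
    using jpp(1) unfolding *(3) by (simp_all add: jumping_path_Cons)
  then have c: "jstart q = \<phi> [l] (c 1)" "c' 0 = \<phi> [letter_inv l] (jfinish q)"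
    using jumping_path_append[of "pieces q" "jumps q" "[c']" "[]" S \<phi> "letter_inv l"]
      jumping_path_pieces[OF jq(1)] jumping_path_nonempty[OF jq(1)]
    by (simp_all add: jstart_def jfinish_def)
  have c': "c' 0 = c 0" using c jq const_path_ends[OF *(1)] l by simp
  have vs: "tpath vs" "hd vs = jstart q" "last vs = jstart q" using jdisc_props[OF jq(1) z(4)] jq(2) by auto
  have n: "near (c 0) (jstart q)" using c(1) const_path_ends[OF *(1)] near_jump[OF l, of "c 0"] by simp
  have us: "us \<simeq> [c 0]" "us' \<simeq> [c 0]"
    using const_path_discretisation[OF z(2) *(1)] const_path_discretisation[OF z(3) *(2)] c' by auto
  have ends: "last us = c 0" "hd us' = c 0"
    using path_discretisation_props(3)[OF z(2)] path_discretisation_props(2)[OF z(3)] const_path_ends[OF *(1)] c' by auto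
  have "vs @ us' \<simeq> vs @ [c 0]"
    by (rule theq_append[OF refl[OF vs(1)] us(2)]) (use vs n ends near_sym in simp)
  from theq_append[OF us(1) this]
  have "us @ (vs @ us') \<simeq> [c 0] @ (vs @ [c 0])"
    using vs n ends by (simp add: tpath_iff)
  then have "null zs \<longleftrightarrow> null (c 0 # vs @ [c 0])" using null_theq z(1) by simp
  also have "\<dots> \<longleftrightarrow> null vs" using vs n by (intro null_conj) auto
  also have "\<dots> \<longleftrightarrow> null ws" using null_theq[OF jdisc_unique[OF jq(1) z(4) assms(5)]] .
  finally show ?thesis .
qed

lemma jdisc_jeq:
  assumes "p \<asymp> q" "jp p" "jdisc p zs" "jdisc q ws"
  shows "zs \<simeq> ws"
proof -
  have "equivclp (\<lambda>p q. jp p \<and> jp q \<and> (spatially_homotopic \<phi> p q \<or> contraction p q)) p q"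
    using assms(1) by (simp add: jhomotopic_def)
  then have "jp q \<and> (\<forall>ws. jdisc q ws \<longrightarrow> zs \<simeq> ws)"
  proof (induction rule: equivclp_induct)
    case base
    then show ?case using jdisc_unique assms(2,3) by blast
  next
    case (step y z)
    have one: "as \<simeq> bs"
      if "jp a \<and> jp b \<and> (spatially_homotopic \<phi> a b \<or> contraction a b)" "jdisc a as" "jdisc b bs" for a b as bs
      using that jdisc_spatially_homotopic jdisc_contraction by blast
    obtain vs where vs: "jdisc y vs" using step jdisc_exists by blast
    then have zv: "zs \<simeq> vs" using step by blast
    have "zs \<simeq> ws" if "jdisc z ws" for ws
      using step(2) one[of y z vs ws] one[of z y ws vs] vs that zv sym trans by metis
    then show ?case using step by blast
  qed
  then show ?thesis using assms(4) by blast
qed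

lemma null_feq:
  assumes "p \<frown> q" "cjp p" "jdisc p zs" "jdisc q ws"
  shows "null zs \<longleftrightarrow> null ws"
proof -
  have "equivclp (\<lambda>p q. cjp p \<and> cjp q \<and>
      (freely_spatially_homotopic \<phi> p q \<or> contraction p q \<or> cyclic_contraction p q)) p q"
    using assms(1) by (simp add: freely_jhomotopic_def)
  then have "cjp q \<and> (\<forall>ws. jdisc q ws \<longrightarrow> (null zs \<longleftrightarrow> null ws))"
  proof (induction rule: equivclp_induct)
    case base
    then show ?case
      using null_theq jdisc_unique assms(2,3) unfolding closed_jumping_path_def by blast
  next
    case (step y z)
    have one: "null as \<longleftrightarrow> null bs"
      if "cjp a \<and> cjp b \<and> (freely_spatially_homotopic \<phi> a b \<or> contraction a b \<or> cyclic_contraction a b)"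
        "jdisc a as" "jdisc b bs" for a b as bs
    proof -
      have j: "jp a" "jp b" "cjp a" "cjp b" using that(1) by (auto simp: closed_jumping_path_def)
      from that(1) show ?thesis
        using null_freely_spatially_homotopic[OF _ j(1,2) that(2,3)]
          null_theq[OF jdisc_contraction[OF _ j(1,2) that(2,3)]]
          null_cyclic_contraction[OF _ j(3,4) that(2,3)] by argo
    qed
    have "cjp y" using step by blast
    then obtain vs where vs: "jdisc y vs" using jdisc_exists unfolding closed_jumping_path_def by blast
    then have zv: "null zs \<longleftrightarrow> null vs" using step by blast
    have "null zs \<longleftrightarrow> null ws" if "jdisc z ws" for ws
      using step(2) one[of y z vs ws] one[of z y ws vs] vs that zv by metis
    then show ?case using step by blast
  qed
  then show ?thesis using assms(4) by blast
qed

section \<open>The discretisation homomorphism\<close>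

abbreviation P :: "'a \<Rightarrow> 'a list set monoid" where "P \<equiv> discrete_pi1 \<delta> \<theta>"

abbreviation D :: "('s, 'a) jpath set \<Rightarrow> 'a list set" where "D \<equiv> discretisation S \<phi> \<theta>"

text \<open>\<open>D\<close> is a union over representatives and their discretisations; by
  \<open>jdisc_jeq\<close> all of them contribute the same class.\<close>

lemma D_jcl:
  assumes "jp p" "jdisc p zs"
  shows "D (jcl p) = cls zs"
proof -
  have *: "cls zs' = cls zs" if "q \<in> jcl p" "jdisc q zs'" for q zs'
  proof -
    have "zs \<simeq> zs'" using that assms jdisc_jeq by (simp add: mem_jcl)
    then show ?thesis using cls_eq_iff theqD sym by blast
  qed
  then have "D (jcl p) = (\<Union>q\<in>jcl p. \<Union>zs'\<in>{zs'. jdisc q zs'}. cls zs)"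
    unfolding discretisation_def by (intro SUP_cong) auto
  also have "\<dots> = cls zs"
  proof -
    have "p \<in> jcl p" by (simp add: mem_jcl)
    then show ?thesis using assms(2) by blast
  qed
  finally show ?thesis .
qed

lemma group_hom_D: "group_hom (J x0) (P x0) D"
proof -
  have "D \<in> hom (J x0) (P x0)"
  proof (rule homI)
    fix A assume "A \<in> carrier (J x0)"
    then obtain p where p: "A = jcl p" "jp p" "jstart p = x0" "jfinish p = x0" by (auto simp: carrier_J)
    obtain zs where zs: "jdisc p zs" using jdisc_exists p by blast
    show "D A \<in> carrier (P x0)"
      using D_jcl[OF p(2) zs] jdisc_props[OF p(2) zs] p by (simp add: carrier_discrete_pi1)
    fix B assume "B \<in> carrier (J x0)"
    then obtain q where q: "B = jcl q" "jp q" "jstart q = x0" "jfinish q = x0" by (auto simp: carrier_J)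
    obtain ws where ws: "jdisc q ws" using jdisc_exists q by blast
    have e: "jfinish p = jstart q" using p q by simp
    note z = jdisc_props[OF p(2) zs] and w = jdisc_props[OF q(2) ws]
    have "D (A \<otimes>\<^bsub>J x0\<^esub> B) = cls (zs @ tl ws)"
      using p q e D_jcl[OF _ jdisc_jconcat[OF p(2) q(2) e zs ws]] by (simp add: mult_jcl)
    also have "\<dots> = cls (zs @ ws)"
      using theq_join[of zs ws] z w e by (simp add: cls_eq_iff theqD)
    also have "\<dots> = D A \<otimes>\<^bsub>P x0\<^esub> D B"
      using p q D_jcl[OF p(2) zs] D_jcl[OF q(2) ws] z w by (simp add: mult_cls)
    finally show "D (A \<otimes>\<^bsub>J x0\<^esub> B) = D A \<otimes>\<^bsub>P x0\<^esub> D B" .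
  qed
  then show ?thesis
    by (simp add: group_hom_def group_hom_axioms_def group_J group_discrete_pi1)
qed

section \<open>Short jumping-paths\<close>

lemma dist_le_path_length:
  assumes "0 \<le> u" "u \<le> v" "v \<le> 1"
  shows "ennreal (dist (g u) (g v)) \<le> path_length g"
  unfolding path_length_def
  by (rule SUP_upper2[of "[u, v]"]) (use assms in auto)

lemma path_length_const [simp]: "path_length (\<lambda>_. x :: 'b::metric_space) = 0"
proof -
  have "{ts :: real list. sorted ts \<and> set ts \<subseteq> {0..1}} \<noteq> {}" by (auto intro: exI[of _ "[]"])
  then show ?thesis by (simp add: path_length_def)
qed

lemma jlength_Cons: "jlength (g # gs, l # ls) = path_length g + (1 + jlength (gs, ls))"
  by (simp add: jlength_def algebra_simps)

text \<open>Continuous parts count with \<open>dist\<close>, which dominates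
  \<open>\<delta>\<close>, and each jump counts 1, so the triangle inequality can be applied along
  the way to \<open>z\<close>. Having the bound at every vertex, and not just at the last, confines
  the whole discretisation to a ball.\<close>

lemma warped_dist_le_jlength:
  assumes "jp p" "jdisc p zs" "z \<in> set zs"
  shows "ennreal (\<delta> (jstart p) z) \<le> jlength p"
  using assms
proof (induction arbitrary: zs rule: jumping_path_induct)
  case (single g)
  then have "z \<in> g ` {0..1}" using path_discretisation_props(4)[of g zs] by (auto simp: jdisc_single)
  then obtain u where u: "u \<in> {0..1}" "z = g u" by blast
  have "ennreal (\<delta> (g 0) z) \<le> ennreal (dist (g 0) (g u))"
    using u warped_dist_le_dist by (intro ennreal_leI) simp
  also have "\<dots> \<le> path_length g" using u by (intro dist_le_path_length) auto
  finally show ?case by (simp add: jlength_def)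
next
  case (Cons g l p)
  obtain us vs where zs: "zs = us @ vs" "path_discretisation \<theta> g us" "jdisc p vs"
    using Cons.prems by (auto simp: jdisc_Cons)
  have le: "ennreal (\<delta> (g 0) (g u)) \<le> path_length g" if "u \<in> {0..1}" for u
  proof -
    have "ennreal (\<delta> (g 0) (g u)) \<le> ennreal (dist (g 0) (g u))"
      using warped_dist_le_dist by (intro ennreal_leI) simp
    also have "\<dots> \<le> path_length g" using that by (intro dist_le_path_length) auto
    finally show ?thesis .
  qed
  have jl: "jlength (g # pieces p, l # jumps p) = path_length g + (1 + jlength p)"
    by (simp add: jlength_Cons)
  show ?case
  proof (cases "z \<in> set us")
    case True
    then obtain u where "u \<in> {0..1}" "z = g u" using path_discretisation_props(4)[OF zs(2)] by blast
    then show ?thesis using le[of u] unfolding jl by (simp add: add_increasing2)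
  next
    case False
    then have "z \<in> set vs" using Cons.prems(2) zs(1) by simp
    from Cons.IH[OF zs(3) this] have IH: "ennreal (\<delta> (jstart p) z) \<le> jlength p" .
    have "\<delta> (g 0) z \<le> \<delta> (g 0) (g 1) + (\<delta> (g 1) (jstart p) + \<delta> (jstart p) z)"
      using triangle[of "g 0" "g 1" z] triangle[of "g 1" "jstart p" z] by simp
    then have "ennreal (\<delta> (g 0) z) \<le> ennreal (\<delta> (g 0) (g 1)) + (ennreal (\<delta> (g 1) (jstart p)) + ennreal (\<delta> (jstart p) z))"
      by (simp add: ennreal_leI flip: ennreal_plus)
    also have "\<dots> \<le> path_length g + (1 + jlength p)"
      using le[of 1] IH warped_dist_jump[OF Cons(2), of "g 1"] Cons(4)
      by (intro add_mono) (auto simp: ennreal_le_1)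
    finally show ?thesis unfolding jl by simp
  qed
qed

definition short :: "('s, 'a) jpath \<Rightarrow> 'a \<Rightarrow> 'a \<Rightarrow> bool" where
  "short p x y \<longleftrightarrow> jp p \<and> jlength p \<le> ennreal \<theta> \<and> jstart p = x \<and> jfinish p = y"

text \<open>By \<open>warped_dist_le_jlength\<close> all vertices are near the first one, so
  \<open>theq_star\<close> collapses the discretisation to one edge.\<close>

lemma short_jdisc:
  assumes "short p x y" "jdisc p zs"
  shows "zs \<simeq> [x, y]"
proof -
  have p: "jp p" "jlength p \<le> ennreal \<theta>" "jstart p = x" "jfinish p = y" using assms(1) by (auto simp: short_def)
  have near: "near x z" if "z \<in> set zs" for z
  proof -
    have "ennreal (\<delta> x z) \<le> ennreal \<theta>"
      using order_trans[OF warped_dist_le_jlength[OF p(1) assms(2) that] p(2)] unfolding p(3) .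
    then show ?thesis by (rule iffD1[OF ennreal_le_iff[OF theta_nonneg]])
  qed
  obtain zs' where zs: "zs = x # zs'"
    using jdisc_props(1,2)[OF p(1) assms(2)] p(3) by (cases zs) (auto simp: tpath_iff)
  show ?thesis
  proof (cases "zs' = []")
    case True
    then show ?thesis
      using zs jdisc_props(3)[OF p(1) assms(2)] p(4) theq_stutter1[of x "[]"] by (simp add: tpath_iff)
  next
    case False
    then show ?thesis
      using theq_star[of x zs'] near zs jdisc_props(1,3)[OF p(1) assms(2)] p(4) by simp
  qed
qed

lemma short_jconst: "short (jconst x) x x"
  by (simp add: short_def) (simp add: jconst_def jlength_def)

lemma short_leap: "l \<in> letters S \<Longrightarrow> short (leap l x) x (\<phi> [l] x)"
  using theta_ge_1 by (simp add: short_def) (simp add: leap_def jlength_def)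

lemma short_near: "short p x y \<Longrightarrow> near x y"
proof -
  assume s: "short p x y"
  then obtain zs where "jdisc p zs" using jdisc_exists[of p] by (auto simp: short_def)
  from theqD(2)[OF short_jdisc[OF s this]] show ?thesis by (simp add: tpath_iff)
qed

lemma jpath_of_tpath:
  assumes short: "\<And>x y. near x y \<Longrightarrow> \<exists>p. short p x y" and "tpath zs"
  shows "\<exists>p ds. jp p \<and> jstart p = hd zs \<and> jfinish p = last zs \<and> jdisc p ds \<and> ds \<simeq> zs"
  using assms(2)
proof (induction zs)
  case (Cons a zs)
  show ?case
  proof (cases zs)
    case Nil
    obtain ds where "jdisc (jconst a) ds" using jdisc_exists[of "jconst a"] by auto
    moreover have "ds \<simeq> [a]"
      by (rule trans[OF short_jdisc[OF short_jconst calculation] sym[OF theq_stutter1[of a "[]"]]])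
        (simp add: tpath_iff)
    ultimately show ?thesis using Nil by (intro exI[of _ "jconst a"]) auto
  next
    case c: (Cons b bs)
    obtain p ds where p: "jp p" "jstart p = b" "jfinish p = last zs" "jdisc p ds" "ds \<simeq> zs"
      using Cons c by (auto simp: tpath_iff)
    obtain q where q: "short q a b" using short[of a b] Cons.prems c by (auto simp: tpath_iff)
    then have jq: "jp q" "jstart q = a" "jfinish q = b" by (auto simp: short_def)
    obtain es where es: "jdisc q es" using jdisc_exists[OF jq(1)] by blast
    have jd: "jdisc (q \<cdot> p) (es @ tl ds)"
      using jdisc_jconcat[OF jq(1) p(1) _ es p(4)] jq p by simp
    have "es @ tl ds \<simeq> [a, b] @ tl zs"
      using theq_join_cong[OF short_jdisc[OF q es] p(5)] jdisc_props[OF jq(1) es] jdisc_props[OF p(1,4)] jq p by simp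
    then show ?thesis using jd jq p c by (intro exI[of _ "q \<cdot> p"] exI[of _ "es @ tl ds"]) simp
  qed
qed (simp add: tpath_iff)

lemma D_surj:
  assumes short: "\<And>x y. near x y \<Longrightarrow> \<exists>p. short p x y"
  shows "D ` carrier (J x0) = carrier (P x0)"
proof
  interpret group_hom "J x0" "P x0" D by (rule group_hom_D)
  show "D ` carrier (J x0) \<subseteq> carrier (P x0)" by (rule img_is_subgroup[THEN subgroup.subset])
  show "carrier (P x0) \<subseteq> D ` carrier (J x0)"
  proof
    fix A assume "A \<in> carrier (P x0)"
    then obtain zs where zs: "A = cls zs" "tpath zs" "hd zs = x0" "last zs = x0" by (auto simp: carrier_discrete_pi1)
    obtain p ds where p: "jp p" "jstart p = x0" "jfinish p = x0" "jdisc p ds" "ds \<simeq> zs"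
      using jpath_of_tpath[OF short zs(2)] zs by metis
    have "D (jcl p) = A"
      using D_jcl[OF p(1,4)] zs p(5) by (simp add: cls_eq_iff theqD)
    then show "A \<in> D ` carrier (J x0)" using p by (force simp: carrier_J)
  qed
qed

lemma null_short_quadrilateral:
  assumes "q \<in> short_quadrilaterals S \<phi> \<theta>" "jdisc q ws"
  shows "null ws"
proof -
  obtain p0 p1 p2 p3 where q: "q = ((p0 \<cdot> p1) \<cdot> p2) \<cdot> p3" "jstart q = jfinish q"
    and s: "\<forall>q\<in>{p0, p1, p2, p3}. jp q \<and> jlength q \<le> ennreal \<theta>"
    and m: "jfinish p0 = jstart p1" "jfinish p1 = jstart p2" "jfinish p2 = jstart p3"
    using assms(1) unfolding short_quadrilaterals_def closed_jumping_path_def by blast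
  let ?a = "jstart p0" and ?b = "jstart p1" and ?c = "jstart p2" and ?d = "jstart p3"
  have j: "jp p0" "jp p1" "jp p2" "jp p3" using s by auto
  have e: "jfinish p3 = ?a" using q m j by simp
  have sh: "short p0 ?a ?b" "short p1 ?b ?c" "short p2 ?c ?d" "short p3 ?d ?a"
    using s m e by (auto simp: short_def)
  obtain z0 z1 z2 z3 where z: "jdisc p0 z0" "jdisc p1 z1" "jdisc p2 z2" "jdisc p3 z3"
    using jdisc_exists j by metis
  have h: "z0 \<simeq> [?a, ?b]" "z1 \<simeq> [?b, ?c]" "z2 \<simeq> [?c, ?d]" "z3 \<simeq> [?d, ?a]"
    using sh z short_jdisc by auto
  have n: "near ?a ?b" "near ?b ?c" "near ?c ?d" "near ?d ?a" using sh short_near by auto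
  have jd: "jdisc q (((z0 @ tl z1) @ tl z2) @ tl z3)"
    unfolding q(1) using j m z by (intro jdisc_jconcat) simp_all
  have "z0 @ tl z1 \<simeq> [?a, ?b] @ tl [?b, ?c]"
    using theqD[OF h(1)] theqD[OF h(2)] by (intro theq_join_cong h) simp
  then have 1: "z0 @ tl z1 \<simeq> [?a, ?b, ?c]" by simp
  have "(z0 @ tl z1) @ tl z2 \<simeq> [?a, ?b, ?c] @ tl [?c, ?d]"
    using theqD[OF 1] theqD[OF h(3)] by (intro theq_join_cong h 1) simp
  then have 2: "(z0 @ tl z1) @ tl z2 \<simeq> [?a, ?b, ?c, ?d]" by simp
  have "((z0 @ tl z1) @ tl z2) @ tl z3 \<simeq> [?a, ?b, ?c, ?d] @ tl [?d, ?a]"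
    using theqD[OF 2] theqD[OF h(4)] by (intro theq_join_cong h 2) simp
  \<comment> \<open>The square move exchanges \<open>?b\<close> for \<open>?d\<close>; what is left
    consists of backtrackings only.\<close>
  also have "\<dots> \<simeq> [?a, ?d, ?c, ?d, ?a]"
    using theq_square1[of ?a ?b ?c "[?d, ?a]" ?d] n by (simp add: tpath_iff near_sym)
  also have "\<dots> \<simeq> [?a, ?d, ?a]"
    using theq_Cons[OF theq_backtrack[of ?d ?c "[?a]"], of ?a] n by (simp add: tpath_iff near_sym)
  also have "\<dots> \<simeq> [?a]"
    using theq_backtrack[of ?a ?d "[]"] n by (simp add: tpath_iff near_sym)
  finally have f: "((z0 @ tl z1) @ tl z2) @ tl z3 \<simeq> [?a]" .
  have "jp q" using assms(1) by (simp add: short_quadrilaterals_def closed_jumping_path_def)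
  from null_theq[OF jdisc_unique[OF this assms(2) jd]] f show ?thesis
    using theqD(3)[OF f] by (simp add: null_def)
qed

lemma FT_subset_kernel: "FT S \<phi> \<theta> x0 \<subseteq> kernel (J x0) (P x0) D"
proof
  fix A assume "A \<in> FT S \<phi> \<theta> x0"
  then obtain p q where p: "A = jcl p" "cjp p" "jstart p = x0" and q: "q \<in> short_quadrilaterals S \<phi> \<theta>" "p \<frown> q"
    unfolding FT_def by blast
  have j: "jp p" "jfinish p = x0" "jp q"
    using p q by (auto simp: closed_jumping_path_def short_quadrilaterals_def)
  obtain zs ws where z: "jdisc p zs" "jdisc q ws" using jdisc_exists j by metis
  have "null zs" using null_feq[OF q(2) p(2) z] null_short_quadrilateral[OF q(1) z(2)] by simp
  then have "zs \<simeq> [x0]" using jdisc_props(2)[OF j(1) z(1)] p(3) by (simp add: null_def)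
  then have "D A = \<one>\<^bsub>P x0\<^esub>"
    unfolding p(1) D_jcl[OF j(1) z(1)] one_discrete_pi1 by (simp add: cls_eq_iff theqD)
  then show "A \<in> kernel (J x0) (P x0) D"
    using p j by (auto simp: kernel_def carrier_J)
qed

end

section \<open>The kernel\<close>

locale geodesic_scale = warped_scale S \<phi> \<theta>
  for S :: "'s set" and \<phi> :: "'s letter list \<Rightarrow> 'a::metric_space \<Rightarrow> 'a" and \<theta> :: real +
  fixes x0 :: 'a
  assumes connected: "path_connected (UNIV :: 'a set)"
    and rectifiable: "homotopy_rectifiable_paths (UNIV :: 'a set)"
    and geodesic: "jumping_geodesic S \<phi>"
begin

lemma short_exists: "near x y \<Longrightarrow> \<exists>p. short p x y"
proof -
  assume n: "near x y"
  obtain p where "jp p" "jstart p = x" "jfinish p = y" "jlength p = ennreal (\<delta> x y)"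
    using geodesic unfolding jumping_geodesic_def by blast
  then show ?thesis using n by (intro exI[of _ p]) (simp add: short_def ennreal_leI)
qed

text \<open>Paths \<open>tail x\<close> from the base point turn the fundamental groupoid into the group \<open>J x0\<close>.\<close>

definition tail :: "'a \<Rightarrow> ('s, 'a) jpath" where
  "tail x = (if x = x0 then jconst x0 else ([SOME g. path g \<and> g 0 = x0 \<and> g 1 = x], []))"

definition untail :: "'a \<Rightarrow> ('s, 'a) jpath" where
  "untail x = (SOME q. jinverse (tail x) q)"

lemma tail: "jp (tail x)" "jstart (tail x) = x0" "jfinish (tail x) = x"
proof -
  have "\<exists>g. path g \<and> g 0 = x0 \<and> g 1 = x"
    using connected by (auto simp: path_connected_def pathstart_def pathfinish_def)
  from someI_ex[OF this] show "jp (tail x)" "jstart (tail x) = x0" "jfinish (tail x) = x"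
    by (auto simp: tail_def jp_piece)
qed

lemma jinverse_tail: "jinverse (tail x) (untail x)"
  unfolding untail_def using jinverse_exists[OF tail(1)] by (rule someI_ex)

lemma untail: "jp (untail x)" "jstart (untail x) = x" "jfinish (untail x) = x0" "untail x \<cdot> tail x \<asymp> jconst x"
  using jinverse_tail[of x] by (auto simp: jinverse_def tail)

lemma untail_x0: "untail x0 \<asymp> jconst x0"
proof -
  have "jconst x0 \<cdot> untail x0 \<asymp> jconst x0"
    using jinverse_tail[of x0] by (simp add: jinverse_def tail_def)
  then show ?thesis using jconst_jconcat[OF untail(1)[of x0]] untail(2)[of x0] jeq_sym jeq_trans by metis
qed

definition F :: "('s, 'a) jpath \<Rightarrow> ('s, 'a) jpath set" where
  "F p = jcl (tail (jstart p) \<cdot> (p \<cdot> untail (jfinish p)))"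

lemmas tail_untail [simp] = tail untail(1-3)

lemma F_carrier: "jp p \<Longrightarrow> F p \<in> carrier (J x0)"
  unfolding F_def carrier_J by (rule imageI) simp

lemma F_cong: "p \<asymp> q \<Longrightarrow> jp p \<Longrightarrow> F p = F q"
  unfolding F_def using jeqD[of p q]
  by (auto simp: jcl_eq_iff intro!: jconcat_cong_right jconcat_cong_left)

text \<open>At the junction, \<open>untail\<close> followed by \<open>tail\<close> cancels.\<close>

lemma F_jconcat:
  assumes "jp p" "jp q" "jfinish p = jstart q"
  shows "F (p \<cdot> q) = F p \<otimes>\<^bsub>J x0\<^esub> F q"
proof -
  let ?t = "tail (jstart p)" and ?m = "jstart q" and ?b = "untail (jfinish q)"
  have "(?t \<cdot> (p \<cdot> untail ?m)) \<cdot> (tail ?m \<cdot> (q \<cdot> ?b)) \<asymp> ?t \<cdot> ((p \<cdot> untail ?m) \<cdot> (tail ?m \<cdot> (q \<cdot> ?b)))"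
    using assms by (intro jconcat_assoc) simp_all
  also have "\<dots> \<asymp> ?t \<cdot> (p \<cdot> (untail ?m \<cdot> (tail ?m \<cdot> (q \<cdot> ?b))))"
    using assms by (intro jconcat_cong_right jconcat_assoc) simp_all
  also have "\<dots> \<asymp> ?t \<cdot> (p \<cdot> ((untail ?m \<cdot> tail ?m) \<cdot> (q \<cdot> ?b)))"
    using assms by (intro jconcat_cong_right jeq_sym[OF jconcat_assoc]) simp_all
  also have "\<dots> \<asymp> ?t \<cdot> (p \<cdot> (jconst ?m \<cdot> (q \<cdot> ?b)))"
    using assms by (intro jconcat_cong_right jconcat_cong_left untail(4)) simp_all
  also have "\<dots> \<asymp> ?t \<cdot> (p \<cdot> (q \<cdot> ?b))"
    using assms jconst_jconcat[of "q \<cdot> ?b"] by (intro jconcat_cong_right) simp_all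
  also have "\<dots> \<asymp> ?t \<cdot> ((p \<cdot> q) \<cdot> ?b)"
    using assms by (intro jconcat_cong_right jeq_sym[OF jconcat_assoc]) simp_all
  finally show ?thesis
    using assms jeq_sym by (simp add: F_def mult_jcl jcl_eq_iff)
qed

text \<open>\<open>tail x0\<close> was chosen constant, so up to homotopy nothing is attached to a
  loop at \<open>x0\<close>.\<close>

lemma F_closed:
  assumes "jp p" "jstart p = x0" "jfinish p = x0"
  shows "F p = jcl p"
proof -
  have "tail x0 \<cdot> (p \<cdot> untail x0) \<asymp> jconst x0 \<cdot> (p \<cdot> jconst x0)"
  proof -
    have "p \<cdot> untail x0 \<asymp> p \<cdot> jconst x0"
      using assms by (intro jconcat_cong_right untail_x0) simp_all
    then have "jconst x0 \<cdot> (p \<cdot> untail x0) \<asymp> jconst x0 \<cdot> (p \<cdot> jconst x0)"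
      by (rule jconcat_cong_right) (simp_all add: assms)
    then show ?thesis by (simp add: tail_def)
  qed
  also have "\<dots> \<asymp> jconst x0 \<cdot> p"
    using assms jconcat_jconst[of p] by (intro jconcat_cong_right) simp_all
  also have "\<dots> \<asymp> p" using assms jconst_jconcat[of p] by simp
  finally show ?thesis using assms by (simp add: F_def jcl_eq_iff)
qed

section \<open>Values of jumping-paths modulo \<open>FT\<close>\<close>

abbreviation N :: "('s, 'a) jpath set set" where "N \<equiv> generate (J x0) (FT S \<phi> \<theta> x0)"

definition Q :: "('s, 'a) jpath set set monoid" where "Q = J x0 Mod N"

lemma FT_carrier: "FT S \<phi> \<theta> x0 \<subseteq> carrier (J x0)"
  by (auto simp: FT_def carrier_J closed_jumping_path_def)

lemma normal_N: "N \<lhd> J x0"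
proof (rule group.normal_generateI[OF group_J FT_carrier])
  fix A B assume "A \<in> FT S \<phi> \<theta> x0" and "B \<in> carrier (J x0)"
  then obtain w q a where w: "A = jcl w" "cjp w" "jstart w = x0" "q \<in> short_quadrilaterals S \<phi> \<theta>" "w \<frown> q"
    and a: "B = jcl a" "jp a" "jstart a = x0" "jfinish a = x0"
    unfolding FT_def carrier_J by blast
  obtain b where b: "jinverse a b" using jinverse_exists[OF a(2)] by blast
  have e: "jfinish a = jstart w" using a w by simp
  have jw: "jp w" "jfinish w = x0" "jp b" "jstart b = x0" "jfinish b = x0"
    using w(2,3) b a by (auto simp: closed_jumping_path_def jinverse_def)
  have "(a \<cdot> w) \<cdot> b \<asymp> a \<cdot> (w \<cdot> b)"
    using jw a w by (intro jconcat_assoc) simp_all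
  then have "B \<otimes>\<^bsub>J x0\<^esub> A \<otimes>\<^bsub>J x0\<^esub> inv\<^bsub>J x0\<^esub> B = jcl (a \<cdot> (w \<cdot> b))"
    using a w jw inv_jcl[OF b, of x0] by (simp add: mult_jcl jcl_eq_iff)
  moreover have "a \<cdot> (w \<cdot> b) \<frown> q" using feq_conj[OF b w(2) e] w(5) feq_trans by blast
  ultimately show "B \<otimes>\<^bsub>J x0\<^esub> A \<otimes>\<^bsub>J x0\<^esub> inv\<^bsub>J x0\<^esub> B \<in> FT S \<phi> \<theta> x0"
    unfolding FT_def using cjp_conj(3,4)[OF b w(2) e] a(3) w(4) by blast
qed

lemma group_Q: "Group.group Q"
  unfolding Q_def by (rule normal.factorgroup_is_group[OF normal_N])

interpretation Q: Group.group Q by (rule group_Q)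

definition G :: "('s, 'a) jpath \<Rightarrow> ('s, 'a) jpath set set" where
  "G p = N #>\<^bsub>J x0\<^esub> F p"

lemma one_Q: "\<one>\<^bsub>Q\<^esub> = N"
  by (simp add: Q_def FactGroup_def)

lemma G_carrier [simp]: "jp p \<Longrightarrow> G p \<in> carrier Q"
  using F_carrier[of p] by (auto simp: Q_def G_def FactGroup_def RCOSETS_def)

lemma G_cong: "p \<asymp> q \<Longrightarrow> jp p \<Longrightarrow> G p = G q"
  by (simp add: G_def F_cong[of p q])

lemma G_jconcat: "jp p \<Longrightarrow> jp q \<Longrightarrow> jfinish p = jstart q \<Longrightarrow> G (p \<cdot> q) = G p \<otimes>\<^bsub>Q\<^esub> G q"
  using normal.rcos_sum[OF normal_N F_carrier F_carrier, of p q]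
  by (simp add: Q_def G_def F_jconcat FactGroup_def)

text \<open>A constant jumping-path is idempotent up to homotopy, and the unit is the only
  idempotent of a group.\<close>

lemma G_jconst [simp]: "G (jconst x) = \<one>\<^bsub>Q\<^esub>"
proof -
  have "jconst x \<cdot> jconst x \<asymp> jconst x" using jconst_jconcat[of "jconst x"] by simp
  then have "G (jconst x) = G (jconst x) \<otimes>\<^bsub>Q\<^esub> G (jconst x)"
    using G_cong[of "jconst x \<cdot> jconst x" "jconst x"] G_jconcat[of "jconst x" "jconst x"] by simp
  then show ?thesis using Q.l_cancel_one'[of "G (jconst x)" "G (jconst x)"] by simp
qed

text \<open>Attaching \<open>tail\<close> and \<open>untail\<close> conjugates the quadrilateral,
  and \<open>feq_conj\<close> absorbs this. Its value under \<open>F\<close> is thus an element of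
  \<open>FT\<close>, wherever the quadrilateral lies.\<close>

lemma G_quadrilateral:
  assumes "short p0 a b" "short p1 b c" "short p2 c d" "short p3 d a"
  shows "G p0 \<otimes>\<^bsub>Q\<^esub> G p1 \<otimes>\<^bsub>Q\<^esub> G p2 \<otimes>\<^bsub>Q\<^esub> G p3 = \<one>\<^bsub>Q\<^esub>"
proof -
  let ?w = "((p0 \<cdot> p1) \<cdot> p2) \<cdot> p3"
  have j: "jp p0" "jp p1" "jp p2" "jp p3" "jstart p0 = a" "jfinish p0 = b" "jstart p1 = b" "jfinish p1 = c"
    "jstart p2 = c" "jfinish p2 = d" "jstart p3 = d" "jfinish p3 = a"
    using assms by (auto simp: short_def)
  have w: "cjp ?w" "jstart ?w = a" "jfinish ?w = a" using j by (simp_all add: closed_jumping_path_def)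
  have "?w \<in> short_quadrilaterals S \<phi> \<theta>"
    unfolding short_quadrilaterals_def mem_Collect_eq
  proof (intro conjI exI)
    show "\<forall>q\<in>{p0, p1, p2, p3}. jp q \<and> jlength q \<le> ennreal \<theta>" using assms by (auto simp: short_def)
  qed (use w j in simp_all)
  moreover have c: "cjp (tail a \<cdot> (?w \<cdot> untail a))" "jstart (tail a \<cdot> (?w \<cdot> untail a)) = x0"
    using cjp_conj(3,4)[OF jinverse_tail w(1), of a] w(2) by simp_all
  moreover have "tail a \<cdot> (?w \<cdot> untail a) \<frown> ?w"
    using feq_conj[OF jinverse_tail w(1), of a] w(2) by simp
  ultimately have "F ?w \<in> FT S \<phi> \<theta> x0"
    unfolding F_def w(2,3) FT_def by blast
  then have "F ?w \<in> N" by (rule generate.incl)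
  then have "G ?w = \<one>\<^bsub>Q\<^esub>"
    unfolding G_def one_Q
    using group.coset_join2[OF group_J _ group.generate_is_subgroup[OF group_J FT_carrier]] F_carrier[of ?w] w(1)
    by (simp add: closed_jumping_path_def)
  then show ?thesis using j by (simp add: G_jconcat)
qed

text \<open>Closing both up by the same return path \<open>r\<close> and two constant sides gives
  quadrilaterals, so both values are inverse to \<open>G r\<close>.\<close>

lemma G_short_unique:
  assumes "short p x y" "short p' x y"
  shows "G p = G p'"
proof -
  obtain r where r: "short r y x" using short_exists short_near[OF assms(1)] near_sym by blast
  have j: "jp p" "jp p'" "jp r" using assms r by (auto simp: short_def)
  have "G p \<otimes>\<^bsub>Q\<^esub> G r = \<one>\<^bsub>Q\<^esub>" "G p' \<otimes>\<^bsub>Q\<^esub> G r = \<one>\<^bsub>Q\<^esub>"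
    using G_quadrilateral[OF assms(1) r short_jconst short_jconst]
      G_quadrilateral[OF assms(2) r short_jconst short_jconst] j by simp_all
  then show ?thesis using Q.right_cancel[of "G r" "G p" "G p'"] j by simp
qed

section \<open>The induced invariant of theta-paths\<close>

definition edge :: "'a \<Rightarrow> 'a \<Rightarrow> ('s, 'a) jpath set set" where
  "edge x y = G (SOME p. short p x y)"

lemma edge_eq: "short p x y \<Longrightarrow> edge x y = G p"
  unfolding edge_def by (rule G_short_unique[OF someI])

lemma edge_carrier [simp]: "near x y \<Longrightarrow> edge x y \<in> carrier Q"
  using short_exists[of x y] by (auto simp: edge_eq short_def)

lemma edge_refl [simp]: "edge x x = \<one>\<^bsub>Q\<^esub>"
  using edge_eq[OF short_jconst] by simp

lemma edge_quadrilateral: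
  assumes "near a b" "near b c" "near c d" "near d a"
  shows "edge a b \<otimes>\<^bsub>Q\<^esub> edge b c \<otimes>\<^bsub>Q\<^esub> edge c d \<otimes>\<^bsub>Q\<^esub> edge d a = \<one>\<^bsub>Q\<^esub>"
  using assms[THEN short_exists] G_quadrilateral by (auto simp: edge_eq)

text \<open>Both two-step paths are closed up by the same return \<open>c, d, a\<close>; for the
  second one this is the degenerate quadrilateral \<open>a, d, c, d, a\<close>.\<close>

lemma edge_square:
  assumes "near a b" "near b c" "near a d" "near d c"
  shows "edge a b \<otimes>\<^bsub>Q\<^esub> edge b c = edge a d \<otimes>\<^bsub>Q\<^esub> edge d c"
proof -
  have n: "near c d" "near d a" using assms near_sym by auto
  let ?x = "edge c d \<otimes>\<^bsub>Q\<^esub> edge d a"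
  have "(edge a b \<otimes>\<^bsub>Q\<^esub> edge b c) \<otimes>\<^bsub>Q\<^esub> ?x = (edge a d \<otimes>\<^bsub>Q\<^esub> edge d c) \<otimes>\<^bsub>Q\<^esub> ?x"
    using edge_quadrilateral[OF assms(1,2) n] edge_quadrilateral[OF assms(3,4) n] assms n
    by (simp add: Q.m_assoc)
  then show ?thesis using assms n by simp
qed

fun walk :: "'a list \<Rightarrow> ('s, 'a) jpath set set" where
  "walk (a # b # zs) = edge a b \<otimes>\<^bsub>Q\<^esub> walk (b # zs)"
| "walk _ = \<one>\<^bsub>Q\<^esub>"

lemma walk_carrier [simp]: "successively near zs \<Longrightarrow> walk zs \<in> carrier Q"
  by (induction zs rule: walk.induct) auto

lemma walk_append:
  assumes "successively near (xs @ a # ys)"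
  shows "walk (xs @ a # ys) = walk (xs @ [a]) \<otimes>\<^bsub>Q\<^esub> walk (a # ys)"
  using assms
proof (induction xs)
  case (Cons x xs)
  have "successively near (xs @ [a])" "successively near (a # ys)"
    using Cons.prems by (auto simp: successively_append_iff successively_Cons)
  then show ?case
    using Cons walk_carrier[of "xs @ [a]"] by (cases xs) (simp_all add: Q.m_assoc)
qed simp

text \<open>A repetition inserts the factor \<open>edge a a\<close>, which is the unit, and a square
  move exchanges two neighbouring factors according to \<open>edge_square\<close>.\<close>

lemma walk_theq: "zs \<simeq> ws \<Longrightarrow> walk zs = walk ws"
proof (induction rule: theq.induct)
  case (stutter xs a ys)
  then show ?case
    using walk_append[of xs a ys] walk_append[of xs a "a # ys"] theqD(2)[OF theq.stutter[OF stutter]]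
    by (simp add: tpath_iff successively_append_iff)
next
  case (square xs a b c ys d)
  have n: "near a b" "near b c" "near a d" "near d c" and s: "successively near (c # ys)"
    "successively near (xs @ [a])"
    using square by (auto simp: tpath_iff successively_append_iff)
  have "walk (a # b # c # ys) = walk (a # d # c # ys)"
    using edge_square[OF n] n s by (simp add: Q.m_assoc[symmetric])
  then show ?case
    using walk_append[of xs a "b # c # ys"] walk_append[of xs a "d # c # ys"] square
    by (simp add: tpath_iff)
qed simp_all

section \<open>Comparing a jumping-path with the walk along its discretisation\<close>

definition tracked :: "('s, 'a) jpath \<Rightarrow> bool" where
  "tracked p \<longleftrightarrow> (\<exists>ds. jdisc p ds \<and> G p = walk ds)"

text \<open>One discretisation stands for all: any two are homotopic, and \<open>walk\<close> is
  invariant under homotopy.\<close>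

lemma trackedD: "tracked p \<Longrightarrow> jp p \<Longrightarrow> jdisc p zs \<Longrightarrow> G p = walk zs"
  using jdisc_unique walk_theq unfolding tracked_def by metis

lemma tracked_short:
  assumes "short p x y"
  shows "tracked p"
proof -
  have j: "jp p" using assms by (simp add: short_def)
  then obtain ds where ds: "jdisc p ds" using jdisc_exists by blast
  have "walk ds = edge x y"
    using walk_theq[OF short_jdisc[OF assms ds]] short_near[OF assms] by simp
  then show ?thesis using edge_eq[OF assms] ds by (auto simp: tracked_def)
qed

lemma tracked_jeq:
  assumes "jp p" "p \<asymp> q" "tracked p"
  shows "tracked q"
proof -
  obtain ds es where ds: "jdisc p ds" "jdisc q es" using jdisc_exists assms(1) jeqD(1)[OF assms(2,1)] by metis
  have "G q = walk es"
    using trackedD[OF assms(3,1) ds(1)] G_cong[OF assms(2,1)] walk_theq[OF jdisc_jeq[OF assms(2,1) ds]] by simp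
  then show ?thesis using ds by (auto simp: tracked_def)
qed

lemma tracked_jconcat:
  assumes "jp p" "jp q" "jfinish p = jstart q" "tracked p" "tracked q"
  shows "tracked (p \<cdot> q)"
proof -
  obtain ds es where d: "jdisc p ds" "jdisc q es" "G p = walk ds" "G q = walk es"
    using assms(4,5) by (auto simp: tracked_def)
  note dp = jdisc_props[OF assms(1) d(1)] and ep = jdisc_props[OF assms(2) d(2)]
  obtain ds' a where ds: "ds = ds' @ [a]" using dp(1) by (metis append_butlast_last_id tpath_iff)
  obtain es' where es: "es = a # es'" using dp(3) ep(1,2) assms(3) ds by (cases es) (auto simp: tpath_iff)
  have jd: "jdisc (p \<cdot> q) (ds @ tl es)" by (rule jdisc_jconcat[OF assms(1-3) d(1,2)])
  have "successively near (ds' @ a # es')"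
    using jdisc_props(1)[OF _ jd] assms ds es by (simp add: tpath_iff)
  from walk_append[OF this] have "walk (ds @ tl es) = walk ds \<otimes>\<^bsub>Q\<^esub> walk es" using ds es by simp
  then show ?thesis using jd d assms by (auto simp: tracked_def G_jconcat)
qed

text \<open>A path inside a small ball may still have infinite length, whereas \<open>edge\<close>
  is defined through length. Hence \<open>g\<close> is first replaced by a homotopic path of finite
  length, whose segments of length at most \<open>\<theta>\<close> are covered by
  \<open>tracked_short\<close>.\<close>

lemma tracked_single:
  assumes "path g"
  shows "tracked ([g], [])"
proof -
  obtain h where h: "homotopic_paths UNIV g h" "path_length h < \<infinity>"
    using rectifiable assms unfolding homotopy_rectifiable_paths_def by auto
  have ph: "path h" using homotopic_paths_imp_path[OF h(1)] by simp
  have pseg: "path (seg a b h)" if "0 \<le> a" "a \<le> b" "b \<le> 1" for a b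
    unfolding path_def seg_def[abs_def]
  proof (rule continuous_on_compose2[OF ph[unfolded path_def]])
    show "(\<lambda>u. a + (b - a) * u) ` {0..1} \<subseteq> {0..1}"
    proof clarify
      fix u :: real assume "u \<in> {0..1}"
      then have "(b - a) * u \<le> b - a" "0 \<le> (b - a) * u"
        using that mult_left_le[of u "b - a"] by auto
      then show "a + (b - a) * u \<in> {0..1}" using that by simp
    qed
  qed (auto intro!: continuous_intros)
  have "tracked ([seg 0 1 h], [])"
  proof (rule rectifiable_path_induct[OF ph h(2), where Q = "\<lambda>a b. tracked ([seg a b h], [])" and e = \<theta>])
    show "0 < \<theta>" using theta_ge_1 by simp
    fix a b :: real assume ab: "0 \<le> a" "a \<le> b" "b \<le> 1" "path_length (seg a b h) \<le> ennreal \<theta>"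
    then have "short ([seg a b h], []) (seg a b h 0) (seg a b h 1)"
      using pseg[OF ab(1-3)] by (simp add: short_def jp_piece jlength_def)
    then show "tracked ([seg a b h], [])" by (rule tracked_short)
  next
    fix a b c :: real assume abc: "0 \<le> a" "a \<le> b" "b \<le> c" "c \<le> 1"
      and t: "tracked ([seg a b h], [])" "tracked ([seg b c h], [])"
    let ?p = "([seg a b h], []) :: ('s, 'a) jpath" and ?q = "([seg b c h], []) :: ('s, 'a) jpath"
    have j: "jp ?p" "jp ?q" "jfinish ?p = jstart ?q"
      using pseg[of a b] pseg[of b c] abc by (simp_all add: jp_piece) (simp add: seg_def)
    have "?p \<cdot> ?q \<asymp> ([seg a c h], [])"
      using jeq_single[OF homotopic_paths_seg_join[OF ph abc]] by (simp add: jconcat_single)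
    then show "tracked ([seg a c h], [])"
      using tracked_jconcat[OF j t] tracked_jeq[of "?p \<cdot> ?q"] j by simp
  qed
  then have "tracked ([h], [])" by (simp add: seg_def[abs_def])
  then show ?thesis
    using tracked_jeq[OF jp_piece[OF ph] jeq_sym[OF jeq_single[OF h(1)]]] by blast
qed

lemma tracked: "jp p \<Longrightarrow> tracked p"
proof (induction rule: jpath_step_induct)
  case (jeq p q)
  then show ?case using tracked_jeq by blast
next
  case (leap l x)
  then show ?case using tracked_short[OF short_leap] by blast
qed (use tracked_single tracked_jconcat in blast)+

lemma kernel_D: "kernel (J x0) (P x0) D = N"
proof
  interpret group_hom "J x0" "P x0" D by (rule group_hom_D)
  show "N \<subseteq> kernel (J x0) (P x0) D"
    by (rule group.generate_subgroup_incl[OF group_J FT_subset_kernel subgroup_kernel])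
  show "kernel (J x0) (P x0) D \<subseteq> N"
  proof
    fix A assume A: "A \<in> kernel (J x0) (P x0) D"
    then obtain p where p: "A = jcl p" "jp p" "jstart p = x0" "jfinish p = x0"
      by (auto simp: kernel_def carrier_J)
    obtain zs where zs: "jdisc p zs" using jdisc_exists[OF p(2)] by blast
    have "cls zs = cls [x0]"
      using A D_jcl[OF p(2) zs] p(1) by (simp add: kernel_def one_discrete_pi1)
    then have "zs \<simeq> [x0]"
      using cls_eq_iff[of zs "[x0]"] jdisc_props(1)[OF p(2) zs] by (simp add: tpath_iff[of "[x0]"])
    \<comment> \<open>\<open>walk [x0]\<close> is the empty product.\<close>
    then have "G p = \<one>\<^bsub>Q\<^esub>" using trackedD[OF tracked[OF p(2)] p(2) zs] walk_theq by simp
    then have "N #>\<^bsub>J x0\<^esub> A = N" using p F_closed by (simp add: G_def one_Q)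
    then show "A \<in> N"
      using group.coset_join1[OF group_J _ _ group.generate_is_subgroup[OF group_J FT_carrier]]
        group.generate_incl[OF group_J FT_carrier] A by (simp add: kernel_def)
  qed
qed

end

theorem theorem5p3:
  fixes S :: "'s set"
    and \<phi> :: "'s letter list \<Rightarrow> 'a::metric_space \<Rightarrow> 'a"
    and x0 :: 'a
    and \<theta> :: real
  assumes "path_connected (UNIV :: 'a set)"
    and "locally path_connected (UNIV :: 'a set)"
    and "finite S"
    and "acts_by_homeomorphisms S \<phi>"
    and "\<theta> \<ge> 1"
    and "homotopy_rectifiable_paths (UNIV :: 'a set)"
    and "jumping_geodesic S \<phi>"
  shows "let J = jumping_pi1 S \<phi> x0;
             P = discrete_pi1 (warped_dist S \<phi>) \<theta> x0;
             D = discretisation S \<phi> \<theta>;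
             N = generate J (FT S \<phi> \<theta> x0)
         in group_hom J P D \<and> D ` carrier J = carrier P \<and> kernel J P D = N \<and> P \<cong> J Mod N"
proof -
  interpret geodesic_scale S \<phi> \<theta> x0
    by unfold_locales (use assms in auto)
  have surj: "D ` carrier (J x0) = carrier (P x0)"
    using short_exists by (rule D_surj)
  have "J x0 Mod N \<cong> P x0"
    using group_hom.FactGroup_iso[OF group_hom_D surj] unfolding kernel_D .
  then have "P x0 \<cong> J x0 Mod N" by (rule group.iso_sym[OF group_Q[unfolded Q_def]])
  then show ?thesis unfolding Let_def using group_hom_D surj kernel_D by blast
qed

end
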